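(* Let $m_n\to\infty$ be positive integers, let $w_n:\mathcal{Z}\to\mathbb{R}^{m_n}$ be measurable functions with $\int w_n\,dQ=0$ and $\int|w_n|^2\,dQ<\infty$, let $W_n=\int w_nw_n^{\top}\,dQ$, and let $\hat w_n$ be an estimator of $w_n$ based on $Z_1,\dots,Z_n$, with $\hat W_n=\frac1n\sum_{j=1}^n\hat w_n(Z_j)\hat w_n^{\top}(Z_j)$. Suppose the sequence $W_n$ is regular and that $$m_n\max_{1\le j\le n}|\hat w_n(Z_j)|=o_p(n^{1/2}),\qquad |\hat W_n-W_n|_o=o_p(m_n^{-1/2}),$$ $$\frac1n\sum_{j=1}^n\hat w_n(Z_j)=\frac1n\sum_{j=1}^nv_n(Z_j)+o_p(n^{-1/2})$$ for some measurable function $v_n$ from $\mathcal{Z}$ into $\mathbb{R}^{m_n}$ such that $\int v_n\,dQ=0$ and $|v_n|$ is Lindeberg. Furthermore, assume that the dispersion matrix $$U_n=W_n^{-1/2}\int v_nv_n^{\top}\,dQ\;W_n^{-1/2}$$ of $W_n^{-1/2}v_n(Z)$ satisfies $|U_n|_o=O(1)$ and that $m_n/\operatorname{trace}(U_n^2)$ is bounded. Then, as $m_n$ tends to infinity with $n$, $$\frac{-2\log\hat{\mathscr{R}}_n-\operatorname{trace}(U_n)}{\sqrt{2\operatorname{trace}(U_n^2)}}$$ is asymptotically standard normal.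
   Context: $(\mathcal{Z},\mathscr{S})$ is a measurable space; $Z_1,\dots,Z_n$ are independent copies of a $\mathcal{Z}$-valued random variable $Z$ with distribution $Q$ (the same for all $n$). $|\cdot|$ is the Euclidean norm (for vectors, $o_p$ statements are in this norm) and $|A|_o=\sup_{|u|=1}|Au|$ is the operator norm. An estimator $\hat w_n$ of $w_n$ is an $\mathbb{R}^{m_n}$-valued function on $\mathcal{Z}$ depending on the observations $Z_1,\dots,Z_n$, such that $\hat w_n(Z_j)$ are random vectors. A sequence $W_n$ of $m_n\times m_n$ dispersion (covariance) matrices is regular if $0<\inf_n\inf_{|u|=1}u^{\top}W_nu\le\sup_n\sup_{|u|=1}u^{\top}W_nu<\infty$. A sequence $f_n$ of measurable functions from $\mathcal{Z}$ to $\mathbb{R}$ is Lindeberg if $\int|f_n|^2\mathbf{1}[|f_n|>\epsilon\sqrt n]\,dQ\to0$ for every $\epsilon>0$. With $\mathscr{P}_n=\{\pi\in[0,1]^n:\pi_1+\dots+\pi_n=1\}$, $$\hat{\mathscr{R}}_n=\sup\Big\{\prod_{j=1}^n n\pi_j:\ \pi\in\mathscr{P}_n,\ \frac1n\sum_{j=1}^n\pi_j\hat w_n(Z_j)=0\Big\},$$ with the supremum taken in $[0,\infty)$, so that $\sup\emptyset=0$ and $-2\log 0=+\infty$. *)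

theory Defs
  imports "HOL-Probability.Probability" "Jordan_Normal_Form.Matrix"
begin

unbundle no vec_syntax
unbundle no inner_syntax
hide_type (open) Finite_Cartesian_Product.vec
hide_const (open) Finite_Cartesian_Product.vec Finite_Cartesian_Product.mat

text \<open>Since the dimension varies with the sample size, vectors and matrices are the
  explicitly dimensioned ones of \<^theory>\<open>Jordan_Normal_Form.Matrix\<close>.\<close>

definition vnorm :: "real vec \<Rightarrow> real" where
  "vnorm x = sqrt (x \<bullet> x)"

definition unit_sphere :: "nat \<Rightarrow> real vec set" where
  "unit_sphere d = {u \<in> carrier_vec d. vnorm u = 1}"

definition op_norm :: "real mat \<Rightarrow> real" where
  "op_norm A = (SUP u\<in>unit_sphere (dim_col A). vnorm (A *\<^sub>v u))"

definition mat_trace :: "real mat \<Rightarrow> real" where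
  "mat_trace A = (\<Sum>i<dim_row A. A $$ (i, i))"

definition outer :: "real vec \<Rightarrow> real vec \<Rightarrow> real mat" where
  "outer x y = mat (dim_vec x) (dim_vec y) (\<lambda>(i, k). x $ i * y $ k)"

text \<open>The set below has exactly one element when \<open>A\<close> is symmetric positive definite, so
  the choice operator yields the usual inverse square root.\<close>

definition inv_sqrt_mat :: "real mat \<Rightarrow> real mat" where
  "inv_sqrt_mat A = (SOME B. B \<in> carrier_mat (dim_row A) (dim_row A) \<and> transpose_mat B = B \<and>
     (\<forall>u\<in>unit_sphere (dim_row A). 0 < u \<bullet> (B *\<^sub>v u)) \<and> B * B * A = 1\<^sub>m (dim_row A))"

text \<open>Measurability, integrals and averages of vectors and matrices are entrywise.\<close>

definition measurable_vec :: "nat \<Rightarrow> 'a measure \<Rightarrow> ('a \<Rightarrow> real vec) \<Rightarrow> bool" where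
  "measurable_vec d M f \<longleftrightarrow> (\<forall>x\<in>space M. f x \<in> carrier_vec d) \<and>
     (\<forall>i<d. (\<lambda>x. f x $ i) \<in> borel_measurable M)"

definition integral_vec :: "nat \<Rightarrow> 'a measure \<Rightarrow> ('a \<Rightarrow> real vec) \<Rightarrow> real vec" where
  "integral_vec d M f = vec d (\<lambda>i. \<integral>x. f x $ i \<partial>M)"

definition integral_mat :: "nat \<Rightarrow> 'a measure \<Rightarrow> ('a \<Rightarrow> real mat) \<Rightarrow> real mat" where
  "integral_mat d M f = mat d d (\<lambda>(i, k). \<integral>x. f x $$ (i, k) \<partial>M)"

definition mean_vec :: "nat \<Rightarrow> nat \<Rightarrow> (nat \<Rightarrow> real vec) \<Rightarrow> real vec" where
  "mean_vec d n x = vec d (\<lambda>i. (\<Sum>j\<in>{1..n}. x j $ i) / real n)"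

definition mean_mat :: "nat \<Rightarrow> nat \<Rightarrow> (nat \<Rightarrow> real mat) \<Rightarrow> real mat" where
  "mean_mat d n X = mat d d (\<lambda>(i, k). (\<Sum>j\<in>{1..n}. X j $$ (i, k)) / real n)"

text \<open>Sequences are indexed by sample sizes \<open>n \<ge> 1\<close>. The extrema are taken in the extended
  reals, where they always exist.\<close>

definition regular_mats :: "(nat \<Rightarrow> nat) \<Rightarrow> (nat \<Rightarrow> real mat) \<Rightarrow> bool" where
  "regular_mats m W \<longleftrightarrow>
     0 < (INF n\<in>{1..}. INF u\<in>unit_sphere (m n). ereal (u \<bullet> (W n *\<^sub>v u))) \<and>
     (SUP n\<in>{1..}. SUP u\<in>unit_sphere (m n). ereal (u \<bullet> (W n *\<^sub>v u))) < \<infinity>"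

definition lindeberg :: "'z measure \<Rightarrow> (nat \<Rightarrow> 'z \<Rightarrow> real) \<Rightarrow> bool" where
  "lindeberg Q f \<longleftrightarrow> (\<forall>\<epsilon>>0. (\<lambda>n. \<integral>\<^sup>+z. ennreal (\<bar>f n z\<bar>\<^sup>2) *
     indicator {z. \<bar>f n z\<bar> > \<epsilon> * sqrt (real n)} z \<partial>Q) \<longlonglongrightarrow> 0)"

text \<open>\<open>X\<^sub>n / a\<^sub>n\<close> tends to \<open>0\<close> in probability. Meant for measurable \<open>X\<^sub>n\<close>, as \<^const>\<open>measure\<close> is \<open>0\<close> on
  non-measurable sets.\<close>

definition small_o_p :: "'w measure \<Rightarrow> (nat \<Rightarrow> 'w \<Rightarrow> real) \<Rightarrow> (nat \<Rightarrow> real) \<Rightarrow> bool" where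
  "small_o_p M X a \<longleftrightarrow>
     (\<forall>\<epsilon>>0. (\<lambda>n. measure M {\<omega> \<in> space M. \<bar>X n \<omega> / a n\<bar> > \<epsilon>}) \<longlonglongrightarrow> 0)"

text \<open>For extended-real statistics, a distribution function that converges pointwise to the
  (continuous) standard normal one. Mass at infinity is thereby forced to vanish.\<close>

definition asymp_std_normal :: "'w measure \<Rightarrow> (nat \<Rightarrow> 'w \<Rightarrow> ereal) \<Rightarrow> bool" where
  "asymp_std_normal M T \<longleftrightarrow> (\<forall>t::real.
     (\<lambda>n. measure M {\<omega> \<in> space M. T n \<omega> \<le> ereal t}) \<longlonglongrightarrow> cdf std_normal_distribution t)"

definition prob_weights :: "nat \<Rightarrow> (nat \<Rightarrow> real) set" where
  "prob_weights n = {\<pi> \<in> {1..n} \<rightarrow>\<^sub>E {0..1}. (\<Sum>j\<in>{1..n}. \<pi> j) = 1}"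

text \<open>The inserted \<open>0\<close> realises the supremum within \<open>[0, \<infinity>)\<close>: all other members are nonnegative,
  and the empty set gets supremum \<open>0\<close>.\<close>

definition emp_lik :: "nat \<Rightarrow> nat \<Rightarrow> (nat \<Rightarrow> real vec) \<Rightarrow> real" where
  "emp_lik d n x = Sup (insert 0 {\<Prod>j\<in>{1..n}. real n * \<pi> j | \<pi>.
     \<pi> \<in> prob_weights n \<and> mean_vec d n (\<lambda>j. \<pi> j \<cdot>\<^sub>v x j) = 0\<^sub>v d})"

definition neg2log :: "real \<Rightarrow> ereal" where
  "neg2log r = (if r = 0 then \<infinity> else ereal (- 2 * ln r))"

end

theory Submission
  imports Defs
begin

text \<open>Write \<open>B\<close> for the inverse square root of \<open>W\<^sub>n\<close>, \<open>\<xi>\<^sub>j = B v\<^sub>n(Z\<^sub>j)\<close> and \<open>S = \<Sum>\<^sub>j \<xi>\<^sub>j\<close>.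

  By Lagrange duality \<open>- ln R\<close> is the maximum over \<open>z\<close> of the concave function
  \<open>\<Sum>\<^sub>j ln (1 + z \<bullet> x\<^sub>j)\<close>. Under the rate conditions its maximiser lies in a ball of radius of order
  \<open>sqrt (m / n)\<close>, on which a third order Taylor expansion and the closeness of the sample covariance
  to \<open>W\<^sub>n\<close> replace it by a quadratic with maximum \<open>n / 2\<close> times the squared norm of \<open>B\<close> applied to the
  sample mean. Hence \<open>- 2 ln R\<close> equals \<open>S \<bullet> S / n\<close> up to \<open>o(sqrt m)\<close> in probability.

  For the quadratic form, the diagonal terms \<open>\<xi>\<^sub>j \<bullet> \<xi>\<^sub>j\<close> obey a law of large numbers by truncation. The
  standardised off-diagonal part \<open>Y\<close> is treated by Stein's method for characteristic functions
  (Tikhomirov): splitting off one observation at a time shows that \<open>\<psi>(t) = E exp (\<i> t Y)\<close> satisfies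
  \<open>\<psi>'(t) = - t \<psi>(t) + o(1)\<close> locally uniformly, the only nontrivial input being that \<open>S \<bullet> U S / n\<close>
  concentrates around \<open>trace (U\<^sup>2)\<close>.\<close>

section \<open>Euclidean coordinates\<close>

text \<open>The rate conditions are exactly what a radius r of order sqrt (m / n) asks for. There n
  r^2 has order m, so an error o(m^(-1/2)) in the sample covariance costs o(sqrt m). The cubic
  Taylor term is at most n r^2 times r max |x_j|, which is o(sqrt m) because m max |x_j| = o(sqrt
  n). Both vanish after division by sqrt (2 trace (U^2)), which is at least of order sqrt m.

  The obstacle in the probabilistic half is that v_n has only second moments and the Lindeberg
  property: neither the variance of the diagonal terms nor a third moment of the increments is
  available. Both are replaced by truncation of |X| at e sqrt n, where e is fixed while n grows and
  tends to 0 only afterwards.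

  Two tasks come from the formal setting. The inverse square root is a choice, so a witness is built
  as a binomial series. And \<open>measure\<close> is 0 on non-measurable sets, so events about
  \<open>emp_lik\<close> and \<open>op_norm\<close> must be shown measurable, which is done by
  reducing them to countably many conditions.

  Since the dimension changes with n, vectors are functions on nat with the dimension as an explicit
  argument.\<close>

definition dot :: "nat \<Rightarrow> (nat \<Rightarrow> real) \<Rightarrow> (nat \<Rightarrow> real) \<Rightarrow> real" where
  "dot d x y = (\<Sum>i<d. x i * y i)"

definition nrm :: "nat \<Rightarrow> (nat \<Rightarrow> real) \<Rightarrow> real" where
  "nrm d x = sqrt (dot d x x)"

definition mv :: "nat \<Rightarrow> (nat \<Rightarrow> nat \<Rightarrow> real) \<Rightarrow> (nat \<Rightarrow> real) \<Rightarrow> nat \<Rightarrow> real" where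
  "mv d A x i = (\<Sum>k<d. A i k * x k)"

lemma dot_commute: "dot d x y = dot d y x"
  by (simp add: dot_def mult.commute)

lemma dot_add_left: "dot d (\<lambda>i. x i + y i) z = dot d x z + dot d y z"
  and dot_add_right: "dot d z (\<lambda>i. x i + y i) = dot d z x + dot d z y"
  and dot_diff_left: "dot d (\<lambda>i. x i - y i) z = dot d x z - dot d y z"
  and dot_diff_right: "dot d z (\<lambda>i. x i - y i) = dot d z x - dot d z y"
  and dot_scale_left: "dot d (\<lambda>i. c * x i) z = c * dot d x z"
  and dot_scale_right: "dot d z (\<lambda>i. c * x i) = c * dot d z x"
  by (simp_all add: dot_def algebra_simps sum.distrib sum_subtractf sum_distrib_left)

lemma dot_sum_right: "dot d z (\<lambda>i. \<Sum>j\<in>J. f j i) = (\<Sum>j\<in>J. dot d z (f j))"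
  unfolding dot_def sum_distrib_left by (rule sum.swap)

lemma dot_cong: "(\<And>i. i < d \<Longrightarrow> x i = x' i) \<Longrightarrow> (\<And>i. i < d \<Longrightarrow> y i = y' i) \<Longrightarrow> dot d x y = dot d x' y'"
  by (simp add: dot_def)

lemma dot_self_nonneg [simp]: "0 \<le> dot d x x"
  by (simp add: dot_def sum_nonneg)

lemma nrm_nonneg [simp]: "0 \<le> nrm d x"
  by (simp add: nrm_def)

lemma nrm_power2: "(nrm d x)\<^sup>2 = dot d x x"
  by (simp add: nrm_def)

lemma nrm_scale: "nrm d (\<lambda>i. c * x i) = \<bar>c\<bar> * nrm d x"
  by (simp add: nrm_def dot_scale_left dot_scale_right real_sqrt_mult mult.assoc[symmetric]
      flip: power2_eq_square)

lemma dot_le_nrm: "\<bar>dot d x y\<bar> \<le> nrm d x * nrm d y"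
proof -
  have "(dot d x y)\<^sup>2 \<le> dot d x x * dot d y y"
    unfolding dot_def using Cauchy_Schwarz_ineq_sum[of x y "{..<d}"] by (simp add: power2_eq_square)
  then have "sqrt ((dot d x y)\<^sup>2) \<le> sqrt (dot d x x * dot d y y)"
    by (rule real_sqrt_le_mono)
  then show ?thesis
    by (simp add: nrm_def real_sqrt_mult)
qed

lemma nrm_triangle: "nrm d (\<lambda>i. x i + y i) \<le> nrm d x + nrm d y"
proof -
  have "(nrm d (\<lambda>i. x i + y i))\<^sup>2 = (nrm d x)\<^sup>2 + 2 * dot d x y + (nrm d y)\<^sup>2"
    by (simp add: nrm_power2 dot_add_left dot_add_right dot_commute[of d y x])
  also have "\<dots> \<le> (nrm d x + nrm d y)\<^sup>2"
    using dot_le_nrm[of d x y] unfolding power2_sum by linarith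
  finally show ?thesis
    by (rule power2_le_imp_le) simp
qed

lemma abs_coord_le_nrm: "i < d \<Longrightarrow> \<bar>x i\<bar> \<le> nrm d x"
proof -
  assume "i < d"
  then have "x i * x i \<le> dot d x x"
    unfolding dot_def by (intro member_le_sum) auto
  then have "sqrt ((x i)\<^sup>2) \<le> nrm d x"
    unfolding nrm_def by (intro real_sqrt_le_mono) (simp add: power2_eq_square)
  then show ?thesis by simp
qed

section \<open>Inverse square roots of positive definite matrices\<close>

lemma quadratic_nonneg_discrim:
  fixes a b c :: real
  assumes "\<And>t. 0 \<le> a + 2 * t * b + t\<^sup>2 * c" and "0 \<le> c"
  shows "b\<^sup>2 \<le> a * c"
proof (cases "c = 0")
  case True
  have "b = 0"
  proof (rule ccontr)
    assume "b \<noteq> 0"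
    \<comment> \<open>At this t the affine function a + 2 t b takes the value -1.\<close>
    then show False using assms(1)[of "- (a + 1) / (2 * b)"] True by (simp add: field_simps)
  qed
  then show ?thesis using True by simp
next
  case False
  then have c: "0 < c" using assms(2) by simp
  have "0 \<le> a + 2 * (- b / c) * b + (- b / c)\<^sup>2 * c" by (rule assms(1))
  also have "\<dots> = a - b\<^sup>2 / c" using c by (simp add: field_simps power2_eq_square)
  finally show ?thesis using c by (simp add: field_simps)
qed

lemma mv_add: "mv d A (\<lambda>i. u i + v i) = (\<lambda>i. mv d A u i + mv d A v i)"
  and mv_diff: "mv d A (\<lambda>i. u i - v i) = (\<lambda>i. mv d A u i - mv d A v i)"
  and mv_scale: "mv d A (\<lambda>i. c * u i) = (\<lambda>i. c * mv d A u i)"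
  by (auto simp: mv_def fun_eq_iff algebra_simps sum.distrib sum_subtractf sum_distrib_left)

lemma psd_cauchy_schwarz:
  assumes sym: "\<And>u v. dot d u (mv d A v) = dot d v (mv d A u)"
    and nonneg: "\<And>u. 0 \<le> dot d u (mv d A u)"
  shows "(dot d u (mv d A v))\<^sup>2 \<le> dot d u (mv d A u) * dot d v (mv d A v)"
proof (rule quadratic_nonneg_discrim[OF _ nonneg])
  fix t
  have "0 \<le> dot d (\<lambda>i. u i + t * v i) (mv d A (\<lambda>i. u i + t * v i))" by (rule nonneg)
  also have "\<dots> = dot d u (mv d A u) + 2 * t * dot d u (mv d A v) + t\<^sup>2 * dot d v (mv d A v)"
    using sym[of v u]
    by (simp add: mv_add mv_scale dot_add_left dot_add_right dot_scale_left dot_scale_right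
        power2_eq_square algebra_simps)
  finally show "0 \<le> dot d u (mv d A u) + 2 * t * dot d u (mv d A v) + t\<^sup>2 * dot d v (mv d A v)" .
qed

text \<open>Cauchy-Schwarz for the form of A with v = A u gives |A u|^4 <= (A u . A A u) (u . A u),
  and the first factor is at most q |A u|^2. Dividing by |A u|^2 turns a bound on the form into a
  bound on A without any spectral theory.\<close>

lemma psd_mv_square_le:
  assumes sym: "\<And>u v. dot d u (mv d A v) = dot d v (mv d A u)"
    and nonneg: "\<And>u. 0 \<le> dot d u (mv d A u)"
    and upper: "\<And>u. dot d u (mv d A u) \<le> q * dot d u u"
  shows "dot d (mv d A u) (mv d A u) \<le> q * dot d u (mv d A u)"
proof -
  let ?v = "mv d A u"
  have "dot d ?v ?v * dot d ?v ?v \<le> dot d ?v (mv d A ?v) * dot d u ?v"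
    using psd_cauchy_schwarz[OF sym nonneg, of ?v u] by (simp add: power2_eq_square)
  also have "\<dots> \<le> (q * dot d ?v ?v) * dot d u ?v"
    using nonneg upper by (intro mult_right_mono) auto
  finally have le: "dot d ?v ?v * dot d ?v ?v \<le> dot d ?v ?v * (q * dot d u ?v)" by (simp add: mult_ac)
  show ?thesis
  proof (cases "dot d ?v ?v = 0")
    case True
    then have "nrm d ?v = 0" by (simp add: nrm_def)
    then have "dot d u ?v = 0" using dot_le_nrm[of d u ?v] by simp
    then show ?thesis using True by simp
  next
    case False
    then have "0 < dot d ?v ?v" using dot_self_nonneg[of d ?v] by linarith
    then show ?thesis using le by (simp add: mult_le_cancel_left_pos)
  qed
qed

text \<open>The coefficients of the power series of \<open>(1 - t) powr (-1/2)\<close>; by Vandermonde their Cauchy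
  square is the geometric series.\<close>

definition isqrt_coeff :: "nat \<Rightarrow> real" where
  "isqrt_coeff k = pochhammer (1 / 2) k / fact k"

lemma isqrt_coeff_nonneg: "0 \<le> isqrt_coeff k"
  by (simp add: isqrt_coeff_def pochhammer_nonneg)

lemma isqrt_coeff_0: "isqrt_coeff 0 = 1"
  by (simp add: isqrt_coeff_def)

lemma isqrt_coeff_convolution: "(\<Sum>k\<le>n. isqrt_coeff k * isqrt_coeff (n - k)) = 1"
proof -
  have "(\<Sum>k\<le>n. isqrt_coeff k * isqrt_coeff (n - k))
      = (\<Sum>k\<le>n. of_nat (n choose k) * pochhammer (1 / 2) k * pochhammer (1 / 2) (n - k)) / fact n"
    unfolding sum_divide_distrib
    by (intro sum.cong refl) (simp add: isqrt_coeff_def binomial_fact field_simps)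
  also have "\<dots> = pochhammer (1 / 2 + 1 / 2) n / (fact n :: real)"
    by (simp only: pochhammer_binomial_sum)
  also have "\<dots> = 1" by (simp add: pochhammer_fact[symmetric])
  finally show ?thesis .
qed

lemma isqrt_coeff_le_1: "isqrt_coeff n \<le> 1"
proof -
  have "isqrt_coeff 0 * isqrt_coeff (n - 0) \<le> (\<Sum>k\<le>n. isqrt_coeff k * isqrt_coeff (n - k))"
    by (rule member_le_sum) (auto simp: isqrt_coeff_nonneg)
  then show ?thesis by (simp add: isqrt_coeff_convolution isqrt_coeff_0)
qed

text \<open>Standard basis vector; read as a function of both arguments it is also the identity
  matrix, and is used as such in \<open>mv d unitv\<close>.\<close>

definition unitv :: "nat \<Rightarrow> nat \<Rightarrow> real" where
  "unitv j i = (if i = j then 1 else 0)"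

lemma dot_unitv: "j < d \<Longrightarrow> dot d (unitv j) u = u j"
  by (simp add: dot_def unitv_def if_distrib[of "\<lambda>x. x * _"] cong: if_cong)

lemma nrm_unitv: "j < d \<Longrightarrow> nrm d (unitv j) = 1"
  by (simp add: nrm_def dot_unitv) (simp add: unitv_def)

lemma mv_unitv: "j < d \<Longrightarrow> mv d A (unitv j) i = A i j"
  by (simp add: mv_def unitv_def if_distrib[of "\<lambda>x. _ * x"] cong: if_cong)

section \<open>The binomial series for (I - X)^(-1/2), where 0 <= X <= q < 1\<close>

context
  fixes d :: nat and X :: "nat \<Rightarrow> nat \<Rightarrow> real" and q :: real
  assumes X_sym: "\<And>u v. dot d u (mv d X v) = dot d v (mv d X u)"
    and X_nonneg: "\<And>u. 0 \<le> dot d u (mv d X u)"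
    and X_upper: "\<And>u. dot d u (mv d X u) \<le> q * dot d u u"
    and q: "0 \<le> q" "q < 1"
begin

abbreviation (input) T where "T k \<equiv> (mv d X ^^ k)"

definition pow_entry :: "nat \<Rightarrow> nat \<Rightarrow> nat \<Rightarrow> real" where
  "pow_entry k i j = (mv d X ^^ k) (unitv j) i"

lemma dot_pow: "dot d u (T k v) = dot d (T k u) v"
proof (induction k arbitrary: u v)
  case (Suc k)
  have "dot d u (T (Suc k) v) = dot d (mv d X u) (T k v)"
    using X_sym[of u "T k v"] by (simp add: dot_commute)
  also have "\<dots> = dot d (T (Suc k) u) v"
    by (simp add: Suc funpow_swap1)
  finally show ?case .
qed simp

lemma nrm_pow: "nrm d (T k u) \<le> q ^ k * nrm d u"
proof (induction k)
  case (Suc k)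
  let ?v = "T k u"
  have "dot d (mv d X ?v) (mv d X ?v) \<le> q * dot d ?v (mv d X ?v)"
    by (rule psd_mv_square_le[OF X_sym X_nonneg X_upper])
  also have "\<dots> \<le> q * (q * dot d ?v ?v)"
    by (intro mult_left_mono X_upper q)
  finally have "nrm d (mv d X ?v) \<le> sqrt (q\<^sup>2 * dot d ?v ?v)"
    unfolding nrm_def by (intro real_sqrt_le_mono) (simp add: power2_eq_square mult_ac)
  also have "\<dots> = q * nrm d ?v" using q by (simp add: real_sqrt_mult nrm_def)
  also have "\<dots> \<le> q * (q ^ k * nrm d u)" by (intro mult_left_mono Suc q)
  finally show ?case by (simp add: mult_ac)
qed simp

text \<open>Half of the power is moved to the left argument. With w = X^(k div 2) u the form becomes
  w . w or w . X w, according to the parity of k.\<close>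

lemma dot_pow_nonneg: "0 \<le> dot d u (T k u)"
proof -
  have "dot d u (T k u) = dot d (T (k div 2) u) (T (k mod 2) (T (k div 2) u))"
  proof -
    have "k = k div 2 + (k mod 2 + k div 2)" by presburger
    then have "T k u = T (k div 2) (T (k mod 2) (T (k div 2) u))"
      by (metis comp_apply funpow_add)
    then show ?thesis by (simp only: dot_pow[of u])
  qed
  moreover have "k mod 2 = 0 \<or> k mod 2 = 1" by presburger
  ultimately show ?thesis using X_nonneg by (auto simp del: mod_less_eq_dividend)
qed

lemma pow_entry_mult:
  assumes "i < d" "j < d"
  shows "(\<Sum>l<d. pow_entry k l i * pow_entry k' l j) = pow_entry (k + k') i j"
proof -
  have "(\<Sum>l<d. pow_entry k l i * pow_entry k' l j) = dot d (T k (unitv i)) (T k' (unitv j))"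
    by (simp add: dot_def pow_entry_def)
  also have "\<dots> = dot d (unitv i) (T (k + k') (unitv j))"
    by (simp add: dot_pow[symmetric] funpow_add)
  finally show ?thesis using assms by (simp add: dot_unitv pow_entry_def)
qed

lemma pow_entry_sym: "i < d \<Longrightarrow> j < d \<Longrightarrow> pow_entry k i j = pow_entry k j i"
  using dot_pow[of "unitv i" k "unitv j"] by (simp add: dot_unitv dot_commute[of d "T k (unitv i)"] pow_entry_def)

lemma pow_entry_apply: "i < d \<Longrightarrow> T k u i = (\<Sum>j<d. pow_entry k i j * u j)"
proof -
  assume i: "i < d"
  have "T k u i = dot d (T k (unitv i)) u"
    using dot_pow[of "unitv i" k u] i by (simp add: dot_unitv)
  then show ?thesis using i by (simp add: dot_def pow_entry_sym[OF i] pow_entry_def[of k _ i])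
qed

lemma pow_entry_bound: "i < d \<Longrightarrow> j < d \<Longrightarrow> \<bar>pow_entry k i j\<bar> \<le> q ^ k"
  using abs_coord_le_nrm[of i d "T k (unitv j)"] nrm_pow[of k "unitv j"]
  by (simp add: nrm_unitv pow_entry_def)

lemma pow_entry_summable:
  assumes "i < d" "j < d"
  shows "summable (\<lambda>k. norm (isqrt_coeff k * pow_entry k i j))"
proof (rule summable_comparison_test)
  show "\<exists>N. \<forall>n\<ge>N. norm (norm (isqrt_coeff n * pow_entry n i j)) \<le> q ^ n"
  proof (intro exI allI impI)
    fix n :: nat
    have "\<bar>isqrt_coeff n\<bar> * \<bar>pow_entry n i j\<bar> \<le> 1 * q ^ n"
      using isqrt_coeff_nonneg[of n] isqrt_coeff_le_1[of n] pow_entry_bound[OF assms]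
      by (intro mult_mono) auto
    then show "norm (norm (isqrt_coeff n * pow_entry n i j)) \<le> q ^ n" by (simp add: abs_mult)
  qed
  show "summable (\<lambda>n. q ^ n)" using q by (intro summable_geometric) auto
qed

text \<open>An entry of the matrix (I - X)^(-1/2).\<close>

definition isqrt_entry :: "nat \<Rightarrow> nat \<Rightarrow> real" where
  "isqrt_entry i j = (\<Sum>k. isqrt_coeff k * pow_entry k i j)"

lemma isqrt_entry_sums:
  "i < d \<Longrightarrow> j < d \<Longrightarrow> (\<lambda>k. isqrt_coeff k * pow_entry k i j) sums isqrt_entry i j"
  unfolding isqrt_entry_def by (rule summable_sums[OF summable_norm_cancel[OF pow_entry_summable]])

lemma isqrt_entry_sym: "i < d \<Longrightarrow> j < d \<Longrightarrow> isqrt_entry i j = isqrt_entry j i"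
  by (simp add: isqrt_entry_def pow_entry_sym[of i j])

text \<open>The Cauchy product is taken entry by entry. The convolution identity collapses its
  coefficients to 1, which leaves the Neumann series of (I - X)^(-1).\<close>

lemma isqrt_square_sums:
  assumes i: "i < d" and j: "j < d"
  shows "(\<lambda>k. pow_entry k i j) sums (\<Sum>l<d. isqrt_entry i l * isqrt_entry l j)"
proof -
  have "(\<lambda>n. \<Sum>k\<le>n. isqrt_coeff k * pow_entry k l i * (isqrt_coeff (n - k) * pow_entry (n - k) l j))
      sums (isqrt_entry l i * isqrt_entry l j)" if "l < d" for l
    unfolding isqrt_entry_def using that i j
    by (intro Cauchy_product_sums pow_entry_summable)
  then have "(\<lambda>n. \<Sum>l<d. \<Sum>k\<le>n. isqrt_coeff k * pow_entry k l i * (isqrt_coeff (n - k) * pow_entry (n - k) l j))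
      sums (\<Sum>l<d. isqrt_entry l i * isqrt_entry l j)"
    by (intro sums_sum) auto
  also have "(\<lambda>n. \<Sum>l<d. \<Sum>k\<le>n. isqrt_coeff k * pow_entry k l i * (isqrt_coeff (n - k) * pow_entry (n - k) l j))
      = (\<lambda>n. pow_entry n i j)"
  proof
    fix n
    have "(\<Sum>l<d. \<Sum>k\<le>n. isqrt_coeff k * pow_entry k l i * (isqrt_coeff (n - k) * pow_entry (n - k) l j))
      = (\<Sum>k\<le>n. isqrt_coeff k * isqrt_coeff (n - k) * (\<Sum>l<d. pow_entry k l i * pow_entry (n - k) l j))"
      unfolding sum_distrib_left by (subst sum.swap) (simp add: mult_ac)
    also have "\<dots> = (\<Sum>k\<le>n. isqrt_coeff k * isqrt_coeff (n - k)) * pow_entry n i j"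
      unfolding sum_distrib_right by (intro sum.cong refl) (simp add: pow_entry_mult[OF i j])
    finally show "(\<Sum>l<d. \<Sum>k\<le>n. isqrt_coeff k * pow_entry k l i * (isqrt_coeff (n - k) * pow_entry (n - k) l j))
      = pow_entry n i j" by (simp add: isqrt_coeff_convolution)
  qed
  finally show ?thesis using i by (simp add: isqrt_entry_sym[of _ i])
qed

text \<open>Multiplying the Neumann series by I - X makes it telescope, and the powers of X tend to
  0 because their entries are at most q^k.\<close>

lemma isqrt_inverse:
  assumes i: "i < d" and j: "j < d"
  shows "(\<Sum>l<d. (\<Sum>m<d. isqrt_entry i m * isqrt_entry m l) * (unitv j l - X l j)) = unitv j i"
proof (rule sums_unique2)
  show "(\<lambda>k. \<Sum>l<d. pow_entry k i l * (unitv j l - X l j))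
      sums (\<Sum>l<d. (\<Sum>m<d. isqrt_entry i m * isqrt_entry m l) * (unitv j l - X l j))"
    using i by (intro sums_sum sums_mult2 isqrt_square_sums) auto
  have eq: "(\<Sum>l<d. pow_entry k i l * (unitv j l - X l j)) = pow_entry k i j - pow_entry (Suc k) i j" for k
  proof -
    have "pow_entry 1 l j = X l j" for l
      by (simp add: pow_entry_def mv_unitv[OF j])
    then have "(\<Sum>l<d. pow_entry k i l * X l j) = (\<Sum>l<d. pow_entry k l i * pow_entry 1 l j)"
      using i by (intro sum.cong refl) (simp add: pow_entry_sym[of i])
    also have "\<dots> = pow_entry (Suc k) i j" using pow_entry_mult[OF i j, of k 1] by simp
    finally have "(\<Sum>l<d. pow_entry k i l * X l j) = pow_entry (Suc k) i j" .
    moreover have "(\<Sum>l<d. pow_entry k i l * unitv j l) = pow_entry k i j"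
      using j dot_unitv[of j d "pow_entry k i"] by (simp add: dot_def mult.commute)
    ultimately show ?thesis by (simp add: algebra_simps sum_subtractf)
  qed
  have "(\<lambda>k. pow_entry k i j) \<longlonglongrightarrow> 0"
  proof (rule Lim_null_comparison)
    show "\<forall>\<^sub>F k in sequentially. norm (pow_entry k i j) \<le> q ^ k"
      using pow_entry_bound[OF i j] by simp
    show "(\<lambda>k. q ^ k) \<longlonglongrightarrow> 0" using q by (intro LIMSEQ_realpow_zero)
  qed
  then have "(\<lambda>k. pow_entry k i j - pow_entry (Suc k) i j) sums (pow_entry 0 i j - 0)"
    by (rule telescope_sums')
  then show "(\<lambda>k. \<Sum>l<d. pow_entry k i l * (unitv j l - X l j)) sums unitv j i"
    unfolding eq by (simp add: pow_entry_def)
qed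

text \<open>All terms of the series are nonnegative forms, and the term k = 0 alone already
  contributes dot d u u. This supplies the positivity that the definition of
  \<open>inv_sqrt_mat\<close> demands.\<close>

lemma isqrt_pos:
  "dot d u u \<le> dot d u (mv d isqrt_entry u)"
proof -
  have "(\<lambda>k. \<Sum>i<d. u i * (\<Sum>j<d. (isqrt_coeff k * pow_entry k i j) * u j)) sums
      (\<Sum>i<d. u i * (\<Sum>j<d. isqrt_entry i j * u j))"
    by (intro sums_sum sums_mult sums_mult2 isqrt_entry_sums) auto
  moreover have "(\<Sum>i<d. u i * (\<Sum>j<d. (isqrt_coeff k * pow_entry k i j) * u j))
      = isqrt_coeff k * dot d u (T k u)" for k
    unfolding dot_def sum_distrib_left
    by (intro sum.cong refl) (simp add: pow_entry_apply sum_distrib_left mult_ac)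
  ultimately have S: "(\<lambda>k. isqrt_coeff k * dot d u (T k u)) sums dot d u (mv d isqrt_entry u)"
    by (simp add: dot_def mv_def)
  have S0: "(\<lambda>k. if k = 0 then dot d u u else 0) sums dot d u u"
    using sums_single[of 0 "\<lambda>_. dot d u u"] by simp
  show ?thesis
  proof (rule sums_le[OF _ S0 S])
    show "(if k = 0 then dot d u u else 0) \<le> isqrt_coeff k * dot d u (T k u)" for k
      by (simp add: isqrt_coeff_0 isqrt_coeff_nonneg dot_pow_nonneg)
  qed
qed

end

lemma scalar_prod_eq_dot: "v \<in> carrier_vec d \<Longrightarrow> u \<bullet> v = dot d (($) u) (($) v)"
  by (auto simp: dot_def scalar_prod_def atLeast0LessThan)

text \<open>The predicate under the choice has a witness: with X = I - W / c1 the series represents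
  (W / c1)^(-1/2), and a factor 1 / sqrt c1 turns this into W^(-1/2). The chosen matrix then
  satisfies the same predicate.\<close>

lemma inv_sqrt_mat_props:
  fixes W :: "real mat"
  defines "F \<equiv> \<lambda>i k. W $$ (i, k)"
  assumes W: "W \<in> carrier_mat d d" and d: "0 < d"
    and sym: "\<And>u v. dot d u (mv d F v) = dot d v (mv d F u)"
    and c0: "0 < c0" and lower: "\<And>u. c0 * dot d u u \<le> dot d u (mv d F u)"
    and upper: "\<And>u. dot d u (mv d F u) \<le> c1 * dot d u u"
  shows "inv_sqrt_mat W \<in> carrier_mat d d" "transpose_mat (inv_sqrt_mat W) = inv_sqrt_mat W"
    "inv_sqrt_mat W * inv_sqrt_mat W * W = 1\<^sub>m d"
proof -
  \<comment> \<open>Comparing both bounds at a basis vector, which exists as 0 < d, gives c0 <= c1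
    and hence 0 <= q < 1 below.\<close>
  have "c0 * dot d (unitv 0) (unitv 0) \<le> c1 * dot d (unitv 0) (unitv 0)"
    using lower upper order_trans by blast
  moreover have "dot d (unitv 0) (unitv 0) = 1" using d by (simp add: dot_unitv) (simp add: unitv_def)
  ultimately have c01: "c0 \<le> c1" by simp
  define X where "X = (\<lambda>i k. unitv k i - F i k / c1)"
  define q where "q = 1 - c0 / c1"
  have c1: "0 < c1" using c0 c01 by simp
  have mvX: "dot d v (mv d X u) = dot d v u - dot d v (mv d F u) / c1" for u v
  proof -
    have "mv d X u i = u i - mv d F u i / c1" if "i < d" for i
    proof -
      have "mv d X u i = (\<Sum>k<d. unitv i k * u k) - (\<Sum>k<d. F i k * u k) / c1"
        by (simp add: mv_def X_def algebra_simps sum_subtractf sum_divide_distrib)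
          (simp add: unitv_def eq_commute)
      then show ?thesis using dot_unitv[OF that, of u] by (simp add: dot_def mv_def)
    qed
    then have "dot d v (mv d X u) = dot d v (\<lambda>i. u i - (1 / c1) * mv d F u i)"
      by (intro dot_cong) auto
    then show ?thesis by (simp only: dot_diff_right dot_scale_right) simp
  qed
  have Xs: "dot d u (mv d X v) = dot d v (mv d X u)" for u v
    unfolding mvX using sym[of u v] dot_commute[of d u v] by simp
  have Xn: "0 \<le> dot d u (mv d X u)" for u
    unfolding mvX using upper[of u] c1 by (simp add: field_simps)
  have Xu: "dot d u (mv d X u) \<le> q * dot d u u" for u
    unfolding mvX q_def using lower[of u] c1 by (simp add: field_simps)
  have q: "0 \<le> q" "q < 1" using c0 c1 c01 by (auto simp: q_def)
  let ?I = "isqrt_entry d X"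
  define s where "s = 1 / sqrt c1"
  have s: "0 < s" "s * s = 1 / c1" using c1 by (auto simp: s_def)
  define B where "B = mat d d (\<lambda>(i, j). s * ?I i j)"
  have Bc: "B \<in> carrier_mat d d" by (simp add: B_def)
  have Bs: "transpose_mat B = B"
    using isqrt_entry_sym[OF Xs Xn Xu q] by (intro eq_matI) (auto simp: B_def)
  have Bp: "0 < u \<bullet> (B *\<^sub>v u)" if u: "u \<in> unit_sphere d" for u
  proof -
    have uc: "u \<in> carrier_vec d" and "vnorm u = 1" using u by (auto simp: unit_sphere_def)
    then have uu: "dot d (($) u) (($) u) = 1"
      by (simp add: vnorm_def scalar_prod_eq_dot)
    have "u \<bullet> (B *\<^sub>v u) = dot d (($) u) (($) (B *\<^sub>v u))"
      using Bc uc by (intro scalar_prod_eq_dot) auto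
    also have "\<dots> = dot d (($) u) (\<lambda>i. s * mv d ?I (($) u) i)"
      using uc by (intro dot_cong) (auto simp: B_def scalar_prod_def mv_def atLeast0LessThan sum_distrib_left mult_ac)
    also have "\<dots> = s * dot d (($) u) (mv d ?I (($) u))" by (rule dot_scale_right)
    finally have e: "u \<bullet> (B *\<^sub>v u) = s * dot d (($) u) (mv d ?I (($) u))" .
    have "1 \<le> dot d (($) u) (mv d ?I (($) u))"
      using isqrt_pos[OF Xs Xn Xu q, of "($) u"] uu by simp
    then show ?thesis unfolding e using s by simp
  qed
  have BBW: "B * B * W = 1\<^sub>m d"
  proof (rule eq_matI)
    fix i j assume "i < dim_row (1\<^sub>m d)" "j < dim_col (1\<^sub>m d)"
    then have ij: "i < d" "j < d" by auto
    have "(B * B * W) $$ (i, j) = (\<Sum>l<d. (\<Sum>m<d. (s * ?I i m) * (s * ?I m l)) * F l j)"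
      using ij W by (simp add: B_def scalar_prod_def atLeast0LessThan F_def)
    also have "\<dots> = (\<Sum>l<d. (\<Sum>m<d. ?I i m * ?I m l) * (unitv j l - X l j))"
    proof (intro sum.cong refl)
      fix l
      have "(\<Sum>m<d. (s * ?I i m) * (s * ?I m l)) = (s * s) * (\<Sum>m<d. ?I i m * ?I m l)"
        by (simp add: sum_distrib_left mult_ac)
      then show "(\<Sum>m<d. (s * ?I i m) * (s * ?I m l)) * F l j
        = (\<Sum>m<d. ?I i m * ?I m l) * (unitv j l - X l j)"
        by (simp add: s X_def)
    qed
    also have "\<dots> = unitv j i" by (rule isqrt_inverse[OF Xs Xn Xu q ij])
    finally show "(B * B * W) $$ (i, j) = 1\<^sub>m d $$ (i, j)" using ij by (simp add: unitv_def)
  qed (use Bc W in auto)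
  have dr: "dim_row W = d" using W by auto
  let ?P = "\<lambda>B. B \<in> carrier_mat (dim_row W) (dim_row W) \<and> transpose_mat B = B \<and>
     (\<forall>u\<in>unit_sphere (dim_row W). 0 < u \<bullet> (B *\<^sub>v u)) \<and> B * B * W = 1\<^sub>m (dim_row W)"
  have "?P (inv_sqrt_mat W)"
    unfolding inv_sqrt_mat_def by (rule someI[of ?P B]) (use Bc Bs Bp BBW dr in auto)
  then show "inv_sqrt_mat W \<in> carrier_mat d d" "transpose_mat (inv_sqrt_mat W) = inv_sqrt_mat W"
    "inv_sqrt_mat W * inv_sqrt_mat W * W = 1\<^sub>m d" using dr by auto
qed

section \<open>Moments of independent samples\<close>

lemma square_integrable_mult:
  fixes f g :: "'c \<Rightarrow> real"
  assumes "f \<in> borel_measurable N" "g \<in> borel_measurable N"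
    and "integrable N (\<lambda>x. (f x)\<^sup>2)" "integrable N (\<lambda>x. (g x)\<^sup>2)"
  shows "integrable N (\<lambda>x. f x * g x)"
proof (rule Bochner_Integration.integrable_bound)
  show "integrable N (\<lambda>x. (f x)\<^sup>2 + (g x)\<^sup>2)" using assms by auto
  show "AE x in N. norm (f x * g x) \<le> norm ((f x)\<^sup>2 + (g x)\<^sup>2)"
  proof (rule AE_I2)
    fix x
    have "0 \<le> (\<bar>f x\<bar> - \<bar>g x\<bar>)\<^sup>2" by simp
    then have "2 * (\<bar>f x\<bar> * \<bar>g x\<bar>) \<le> (f x)\<^sup>2 + (g x)\<^sup>2" by (simp add: power2_diff)
    moreover have "0 \<le> \<bar>f x\<bar> * \<bar>g x\<bar>" by simp
    ultimately have "\<bar>f x\<bar> * \<bar>g x\<bar> \<le> (f x)\<^sup>2 + (g x)\<^sup>2" by linarith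
    then show "norm (f x * g x) \<le> norm ((f x)\<^sup>2 + (g x)\<^sup>2)" by (simp add: abs_mult)
  qed
qed (use assms in auto)

lemma square_integrable_imp:
  fixes f :: "'c \<Rightarrow> real"
  assumes "prob_space N" "f \<in> borel_measurable N" "integrable N (\<lambda>x. (f x)\<^sup>2)"
  shows "integrable N f"
proof -
  interpret N: prob_space N by fact
  show ?thesis
    using square_integrable_mult[of f N "\<lambda>_. 1"] assms by simp
qed

text \<open>The variance of |f| is nonnegative, so the square of its mean is at most the second
  moment.\<close>

lemma (in prob_space) abs_expectation_le_sqrt:
  assumes "f \<in> borel_measurable M" "integrable M (\<lambda>x. (f x)\<^sup>2)" "(\<integral>x. (f x)\<^sup>2 \<partial>M) \<le> B"
  shows "(\<integral>x. \<bar>f x\<bar> \<partial>M) \<le> sqrt B"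
proof -
  have i: "integrable M f"
    by (rule square_integrable_imp[OF prob_space_axioms assms(1,2)])
  define e where "e = (\<integral>x. \<bar>f x\<bar> \<partial>M)"
  have "0 \<le> (\<integral>x. (\<bar>f x\<bar> - e)\<^sup>2 \<partial>M)"
    by (rule Bochner_Integration.integral_nonneg) simp
  also have "\<dots> = (\<integral>x. (f x)\<^sup>2 - (2 * e) * \<bar>f x\<bar> + e\<^sup>2 \<partial>M)"
    by (intro Bochner_Integration.integral_cong refl) (simp add: power2_diff mult_ac)
  also have "\<dots> = (\<integral>x. (f x)\<^sup>2 \<partial>M) - (2 * e) * e + e\<^sup>2"
    using assms(2) integrable_abs[OF i] by (simp add: prob_space e_def)
  also have "\<dots> = (\<integral>x. (f x)\<^sup>2 \<partial>M) - e\<^sup>2"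
    by (simp add: power2_eq_square)
  finally have "e\<^sup>2 \<le> B" using assms(3) by simp
  then have "e \<le> sqrt B" by (rule real_le_rsqrt)
  then show ?thesis by (simp only: e_def)
qed

text \<open>\<open>G\<close> takes whole coordinate sequences but looks only at the indices in
  \<open>J\<close>. In this form the same expression can be evaluated at the full sample whatever
  \<open>J\<close> is, while measurability refers to the product over \<open>J\<close>, where
  independence applies.\<close>

definition past :: "'z measure \<Rightarrow> nat set \<Rightarrow> ((nat \<Rightarrow> 'z) \<Rightarrow> 'b::topological_space) \<Rightarrow> bool" where
  "past Q J G \<longleftrightarrow> G \<in> borel_measurable (PiM J (\<lambda>_. Q)) \<and> (\<forall>z. G (restrict z J) = G z)"

lemma past_const: "past Q J (\<lambda>z. c)"
  by (simp add: past_def)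

lemma past_coord:
  assumes "f \<in> borel_measurable Q" "j \<in> J"
  shows "past Q J (\<lambda>z. f (z j))"
  unfolding past_def
proof (intro conjI allI)
  show "(\<lambda>z. f (z j)) \<in> borel_measurable (PiM J (\<lambda>_. Q))"
    by (rule measurable_compose[OF measurable_component_singleton[OF assms(2)] assms(1)])
qed (use assms in simp)

lemma
  fixes F G :: "(nat \<Rightarrow> 'z) \<Rightarrow> 'b::{second_countable_topology, real_normed_algebra}"
  assumes "past Q J F" "past Q J G"
  shows past_diff: "past Q J (\<lambda>z. F z - G z)"
    and past_mult: "past Q J (\<lambda>z. F z * G z)"
  using assms unfolding past_def
  by (auto intro!: borel_measurable_diff borel_measurable_times)

lemma past_compose:
  assumes "past Q J F" "h \<in> borel_measurable borel"
  shows "past Q J (\<lambda>z. h (F z))"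
proof -
  have "F \<in> borel_measurable (PiM J (\<lambda>_. Q))" and eq: "\<And>z. F (restrict z J) = F z"
    using assms(1) unfolding past_def by blast+
  from measurable_compose[OF this(1) assms(2)] show ?thesis
    unfolding past_def by (simp only: eq simp_thms)
qed

lemma past_sum: "(\<And>i. i \<in> A \<Longrightarrow> past Q J (F i)) \<Longrightarrow> past Q J (\<lambda>z. \<Sum>i\<in>A. F i z)"
  for F :: "'i \<Rightarrow> (nat \<Rightarrow> 'z) \<Rightarrow> real"
  unfolding past_def by (auto intro!: borel_measurable_sum)

lemma past_sqrt: "past Q J F \<Longrightarrow> past Q J (\<lambda>z. sqrt (F z))"
  by (rule past_compose) auto

lemma past_dot: "(\<And>a. a < d \<Longrightarrow> past Q J (\<lambda>z. x z a)) \<Longrightarrow> (\<And>a. a < d \<Longrightarrow> past Q J (\<lambda>z. y z a)) \<Longrightarrow>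
    past Q J (\<lambda>z. dot d (x z) (y z))"
  unfolding dot_def by (intro past_sum past_mult) auto

lemma past_mv: "(\<And>a. a < d \<Longrightarrow> past Q J (\<lambda>z. x z a)) \<Longrightarrow> past Q J (\<lambda>z. mv d A (x z) a)"
  unfolding mv_def by (intro past_sum past_mult past_const) auto

locale iid_sample = prob_space M for M :: "'w measure" +
  fixes Q :: "'z measure" and Z :: "nat \<Rightarrow> 'w \<Rightarrow> 'z" and I :: "nat set"
  assumes prob_Q: "prob_space Q" and fin: "finite I"
    and indep: "indep_vars (\<lambda>_. Q) Z I" and distr_Z: "\<And>j. j \<in> I \<Longrightarrow> distr M Q (Z j) = Q"
begin

abbreviation zeta :: "'w \<Rightarrow> nat \<Rightarrow> 'z" where "zeta \<omega> \<equiv> \<lambda>j. Z j \<omega>"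

lemma Z_measurable: "j \<in> I \<Longrightarrow> Z j \<in> measurable M Q"
  using indep by (auto simp: indep_vars_def2)

lemma past_measurable:
  assumes "past Q J G" "J \<subseteq> I"
  shows "(\<lambda>\<omega>. G (zeta \<omega>)) \<in> borel_measurable M"
proof -
  have Zm: "(\<lambda>\<omega>. restrict (zeta \<omega>) J) \<in> measurable M (PiM J (\<lambda>_. Q))"
    using assms by (intro measurable_restrict Z_measurable) auto
  have Gm: "G \<in> borel_measurable (PiM J (\<lambda>_. Q))" and eq: "\<And>z. G (restrict z J) = G z"
    using assms(1) unfolding past_def by blast+
  from measurable_compose[OF Zm Gm] show ?thesis by (simp only: eq)
qed

lemma coord_measurable: "j \<in> I \<Longrightarrow> f \<in> borel_measurable Q \<Longrightarrow> (\<lambda>\<omega>. f (Z j \<omega>)) \<in> borel_measurable M"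
  using Z_measurable by (rule measurable_compose)

lemma coord_integrable:
  fixes f :: "'z \<Rightarrow> 'b::{banach, second_countable_topology}"
  assumes "j \<in> I" "integrable Q f"
  shows "integrable M (\<lambda>\<omega>. f (Z j \<omega>))"
  using integrable_distr[OF Z_measurable[OF assms(1)], of f] assms by (simp add: distr_Z)

lemma coord_integral:
  fixes f :: "'z \<Rightarrow> 'b::{banach, second_countable_topology}"
  assumes "j \<in> I" "f \<in> borel_measurable Q"
  shows "(\<integral>\<omega>. f (Z j \<omega>) \<partial>M) = (\<integral>z. f z \<partial>Q)"
  using integral_distr[OF Z_measurable[OF assms(1)] assms(2)] assms(1) by (simp add: distr_Z)

text \<open>This takes the place of conditioning on the observations in \<open>J\<close>: the blocks
  {k} and J are independent, so observation k can be integrated out. The value type is general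
  because \<open>G\<close> will be real in moment bounds and complex in Stein's method.\<close>

lemma
  fixes f :: "'z \<Rightarrow> 'b::{real_normed_field, banach, second_countable_topology}"
  assumes J: "J \<subseteq> I" and k: "k \<in> I" "k \<notin> J" and f: "integrable Q f"
    and G: "past Q J G" "integrable M (\<lambda>\<omega>. G (zeta \<omega>))"
  shows indep_coord_integrable: "integrable M (\<lambda>\<omega>. f (Z k \<omega>) * G (zeta \<omega>))"
    and indep_coord_integral: "(\<integral>\<omega>. f (Z k \<omega>) * G (zeta \<omega>) \<partial>M) = (\<integral>z. f z \<partial>Q) * (\<integral>\<omega>. G (zeta \<omega>) \<partial>M)"
proof -
  have fm: "f \<in> borel_measurable Q" using f by auto
  have "indep_var (PiM {k} (\<lambda>_. Q)) (\<lambda>\<omega>. restrict (zeta \<omega>) {k}) (PiM J (\<lambda>_. Q)) (\<lambda>\<omega>. restrict (zeta \<omega>) J)"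
    using J k by (intro indep_var_restrict[OF indep]) auto
  then have "indep_var borel ((\<lambda>z. f (z k)) \<circ> (\<lambda>\<omega>. restrict (zeta \<omega>) {k})) borel (G \<circ> (\<lambda>\<omega>. restrict (zeta \<omega>) J))"
  proof (rule indep_var_compose)
    show "(\<lambda>z. f (z k)) \<in> borel_measurable (PiM {k} (\<lambda>_. Q))"
      using past_coord[OF fm, of k "{k}"] unfolding past_def by blast
    show "G \<in> borel_measurable (PiM J (\<lambda>_. Q))" using G(1) unfolding past_def by blast
  qed
  also have "(\<lambda>z. f (z k)) \<circ> (\<lambda>\<omega>. restrict (zeta \<omega>) {k}) = (\<lambda>\<omega>. f (Z k \<omega>))" by auto
  also have "G \<circ> (\<lambda>\<omega>. restrict (zeta \<omega>) J) = (\<lambda>\<omega>. G (zeta \<omega>))"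
  proof
    fix \<omega>
    have "\<And>z. G (restrict z J) = G z" using G(1) unfolding past_def by blast
    then show "(G \<circ> (\<lambda>\<omega>. restrict (zeta \<omega>) J)) \<omega> = G (zeta \<omega>)" by (simp only: comp_apply)
  qed
  finally have iv: "indep_var borel (\<lambda>\<omega>. f (Z k \<omega>)) borel (\<lambda>\<omega>. G (zeta \<omega>))" .
  show "integrable M (\<lambda>\<omega>. f (Z k \<omega>) * G (zeta \<omega>))"
    by (rule indep_var_integrable[OF iv coord_integrable[OF k(1) f] G(2)])
  show "(\<integral>\<omega>. f (Z k \<omega>) * G (zeta \<omega>) \<partial>M) = (\<integral>z. f z \<partial>Q) * (\<integral>\<omega>. G (zeta \<omega>) \<partial>M)"
    using indep_var_lebesgue_integral[OF iv coord_integrable[OF k(1) f] G(2)] coord_integral[OF k(1) fm]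
    by simp
qed

text \<open>Inserting an index into J creates two cross terms, each a product of a centred variable
  and an independent sum. They integrate to 0, so only diagonal products remain.\<close>

lemma sum_coord_moments:
  fixes f g :: "'z \<Rightarrow> real"
  assumes f: "f \<in> borel_measurable Q" "integrable Q (\<lambda>z. (f z)\<^sup>2)" "(\<integral>z. f z \<partial>Q) = 0"
    and g: "g \<in> borel_measurable Q" "integrable Q (\<lambda>z. (g z)\<^sup>2)" "(\<integral>z. g z \<partial>Q) = 0"
    and J: "J \<subseteq> I"
  shows "integrable M (\<lambda>\<omega>. (\<Sum>j\<in>J. f (Z j \<omega>)) * (\<Sum>j\<in>J. g (Z j \<omega>))) \<and>
    (\<integral>\<omega>. (\<Sum>j\<in>J. f (Z j \<omega>)) * (\<Sum>j\<in>J. g (Z j \<omega>)) \<partial>M) = real (card J) * (\<integral>z. f z * g z \<partial>Q)"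
proof -
  have "finite J" using J fin finite_subset by auto
  then show ?thesis using J
  proof (induction J rule: finite_induct)
    case (insert k J)
    have fi: "integrable Q f" and gi: "integrable Q g"
      using f g by (auto intro: square_integrable_imp prob_Q)
    have k: "k \<in> I" "k \<notin> J" "J \<subseteq> I" using insert by auto
    have fg: "integrable Q (\<lambda>z. f z * g z)" using f g by (intro square_integrable_mult)
    let ?F = "\<lambda>z. \<Sum>j\<in>J. f (z j)" and ?G = "\<lambda>z. \<Sum>j\<in>J. g (z j)"
    have pF: "past Q J ?F" and pG: "past Q J ?G"
      using f g by (auto intro!: past_sum past_coord)
    have iF: "integrable M (\<lambda>\<omega>. ?F (zeta \<omega>))" and iG: "integrable M (\<lambda>\<omega>. ?G (zeta \<omega>))"
      using k by (auto intro!: Bochner_Integration.integrable_sum coord_integrable fi gi)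
    note int = coord_integrable[OF k(1) fg] indep_coord_integrable[OF k(3,1,2) fi pG iG]
      indep_coord_integrable[OF k(3,1,2) gi pF iF] insert.IH[OF k(3), THEN conjunct1]
    have eq: "(\<Sum>j\<in>insert k J. f (Z j \<omega>)) * (\<Sum>j\<in>insert k J. g (Z j \<omega>)) =
       f (Z k \<omega>) * g (Z k \<omega>) + f (Z k \<omega>) * ?G (zeta \<omega>) + g (Z k \<omega>) * ?F (zeta \<omega>) + ?F (zeta \<omega>) * ?G (zeta \<omega>)" for \<omega>
      using insert(1,2) by (simp add: algebra_simps)
    have "(\<integral>\<omega>. f (Z k \<omega>) * g (Z k \<omega>) \<partial>M) = (\<integral>z. f z * g z \<partial>Q)"
      using k f g by (intro coord_integral) auto
    moreover have "(\<integral>\<omega>. f (Z k \<omega>) * ?G (zeta \<omega>) \<partial>M) = 0"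
      using indep_coord_integral[OF k(3,1,2) fi pG iG] f by simp
    moreover have "(\<integral>\<omega>. g (Z k \<omega>) * ?F (zeta \<omega>) \<partial>M) = 0"
      using indep_coord_integral[OF k(3,1,2) gi pF iF] g by simp
    ultimately show ?case
      unfolding eq using int insert.IH[OF k(3)] insert(1,2)
      by (simp add: algebra_simps)
  qed simp
qed

text \<open>Truncating at level \<open>K\<close> gives a law of large numbers in mean without higher moments.\<close>

lemma mean_deviation_le:
  fixes g :: "'z \<Rightarrow> real"
  assumes g: "integrable Q g" "\<And>z. 0 \<le> g z" and J: "J \<subseteq> I" and card: "real (card J) \<le> N" and K: "0 \<le> K"
  shows "(\<integral>\<omega>. \<bar>(\<Sum>j\<in>J. g (Z j \<omega>)) - real (card J) * (\<integral>z. g z \<partial>Q)\<bar> \<partial>M) \<le>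
    sqrt (N * (K * (\<integral>z. g z \<partial>Q))) + 2 * N * (\<integral>z. g z * indicator {z. K < g z} z \<partial>Q)"
proof -
  interpret Q: prob_space Q by (rule prob_Q)
  have gm[measurable]: "g \<in> borel_measurable Q" using g by auto
  define g1 where "g1 = (\<lambda>z. g z * indicator {z. g z \<le> K} z)"
  define g2 where "g2 = (\<lambda>z. g z * indicator {z. K < g z} z)"
  have gs: "g z = g1 z + g2 z" for z by (auto simp: g1_def g2_def indicator_def)
  have m1[measurable]: "g1 \<in> borel_measurable Q" "g2 \<in> borel_measurable Q"
    unfolding g1_def g2_def indicator_def by measurable
  have b: "0 \<le> g1 z" "g1 z \<le> K" "g1 z \<le> g z" "0 \<le> g2 z" "g2 z \<le> g z" for z
    using g(2)[of z] K by (auto simp: g1_def g2_def indicator_def)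
  have i1: "integrable Q g1" "integrable Q g2"
  proof -
    have "norm (g1 z) \<le> norm (g z)" "norm (g2 z) \<le> norm (g z)" for z
      using b[of z] g(2)[of z] by auto
    then show "integrable Q g1" "integrable Q g2"
      by (auto intro!: Bochner_Integration.integrable_bound[OF g(1)] AE_I2)
  qed
  have isq: "integrable Q (\<lambda>z. (g1 z)\<^sup>2)"
  proof (rule Q.integrable_const_bound[of _ "K\<^sup>2"])
    show "AE z in Q. norm ((g1 z)\<^sup>2) \<le> K\<^sup>2" using b by (auto intro!: power_mono)
  qed simp
  define h where "h = (\<lambda>z. g1 z - (\<integral>z. g1 z \<partial>Q))"
  have hm: "h \<in> borel_measurable Q" by (simp add: h_def)
  have hz: "(\<integral>z. h z \<partial>Q) = 0" using i1 by (simp add: h_def Q.prob_space)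
  have hsq: "(h z)\<^sup>2 = (g1 z)\<^sup>2 - 2 * (\<integral>z. g1 z \<partial>Q) * g1 z + (\<integral>z. g1 z \<partial>Q)\<^sup>2" for z
    by (simp add: h_def power2_diff)
  have hi: "integrable Q (\<lambda>z. (h z)\<^sup>2)" unfolding hsq using isq i1 by auto
  have "(\<integral>z. (h z)\<^sup>2 \<partial>Q) = (\<integral>z. (g1 z)\<^sup>2 \<partial>Q) - (\<integral>z. g1 z \<partial>Q)\<^sup>2"
    unfolding hsq using isq i1 by (simp add: Q.prob_space power2_eq_square)
  also have "\<dots> \<le> (\<integral>z. (g1 z)\<^sup>2 \<partial>Q)" by simp
  \<comment> \<open>The truncated part is at most K, so its second moment is bounded by K times a
    first moment.\<close>
  also have "\<dots> \<le> (\<integral>z. K * g z \<partial>Q)"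
  proof (intro integral_mono isq)
    show "integrable Q (\<lambda>z. K * g z)" using g by auto
    show "(g1 z)\<^sup>2 \<le> K * g z" for z
      unfolding power2_eq_square using b[of z] K by (intro mult_mono) auto
  qed
  finally have hv: "(\<integral>z. (h z)\<^sup>2 \<partial>Q) \<le> K * (\<integral>z. g z \<partial>Q)" by simp
  have g0: "0 \<le> (\<integral>z. g z \<partial>Q)" "0 \<le> (\<integral>z. g2 z \<partial>Q)" using g b by (auto intro!: integral_nonneg_AE)
  note mom = sum_coord_moments[OF hm hi hz hm hi hz J]
  have hm': "(\<lambda>\<omega>. \<Sum>j\<in>J. h (Z j \<omega>)) \<in> borel_measurable M"
    using J hm by (intro borel_measurable_sum coord_measurable) auto
  have hJ: "(\<integral>\<omega>. \<bar>\<Sum>j\<in>J. h (Z j \<omega>)\<bar> \<partial>M) \<le> sqrt (N * (K * (\<integral>z. g z \<partial>Q)))"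
  proof (rule abs_expectation_le_sqrt[OF hm'])
    show "integrable M (\<lambda>\<omega>. (\<Sum>j\<in>J. h (Z j \<omega>))\<^sup>2)" using mom by (simp add: power2_eq_square)
    have "(\<integral>\<omega>. (\<Sum>j\<in>J. h (Z j \<omega>))\<^sup>2 \<partial>M) = real (card J) * (\<integral>z. (h z)\<^sup>2 \<partial>Q)"
      using mom by (simp add: power2_eq_square)
    also have "\<dots> \<le> N * (K * (\<integral>z. g z \<partial>Q))"
      using card hv K g0 by (intro mult_mono) auto
    finally show "(\<integral>\<omega>. (\<Sum>j\<in>J. h (Z j \<omega>))\<^sup>2 \<partial>M) \<le> N * (K * (\<integral>z. g z \<partial>Q))" .
  qed
  have ih: "integrable M (\<lambda>\<omega>. \<Sum>j\<in>J. h (Z j \<omega>))"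
    using J i1 by (intro Bochner_Integration.integrable_sum coord_integrable) (auto simp: h_def)
  have i2: "integrable M (\<lambda>\<omega>. \<Sum>j\<in>J. g2 (Z j \<omega>))"
    using J i1 by (intro Bochner_Integration.integrable_sum coord_integrable) auto
  have split: "(\<Sum>j\<in>J. g (Z j \<omega>)) - real (card J) * (\<integral>z. g z \<partial>Q)
      = (\<Sum>j\<in>J. h (Z j \<omega>)) + (\<Sum>j\<in>J. g2 (Z j \<omega>)) - real (card J) * (\<integral>z. g2 z \<partial>Q)" for \<omega>
  proof -
    have "(\<integral>z. g z \<partial>Q) = (\<integral>z. g1 z \<partial>Q) + (\<integral>z. g2 z \<partial>Q)"
      unfolding gs using i1 by (rule Bochner_Integration.integral_add)
    then show ?thesis by (simp add: gs h_def sum.distrib sum_subtractf algebra_simps)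
  qed
  have "(\<integral>\<omega>. \<bar>(\<Sum>j\<in>J. g (Z j \<omega>)) - real (card J) * (\<integral>z. g z \<partial>Q)\<bar> \<partial>M)
    \<le> (\<integral>\<omega>. \<bar>\<Sum>j\<in>J. h (Z j \<omega>)\<bar> + (\<Sum>j\<in>J. g2 (Z j \<omega>)) + real (card J) * (\<integral>z. g2 z \<partial>Q) \<partial>M)"
  proof (rule integral_mono)
    show "integrable M (\<lambda>\<omega>. \<bar>(\<Sum>j\<in>J. g (Z j \<omega>)) - real (card J) * (\<integral>z. g z \<partial>Q)\<bar>)"
      unfolding split using ih i2 by auto
    show "integrable M (\<lambda>\<omega>. \<bar>\<Sum>j\<in>J. h (Z j \<omega>)\<bar> + (\<Sum>j\<in>J. g2 (Z j \<omega>)) + real (card J) * (\<integral>z. g2 z \<partial>Q))"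
      using ih i2 by auto
    fix \<omega>
    have "0 \<le> (\<Sum>j\<in>J. g2 (Z j \<omega>))" "0 \<le> real (card J) * (\<integral>z. g2 z \<partial>Q)"
      using b g0 by (auto intro!: sum_nonneg)
    then show "\<bar>(\<Sum>j\<in>J. g (Z j \<omega>)) - real (card J) * (\<integral>z. g z \<partial>Q)\<bar>
      \<le> \<bar>\<Sum>j\<in>J. h (Z j \<omega>)\<bar> + (\<Sum>j\<in>J. g2 (Z j \<omega>)) + real (card J) * (\<integral>z. g2 z \<partial>Q)"
      unfolding split by linarith
  qed
  \<comment> \<open>The factor 2 arises because the tail part g2 enters once through its sum and
    once through the mean that is subtracted.\<close>
  also have "\<dots> = (\<integral>\<omega>. \<bar>\<Sum>j\<in>J. h (Z j \<omega>)\<bar> \<partial>M) + 2 * real (card J) * (\<integral>z. g2 z \<partial>Q)"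
  proof -
    have "(\<integral>\<omega>. (\<Sum>j\<in>J. g2 (Z j \<omega>)) \<partial>M) = (\<Sum>j\<in>J. \<integral>\<omega>. g2 (Z j \<omega>) \<partial>M)"
      using J i1 by (intro Bochner_Integration.integral_sum coord_integrable) auto
    also have "\<dots> = (\<Sum>j\<in>J. \<integral>z. g2 z \<partial>Q)"
      using J by (intro sum.cong refl coord_integral) auto
    finally have "(\<integral>\<omega>. (\<Sum>j\<in>J. g2 (Z j \<omega>)) \<partial>M) = real (card J) * (\<integral>z. g2 z \<partial>Q)" by simp
    then show ?thesis using ih i2 by (simp add: prob_space)
  qed
  also have "\<dots> \<le> sqrt (N * (K * (\<integral>z. g z \<partial>Q))) + 2 * N * (\<integral>z. g2 z \<partial>Q)"
    using hJ card g0 by (intro add_mono mult_right_mono) auto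
  finally show ?thesis by (simp add: g2_def)
qed

end

lemma integral_double_sum:
  fixes f :: "nat \<Rightarrow> nat \<Rightarrow> 'c \<Rightarrow> 'b::{banach, second_countable_topology}"
  assumes "\<And>a b. a < d \<Longrightarrow> b < d \<Longrightarrow> integrable N (f a b)"
  shows "(\<integral>x. (\<Sum>a<d. \<Sum>b<d. f a b x) \<partial>N) = (\<Sum>a<d. \<Sum>b<d. \<integral>x. f a b x \<partial>N)"
proof -
  have "(\<integral>x. (\<Sum>a<d. \<Sum>b<d. f a b x) \<partial>N) = (\<Sum>a<d. \<integral>x. (\<Sum>b<d. f a b x) \<partial>N)"
    by (rule Bochner_Integration.integral_sum) (auto intro!: Bochner_Integration.integrable_sum assms)
  also have "\<dots> = (\<Sum>a<d. \<Sum>b<d. \<integral>x. f a b x \<partial>N)"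
    by (intro sum.cong refl Bochner_Integration.integral_sum assms) auto
  finally show ?thesis .
qed

lemma dot_power2_eq: "(dot d u v)\<^sup>2 = (\<Sum>a<d. \<Sum>b<d. u a * u b * (v a * v b))"
  unfolding dot_def power2_eq_square sum_product by (intro sum.cong refl) simp

section \<open>Moments and concentration of quadratic forms in sums of independent centred
  vectors\<close>

locale iid_vectors = iid_sample M Q Z I for M :: "'w measure" and Q :: "'z measure" and Z I +
  fixes d :: nat and X :: "'z \<Rightarrow> nat \<Rightarrow> real"
  assumes X_meas: "\<And>a. a < d \<Longrightarrow> (\<lambda>z. X z a) \<in> borel_measurable Q"
    and X_sq: "\<And>a. a < d \<Longrightarrow> integrable Q (\<lambda>z. (X z a)\<^sup>2)"
    and X_mean: "\<And>a. a < d \<Longrightarrow> (\<integral>z. X z a \<partial>Q) = 0"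
begin

definition V :: "nat \<Rightarrow> nat \<Rightarrow> real" where
  "V a b = (\<integral>z. X z a * X z b \<partial>Q)"

definition trV :: real where "trV = (\<Sum>a<d. V a a)"

definition S :: "nat set \<Rightarrow> (nat \<Rightarrow> 'z) \<Rightarrow> nat \<Rightarrow> real" where
  "S J z a = (\<Sum>j\<in>J. X (z j) a)"

text \<open>The off-diagonal part of the form: the sum of X_j . A X_k over ordered pairs of distinct
  indices j, k in J.\<close>

definition H :: "(nat \<Rightarrow> nat \<Rightarrow> real) \<Rightarrow> nat set \<Rightarrow> (nat \<Rightarrow> 'z) \<Rightarrow> real" where
  "H A J z = dot d (S J z) (mv d A (S J z)) - (\<Sum>j\<in>J. dot d (X (z j)) (mv d A (X (z j))))"

definition symmetric :: "(nat \<Rightarrow> nat \<Rightarrow> real) \<Rightarrow> bool" where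
  "symmetric A \<longleftrightarrow> (\<forall>u v. dot d u (mv d A v) = dot d v (mv d A u))"

lemma past_S: "a < d \<Longrightarrow> past Q J (\<lambda>z. S J z a)"
  unfolding S_def by (intro past_sum past_coord X_meas)

lemma past_mv_S: "past Q J (\<lambda>z. mv d A (S J z) a)"
  by (intro past_mv past_S)

lemma past_H: "past Q J (H A J)"
proof -
  have "past Q J (\<lambda>z. dot d (X (z j)) (mv d A (X (z j))))" if "j \<in> J" for j
    using that by (intro past_dot past_mv past_coord X_meas) auto
  moreover have "past Q J (\<lambda>z. dot d (S J z) (mv d A (S J z)))"
    by (intro past_dot past_S past_mv_S)
  ultimately show ?thesis
    unfolding H_def[abs_def] by (intro past_diff past_sum)
qed

lemma XX_integrable: "a < d \<Longrightarrow> b < d \<Longrightarrow> integrable Q (\<lambda>z. X z a * X z b)"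
  by (intro square_integrable_mult X_meas X_sq)

lemma X_integrable: "a < d \<Longrightarrow> integrable Q (\<lambda>z. X z a)"
  by (rule square_integrable_imp[OF prob_Q X_meas X_sq])

lemma V_sym: "V a b = V b a"
  by (simp add: V_def mult.commute)

lemma V_symmetric: "symmetric V"
proof -
  have "dot d u (mv d V v) = dot d v (mv d V u)" for u v
    unfolding dot_def mv_def sum_distrib_left
    by (subst sum.swap) (simp add: V_sym mult_ac)
  then show ?thesis by (simp add: symmetric_def)
qed

lemma
  assumes "J \<subseteq> I" "a < d" "b < d"
  shows S_mult_integrable: "integrable M (\<lambda>\<omega>. S J (zeta \<omega>) a * S J (zeta \<omega>) b)"
    and S_mult_integral: "(\<integral>\<omega>. S J (zeta \<omega>) a * S J (zeta \<omega>) b \<partial>M) = real (card J) * V a b"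
  using sum_coord_moments[OF X_meas X_sq X_mean X_meas X_sq X_mean, of a b J] assms
  by (simp_all add: S_def V_def)

lemma dot_S_integrable: "J \<subseteq> I \<Longrightarrow> integrable M (\<lambda>\<omega>. dot d (S J (zeta \<omega>)) (S J (zeta \<omega>)))"
  unfolding dot_def by (intro Bochner_Integration.integrable_sum S_mult_integrable) auto

lemma dot_S_integral: "J \<subseteq> I \<Longrightarrow> (\<integral>\<omega>. dot d (S J (zeta \<omega>)) (S J (zeta \<omega>)) \<partial>M) = real (card J) * trV"
  unfolding dot_def trV_def
  by (subst Bochner_Integration.integral_sum) (auto simp: S_mult_integrable S_mult_integral sum_distrib_left)

lemma mv_S_mult_integrable:
  assumes J: "J \<subseteq> I" and ab: "a < d" "b < d"
  shows "integrable M (\<lambda>\<omega>. mv d A (S J (zeta \<omega>)) a * mv d A (S J (zeta \<omega>)) b)"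
proof -
  have "mv d A (S J (zeta \<omega>)) a * mv d A (S J (zeta \<omega>)) b
    = (\<Sum>k<d. \<Sum>l<d. A a k * A b l * (S J (zeta \<omega>) k * S J (zeta \<omega>) l))" for \<omega>
    unfolding mv_def sum_product by (intro sum.cong refl) simp
  then show ?thesis
    using J by (auto intro!: Bochner_Integration.integrable_sum integrable_mult_right S_mult_integrable)
qed

lemma dot_S_mv_S_integrable:
  assumes J: "J \<subseteq> I"
  shows "integrable M (\<lambda>\<omega>. dot d (S J (zeta \<omega>)) (mv d A (S J (zeta \<omega>))))"
proof -
  have "dot d (S J (zeta \<omega>)) (mv d A (S J (zeta \<omega>)))
    = (\<Sum>k<d. \<Sum>l<d. A k l * (S J (zeta \<omega>) k * S J (zeta \<omega>) l))" for \<omega>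
    unfolding mv_def dot_def sum_distrib_left by (intro sum.cong refl) simp
  then show ?thesis
    using J by (auto intro!: Bochner_Integration.integrable_sum integrable_mult_right S_mult_integrable)
qed

lemma dot_X_mv_X_integrable: "integrable Q (\<lambda>z. dot d (X z) (mv d A (X z)))"
proof -
  have "dot d (X z) (mv d A (X z)) = (\<Sum>k<d. \<Sum>l<d. A k l * (X z k * X z l))" for z
    unfolding mv_def dot_def sum_distrib_left by (intro sum.cong refl) simp
  then show ?thesis
    by (auto intro!: Bochner_Integration.integrable_sum integrable_mult_right XX_integrable)
qed

lemma dot_X_X_integrable: "integrable Q (\<lambda>z. dot d (X z) (X z))"
  unfolding dot_def by (intro Bochner_Integration.integrable_sum XX_integrable) auto

lemma trV_eq: "trV = (\<integral>z. dot d (X z) (X z) \<partial>Q)"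
  unfolding trV_def dot_def V_def
  by (subst Bochner_Integration.integral_sum) (auto simp: XX_integrable)

lemma V_form: "dot d u (mv d V u) = (\<integral>z. (dot d u (X z))\<^sup>2 \<partial>Q)"
proof -
  have "(\<integral>z. (dot d u (X z))\<^sup>2 \<partial>Q) = (\<Sum>a<d. \<Sum>b<d. u a * u b * V a b)"
    unfolding dot_power2_eq by (subst integral_double_sum) (simp_all add: XX_integrable V_def)
  also have "\<dots> = dot d u (mv d V u)"
    unfolding dot_def mv_def sum_distrib_left by (intro sum.cong refl) simp
  finally show ?thesis ..
qed

lemma V_nonneg: "0 \<le> dot d u (mv d V u)"
  unfolding V_form by (rule Bochner_Integration.integral_nonneg) simp

lemma of_real_past: "past Q J F \<Longrightarrow> past Q J (\<lambda>z. of_real (F z) :: 'b::{real_normed_field, banach, second_countable_topology})"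
  by (rule past_compose[of _ _ F]) (auto intro!: borel_measurable_continuous_onI continuous_intros)

text \<open>Expanding the inner product over coordinates gives finitely many products of a centred
  coordinate of X_k with a function of the other observations, and each of them integrates to
  0.\<close>

lemma
  fixes G :: "(nat \<Rightarrow> 'z) \<Rightarrow> 'b::{real_normed_field, banach, second_countable_topology}"
  assumes J: "J \<subseteq> I" "k \<in> I" "k \<notin> J"
    and y: "\<And>a. a < d \<Longrightarrow> past Q J (\<lambda>z. y z a)" and G: "past Q J G"
    and int: "\<And>a. a < d \<Longrightarrow> integrable M (\<lambda>\<omega>. of_real (y (zeta \<omega>) a) * G (zeta \<omega>))"
  shows linear_term_integrable: "integrable M (\<lambda>\<omega>. of_real (dot d (X (Z k \<omega>)) (y (zeta \<omega>))) * G (zeta \<omega>))"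
    and linear_term_integral: "(\<integral>\<omega>. of_real (dot d (X (Z k \<omega>)) (y (zeta \<omega>))) * G (zeta \<omega>) \<partial>M) = 0"
proof -
  have eq: "of_real (dot d (X (Z k \<omega>)) (y (zeta \<omega>))) * G (zeta \<omega>)
    = (\<Sum>a<d. of_real (X (Z k \<omega>) a) * (of_real (y (zeta \<omega>) a) * G (zeta \<omega>)))" for \<omega>
    unfolding dot_def of_real_sum sum_distrib_right by (intro sum.cong refl) simp
  have p: "past Q J (\<lambda>z. of_real (y z a) * G z)" if "a < d" for a
    using that by (intro past_mult of_real_past y G)
  have X: "integrable Q (\<lambda>z. of_real (X z a) :: 'b)" if "a < d" for a
    using X_integrable[OF that] by (rule integrable_of_real)
  note 1 = indep_coord_integrable[OF J X p int] and 2 = indep_coord_integral[OF J X p int]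
  show "integrable M (\<lambda>\<omega>. of_real (dot d (X (Z k \<omega>)) (y (zeta \<omega>))) * G (zeta \<omega>))"
    unfolding eq by (intro Bochner_Integration.integrable_sum 1) auto
  have "(\<integral>z. of_real (X z a) \<partial>Q) = (0 :: 'b)" if "a < d" for a
    using X_mean[OF that] integral_of_real[OF X_integrable[OF that], where 'a='b] by simp
  then show "(\<integral>\<omega>. of_real (dot d (X (Z k \<omega>)) (y (zeta \<omega>))) * G (zeta \<omega>) \<partial>M) = 0"
    unfolding eq by (subst Bochner_Integration.integral_sum) (auto simp: 1 2)
qed

text \<open>Integrating out observation k replaces each product of two coordinates of X_k by its
  mean, an entry of \<open>V\<close>. The squared inner product thereby becomes the form of
  \<open>V\<close> at y.\<close>

lemma
  fixes G :: "(nat \<Rightarrow> 'z) \<Rightarrow> 'b::{real_normed_field, banach, second_countable_topology}"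
  assumes J: "J \<subseteq> I" "k \<in> I" "k \<notin> J"
    and y: "\<And>a. a < d \<Longrightarrow> past Q J (\<lambda>z. y z a)" and G: "past Q J G"
    and int: "\<And>a b. a < d \<Longrightarrow> b < d \<Longrightarrow> integrable M (\<lambda>\<omega>. of_real (y (zeta \<omega>) a * y (zeta \<omega>) b) * G (zeta \<omega>))"
  shows quad_term_integrable: "integrable M (\<lambda>\<omega>. of_real ((dot d (X (Z k \<omega>)) (y (zeta \<omega>)))\<^sup>2) * G (zeta \<omega>))"
    and quad_term_integral: "(\<integral>\<omega>. of_real ((dot d (X (Z k \<omega>)) (y (zeta \<omega>)))\<^sup>2) * G (zeta \<omega>) \<partial>M)
      = (\<integral>\<omega>. of_real (dot d (y (zeta \<omega>)) (mv d V (y (zeta \<omega>)))) * G (zeta \<omega>) \<partial>M)"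
    and quad_term_V_integrable: "integrable M (\<lambda>\<omega>. of_real (dot d (y (zeta \<omega>)) (mv d V (y (zeta \<omega>)))) * G (zeta \<omega>))"
proof -
  have eq: "of_real ((dot d (X (Z k \<omega>)) (y (zeta \<omega>)))\<^sup>2) * G (zeta \<omega>)
    = (\<Sum>a<d. \<Sum>b<d. of_real (X (Z k \<omega>) a * X (Z k \<omega>) b) * (of_real (y (zeta \<omega>) a * y (zeta \<omega>) b) * G (zeta \<omega>)))" for \<omega>
    unfolding dot_power2_eq of_real_sum sum_distrib_right
    by (intro sum.cong refl) simp
  have eq2: "of_real (dot d (y (zeta \<omega>)) (mv d V (y (zeta \<omega>)))) * G (zeta \<omega>)
    = (\<Sum>a<d. \<Sum>b<d. of_real (V a b) * (of_real (y (zeta \<omega>) a * y (zeta \<omega>) b) * G (zeta \<omega>)))" for \<omega>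
    unfolding mv_def dot_def sum_distrib_left of_real_sum sum_distrib_right
    by (intro sum.cong refl) (simp add: mult_ac)
  have p: "past Q J (\<lambda>z. of_real (y z a * y z b) * G z)" if "a < d" "b < d" for a b
    using that by (intro past_mult of_real_past y G)
  have X: "integrable Q (\<lambda>z. of_real (X z a * X z b) :: 'b)" if "a < d" "b < d" for a b
    using XX_integrable[OF that] by (rule integrable_of_real)
  note 1 = indep_coord_integrable[OF J X p int] and 2 = indep_coord_integral[OF J X p int]
  show "integrable M (\<lambda>\<omega>. of_real ((dot d (X (Z k \<omega>)) (y (zeta \<omega>)))\<^sup>2) * G (zeta \<omega>))"
    unfolding eq by (intro Bochner_Integration.integrable_sum 1) auto
  show "integrable M (\<lambda>\<omega>. of_real (dot d (y (zeta \<omega>)) (mv d V (y (zeta \<omega>)))) * G (zeta \<omega>))"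
    unfolding eq2 by (intro Bochner_Integration.integrable_sum integrable_mult_right int) auto
  have v: "(\<integral>z. of_real (X z a * X z b) \<partial>Q) = (of_real (V a b) :: 'b)" if "a < d" "b < d" for a b
    unfolding V_def by (rule integral_of_real[OF XX_integrable[OF that]])
  have "(\<integral>\<omega>. of_real ((dot d (X (Z k \<omega>)) (y (zeta \<omega>)))\<^sup>2) * G (zeta \<omega>) \<partial>M)
     = (\<Sum>a<d. \<Sum>b<d. \<integral>\<omega>. of_real (X (Z k \<omega>) a * X (Z k \<omega>) b) * (of_real (y (zeta \<omega>) a * y (zeta \<omega>) b) * G (zeta \<omega>)) \<partial>M)"
    unfolding eq by (rule integral_double_sum[OF 1])
  also have "\<dots> = (\<Sum>a<d. \<Sum>b<d. of_real (V a b) * (\<integral>\<omega>. of_real (y (zeta \<omega>) a * y (zeta \<omega>) b) * G (zeta \<omega>) \<partial>M))"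
    by (intro sum.cong refl) (simp only: 2 v lessThan_iff)
  also have "\<dots> = (\<integral>\<omega>. of_real (dot d (y (zeta \<omega>)) (mv d V (y (zeta \<omega>)))) * G (zeta \<omega>) \<partial>M)"
    unfolding eq2
    by (subst integral_double_sum[OF integrable_mult_right[OF int]]) (simp_all only: integral_mult_right_zero)
  finally show "(\<integral>\<omega>. of_real ((dot d (X (Z k \<omega>)) (y (zeta \<omega>)))\<^sup>2) * G (zeta \<omega>) \<partial>M)
      = (\<integral>\<omega>. of_real (dot d (y (zeta \<omega>)) (mv d V (y (zeta \<omega>)))) * G (zeta \<omega>) \<partial>M)" .
qed

lemma H_insert:
  assumes "finite J" "k \<notin> J" "symmetric A"
  shows "H A (insert k J) z = H A J z + 2 * dot d (X (z k)) (mv d A (S J z))"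
proof -
  have "S (insert k J) z = (\<lambda>a. X (z k) a + S J z a)"
    using assms by (auto simp: S_def)
  moreover have "dot d (S J z) (mv d A (X (z k))) = dot d (X (z k)) (mv d A (S J z))"
    using assms(3) unfolding symmetric_def by blast
  ultimately show ?thesis
    using assms(1,2) by (simp add: H_def mv_add dot_add_left dot_add_right)
qed

text \<open>As indices are added, \<open>H\<close> behaves like a martingale: the increment 2 X_k .
  A S is centred given the earlier observations, so the second moments of the increments add up.
  Each is at most 4 C CA times the mean of |S|^2. Bounding that mean by its value over all of
  \<open>I\<close> makes the total linear in card J.\<close>

lemma H_second_moment:
  assumes A: "symmetric A" and A2: "\<And>u. dot d (mv d A u) (mv d A u) \<le> CA * dot d u u"
    and V: "\<And>u. dot d u (mv d V u) \<le> C * dot d u u" and C: "0 \<le> C" "0 \<le> CA" and J: "J \<subseteq> I"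
  shows "integrable M (\<lambda>\<omega>. (H A J (zeta \<omega>))\<^sup>2) \<and>
    (\<integral>\<omega>. (H A J (zeta \<omega>))\<^sup>2 \<partial>M) \<le> 4 * real (card J) * (C * (CA * (real (card I) * trV)))"
proof -
  have tr0: "0 \<le> trV" unfolding trV_eq by (rule Bochner_Integration.integral_nonneg) simp
  have "finite J" using J fin finite_subset by auto
  then show ?thesis using J
  proof (induction J rule: finite_induct)
    case empty
    then show ?case by (simp add: H_def S_def dot_def mv_def)
  next
    case (insert k J)
    have k: "J \<subseteq> I" "k \<in> I" "k \<notin> J" using insert by auto
    note IH = insert.IH[OF k(1)]
    let ?y = "\<lambda>z. mv d A (S J z)"
    let ?D = "\<lambda>\<omega>. dot d (X (Z k \<omega>)) (?y (zeta \<omega>))"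
    have ym: "(\<lambda>\<omega>. ?y (zeta \<omega>) a) \<in> borel_measurable M" for a
      by (rule past_measurable[OF past_mv_S k(1)])
    have Hm: "(\<lambda>\<omega>. H A J (zeta \<omega>)) \<in> borel_measurable M"
      by (rule past_measurable[OF past_H k(1)])
    have yH: "integrable M (\<lambda>\<omega>. of_real (?y (zeta \<omega>) a) * H A J (zeta \<omega>))" if "a < d" for a
      using mv_S_mult_integrable[OF k(1) that that, of A] IH
      by (auto intro!: square_integrable_mult ym Hm simp: power2_eq_square)
    have yy: "integrable M (\<lambda>\<omega>. of_real (?y (zeta \<omega>) a * ?y (zeta \<omega>) b) * (1::real))" if "a < d" "b < d" for a b
      using mv_S_mult_integrable[OF k(1) that, of A] by simp
    note l1 = linear_term_integrable[OF k past_mv_S past_H yH, simplified]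
      and l2 = linear_term_integral[OF k past_mv_S past_H yH, simplified]
    have q1: "integrable M (\<lambda>\<omega>. (?D \<omega>)\<^sup>2)"
      using quad_term_integrable[OF k past_mv_S past_const yy] by simp
    have q2: "(\<integral>\<omega>. (?D \<omega>)\<^sup>2 \<partial>M) = (\<integral>\<omega>. dot d (?y (zeta \<omega>)) (mv d V (?y (zeta \<omega>))) \<partial>M)"
      using quad_term_integral[OF k past_mv_S past_const yy] by simp
    have q3: "integrable M (\<lambda>\<omega>. dot d (?y (zeta \<omega>)) (mv d V (?y (zeta \<omega>))))"
      using quad_term_V_integrable[OF k past_mv_S past_const yy] by simp
    have eq: "(H A (insert k J) (zeta \<omega>))\<^sup>2 = (H A J (zeta \<omega>))\<^sup>2 + 4 * (?D \<omega> * H A J (zeta \<omega>)) + 4 * (?D \<omega>)\<^sup>2" for \<omega>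
      unfolding H_insert[OF insert(1,2) A] by (simp add: power2_eq_square algebra_simps)
    have "(\<integral>\<omega>. (?D \<omega>)\<^sup>2 \<partial>M) \<le> (\<integral>\<omega>. C * (CA * dot d (S J (zeta \<omega>)) (S J (zeta \<omega>))) \<partial>M)"
      unfolding q2
    proof (rule integral_mono[OF q3])
      show "integrable M (\<lambda>\<omega>. C * (CA * dot d (S J (zeta \<omega>)) (S J (zeta \<omega>))))"
        using dot_S_integrable[OF k(1)] by auto
      fix \<omega>
      have "dot d (?y (zeta \<omega>)) (mv d V (?y (zeta \<omega>))) \<le> C * dot d (?y (zeta \<omega>)) (?y (zeta \<omega>))" by (rule V)
      also have "\<dots> \<le> C * (CA * dot d (S J (zeta \<omega>)) (S J (zeta \<omega>)))" by (intro mult_left_mono A2 C)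
      finally show "dot d (?y (zeta \<omega>)) (mv d V (?y (zeta \<omega>))) \<le> C * (CA * dot d (S J (zeta \<omega>)) (S J (zeta \<omega>)))" .
    qed
    also have "\<dots> = C * (CA * (real (card J) * trV))" by (simp add: dot_S_integral[OF k(1)])
    also have "\<dots> \<le> C * (CA * (real (card I) * trV))"
      using C tr0 card_mono[OF fin k(1)] by (intro mult_left_mono mult_right_mono) auto
    finally have D: "(\<integral>\<omega>. (?D \<omega>)\<^sup>2 \<partial>M) \<le> C * (CA * (real (card I) * trV))" .
    have int: "integrable M (\<lambda>\<omega>. (H A (insert k J) (zeta \<omega>))\<^sup>2)"
      unfolding eq using IH l1 q1 by auto
    have "(\<integral>\<omega>. (H A (insert k J) (zeta \<omega>))\<^sup>2 \<partial>M) = (\<integral>\<omega>. (H A J (zeta \<omega>))\<^sup>2 \<partial>M) + 4 * (\<integral>\<omega>. (?D \<omega>)\<^sup>2 \<partial>M)"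
      unfolding eq using IH l1 q1 l2 by simp
    also have "\<dots> \<le> 4 * real (card J) * (C * (CA * (real (card I) * trV))) + 4 * (C * (CA * (real (card I) * trV)))"
      using D IH by (intro add_mono mult_left_mono) auto
    also have "\<dots> = 4 * real (card (insert k J)) * (C * (CA * (real (card I) * trV)))"
      using insert(1,2) by (simp add: algebra_simps)
    finally show ?case using int by blast
  qed
qed

lemma trV_le:
  assumes V: "\<And>u. dot d u (mv d V u) \<le> C * dot d u u"
  shows "trV \<le> C * real d"
proof -
  have "V a a \<le> C" if "a < d" for a
  proof -
    have "dot d (unitv a) (mv d V (unitv a)) = V a a" "dot d (unitv a) (unitv a) = 1"
      using that by (simp_all add: dot_unitv mv_unitv) (simp add: unitv_def)
    then show ?thesis using V[of "unitv a"] by simp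
  qed
  then have "trV \<le> (\<Sum>a<d. C)" unfolding trV_def by (intro sum_mono) auto
  then show ?thesis by (simp add: mult.commute)
qed

definition tail :: "real \<Rightarrow> real" where
  "tail e = (\<integral>z. dot d (X z) (X z) * indicator {z. e * sqrt (real (card I)) < nrm d (X z)} z \<partial>Q)"

text \<open>The summand 2 C^2 sqrt d comes from the off-diagonal part, e C^2 sqrt d from the
  truncated diagonal and 2 C tail e from the part cut off. Relative to n d this vanishes as d grows,
  which is what makes the Stein argument work.\<close>

definition conc_bound :: "real \<Rightarrow> real \<Rightarrow> real" where
  "conc_bound C e = real (card I) * ((2 + e) * C\<^sup>2 * sqrt (real d) + 2 * C * tail e)"

lemma nrm_X_measurable: "(\<lambda>z. nrm d (X z)) \<in> borel_measurable Q"
  unfolding nrm_def dot_def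
  by (intro measurable_compose[OF _ borel_measurable_sqrt] borel_measurable_sum borel_measurable_times X_meas) auto

lemma tail_integrable: "integrable Q (\<lambda>z. dot d (X z) (X z) * indicator {z. c < nrm d (X z)} z)"
proof (rule Bochner_Integration.integrable_bound[OF dot_X_X_integrable])
  have [measurable]: "(\<lambda>z. nrm d (X z)) \<in> borel_measurable Q" by (rule nrm_X_measurable)
  have [measurable]: "(\<lambda>z. dot d (X z) (X z)) \<in> borel_measurable Q" using dot_X_X_integrable by auto
  show "(\<lambda>z. dot d (X z) (X z) * indicator {z. c < nrm d (X z)} z) \<in> borel_measurable Q"
    unfolding indicator_def by measurable
qed (auto simp: indicator_def)

lemma tail_nonneg: "0 \<le> tail e"
  unfolding tail_def by (rule Bochner_Integration.integral_nonneg) simp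

text \<open>The truncation level C e^2 n for X . A X is chosen so that exceeding it forces |X| > e
  sqrt n. The mass cut off is then at most C times the Lindeberg tail.\<close>

lemma diagonal_deviation:
  assumes C: "1 \<le> C" and e: "0 \<le> e"
    and A0: "\<And>u. 0 \<le> dot d u (mv d A u)" and A1: "\<And>u. dot d u (mv d A u) \<le> C * dot d u u"
    and V: "\<And>u. dot d u (mv d V u) \<le> C * dot d u u" and J: "J \<subseteq> I"
  shows "(\<integral>\<omega>. \<bar>(\<Sum>j\<in>J. dot d (X (Z j \<omega>)) (mv d A (X (Z j \<omega>))))
      - real (card J) * (\<integral>z. dot d (X z) (mv d A (X z)) \<partial>Q)\<bar> \<partial>M)
    \<le> real (card I) * (e * C\<^sup>2 * sqrt (real d) + 2 * C * tail e)"
proof -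
  let ?g = "\<lambda>z. dot d (X z) (mv d A (X z))"
  let ?n = "real (card I)"
  let ?K = "C * (e\<^sup>2 * ?n)"
  have K: "0 \<le> ?K" using C by simp
  have cJ: "real (card J) \<le> ?n" using card_mono[OF fin J] by simp
  have "(\<integral>z. ?g z \<partial>Q) \<le> (\<integral>z. C * dot d (X z) (X z) \<partial>Q)"
    using dot_X_X_integrable by (intro integral_mono dot_X_mv_X_integrable A1) auto
  also have "\<dots> = C * trV" by (simp add: trV_eq)
  also have "\<dots> \<le> C * (C * real d)" using C by (intro mult_left_mono trV_le V) auto
  finally have g1: "(\<integral>z. ?g z \<partial>Q) \<le> C\<^sup>2 * real d" by (simp add: power2_eq_square)
  have "?n * (?K * (\<integral>z. ?g z \<partial>Q)) \<le> ?n * (?K * (C\<^sup>2 * real d))"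
    using K g1 by (intro mult_left_mono) auto
  \<comment> \<open>The spare factor C >= 1 completes the radicand to a perfect square.\<close>
  also have "\<dots> \<le> C * (?n * (?K * (C\<^sup>2 * real d)))"
    using mult_right_mono[OF C, of "?n * (?K * (C\<^sup>2 * real d))"] K by simp
  also have "\<dots> = (?n * (e * C\<^sup>2 * sqrt (real d)))\<^sup>2"
    by (simp add: power2_eq_square mult_ac)
  finally have "sqrt (?n * (?K * (\<integral>z. ?g z \<partial>Q))) \<le> sqrt ((?n * (e * C\<^sup>2 * sqrt (real d)))\<^sup>2)"
    by (rule real_sqrt_le_mono)
  also have "\<dots> = ?n * (e * C\<^sup>2 * sqrt (real d))" using e by simp
  finally have 1: "sqrt (?n * (?K * (\<integral>z. ?g z \<partial>Q))) \<le> ?n * (e * C\<^sup>2 * sqrt (real d))" .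
  have ii: "integrable Q (\<lambda>z. ?g z * indicator {z. ?K < ?g z} z)"
  proof (rule Bochner_Integration.integrable_bound[OF dot_X_mv_X_integrable])
    have [measurable]: "?g \<in> borel_measurable Q" using dot_X_mv_X_integrable by auto
    show "(\<lambda>z. ?g z * indicator {z. ?K < ?g z} z) \<in> borel_measurable Q"
      unfolding indicator_def by measurable
  qed (auto simp: indicator_def)
  have "(\<integral>z. ?g z * indicator {z. ?K < ?g z} z \<partial>Q)
    \<le> (\<integral>z. C * (dot d (X z) (X z) * indicator {z. e * sqrt ?n < nrm d (X z)} z) \<partial>Q)"
  proof (rule integral_mono[OF ii])
    show "integrable Q (\<lambda>z. C * (dot d (X z) (X z) * indicator {z. e * sqrt ?n < nrm d (X z)} z))"
      using tail_integrable by auto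
    fix z
    have "e * sqrt ?n < nrm d (X z)" if "?K < ?g z"
    proof -
      have "C * (e\<^sup>2 * ?n) < C * dot d (X z) (X z)" using that A1[of "X z"] by linarith
      then have "e\<^sup>2 * ?n < dot d (X z) (X z)" using C by simp
      then have "sqrt (e\<^sup>2 * ?n) < nrm d (X z)" unfolding nrm_def by (rule real_sqrt_less_mono)
      then show ?thesis using e by (simp add: real_sqrt_mult)
    qed
    then show "?g z * indicator {z. ?K < ?g z} z
      \<le> C * (dot d (X z) (X z) * indicator {z. e * sqrt ?n < nrm d (X z)} z)"
      using A1[of "X z"] C by (auto simp: indicator_def)
  qed
  then have 2: "(\<integral>z. ?g z * indicator {z. ?K < ?g z} z \<partial>Q) \<le> C * tail e"
    by (simp add: tail_def)
  have "(\<integral>\<omega>. \<bar>(\<Sum>j\<in>J. ?g (Z j \<omega>)) - real (card J) * (\<integral>z. ?g z \<partial>Q)\<bar> \<partial>M) \<le>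
    sqrt (?n * (?K * (\<integral>z. ?g z \<partial>Q))) + 2 * ?n * (\<integral>z. ?g z * indicator {z. ?K < ?g z} z \<partial>Q)"
    by (rule mean_deviation_le[OF dot_X_mv_X_integrable A0 J cJ K])
  also have "\<dots> \<le> ?n * (e * C\<^sup>2 * sqrt (real d)) + 2 * ?n * (C * tail e)"
    using 1 2 by (intro add_mono mult_left_mono) auto
  finally show ?thesis by (simp add: algebra_simps)
qed

text \<open>The form splits into \<open>H\<close>, which is controlled in mean square, and its
  diagonal, which is controlled by truncation. The second moment bound for \<open>H\<close> is of
  order n^2 d, hence a deviation of order n sqrt d against a mean that may be of order n d.\<close>

lemma quadratic_concentration:
  assumes C: "1 \<le> C" and e: "0 \<le> e" and A: "symmetric A"
    and A0: "\<And>u. 0 \<le> dot d u (mv d A u)" and A1: "\<And>u. dot d u (mv d A u) \<le> C * dot d u u"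
    and A2: "\<And>u. dot d (mv d A u) (mv d A u) \<le> C\<^sup>2 * dot d u u"
    and V: "\<And>u. dot d u (mv d V u) \<le> C * dot d u u" and J: "J \<subseteq> I"
  shows "(\<integral>\<omega>. \<bar>dot d (S J (zeta \<omega>)) (mv d A (S J (zeta \<omega>)))
      - real (card J) * (\<integral>z. dot d (X z) (mv d A (X z)) \<partial>Q)\<bar> \<partial>M) \<le> conc_bound C e"
proof -
  let ?g = "\<lambda>z. dot d (X z) (mv d A (X z))"
  let ?n = "real (card I)"
  let ?D = "\<lambda>\<omega>. (\<Sum>j\<in>J. ?g (Z j \<omega>)) - real (card J) * (\<integral>z. ?g z \<partial>Q)"
  have cJ: "real (card J) \<le> ?n" using card_mono[OF fin J] by simp
  have tr0: "0 \<le> trV" unfolding trV_eq by (rule Bochner_Integration.integral_nonneg) simp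
  have Hm: "(\<lambda>\<omega>. H A J (zeta \<omega>)) \<in> borel_measurable M"
    by (rule past_measurable[OF past_H J])
  note H2 = H_second_moment[OF A A2 V _ _ J]
  have Hi: "integrable M (\<lambda>\<omega>. (H A J (zeta \<omega>))\<^sup>2)" using H2 C by simp
  have "(\<integral>\<omega>. (H A J (zeta \<omega>))\<^sup>2 \<partial>M) \<le> 4 * real (card J) * (C * (C\<^sup>2 * (?n * trV)))"
    using H2 C by simp
  also have "\<dots> \<le> 4 * ?n * (C * (C\<^sup>2 * (?n * (C * real d))))"
    using cJ C tr0 trV_le[OF V] by (intro mult_mono mult_left_mono mult_nonneg_nonneg) auto
  finally have "(\<integral>\<omega>. (H A J (zeta \<omega>))\<^sup>2 \<partial>M) \<le> 4 * ?n * (C * (C\<^sup>2 * (?n * (C * real d))))" .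
  from abs_expectation_le_sqrt[OF Hm Hi this]
  have "(\<integral>\<omega>. \<bar>H A J (zeta \<omega>)\<bar> \<partial>M) \<le> sqrt (4 * ?n * (C * (C\<^sup>2 * (?n * (C * real d)))))" .
  also have "4 * ?n * (C * (C\<^sup>2 * (?n * (C * real d)))) = (?n * (2 * C\<^sup>2 * sqrt (real d)))\<^sup>2"
    by (simp add: power2_eq_square mult_ac)
  also have "sqrt \<dots> = ?n * (2 * C\<^sup>2 * sqrt (real d))" by simp
  finally have h: "(\<integral>\<omega>. \<bar>H A J (zeta \<omega>)\<bar> \<partial>M) \<le> ?n * (2 * C\<^sup>2 * sqrt (real d))" .
  have dd: "(\<integral>\<omega>. \<bar>?D \<omega>\<bar> \<partial>M) \<le> ?n * (e * C\<^sup>2 * sqrt (real d) + 2 * C * tail e)"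
    by (rule diagonal_deviation[OF C e A0 A1 V J])
  have iH: "integrable M (\<lambda>\<omega>. H A J (zeta \<omega>))"
    by (rule square_integrable_imp[OF prob_space_axioms Hm Hi])
  have iD: "integrable M ?D"
    using J by (auto intro!: Bochner_Integration.integrable_sum coord_integrable dot_X_mv_X_integrable)
  have "(\<integral>\<omega>. \<bar>dot d (S J (zeta \<omega>)) (mv d A (S J (zeta \<omega>))) - real (card J) * (\<integral>z. ?g z \<partial>Q)\<bar> \<partial>M)
    \<le> (\<integral>\<omega>. \<bar>H A J (zeta \<omega>)\<bar> + \<bar>?D \<omega>\<bar> \<partial>M)"
  proof (rule integral_mono)
    show "integrable M (\<lambda>\<omega>. \<bar>dot d (S J (zeta \<omega>)) (mv d A (S J (zeta \<omega>))) - real (card J) * (\<integral>z. ?g z \<partial>Q)\<bar>)"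
      using dot_S_mv_S_integrable[OF J] by auto
    show "integrable M (\<lambda>\<omega>. \<bar>H A J (zeta \<omega>)\<bar> + \<bar>?D \<omega>\<bar>)" using iH iD by auto
  qed (simp add: H_def)
  also have "\<dots> = (\<integral>\<omega>. \<bar>H A J (zeta \<omega>)\<bar> \<partial>M) + (\<integral>\<omega>. \<bar>?D \<omega>\<bar> \<partial>M)"
    using iH iD by (intro Bochner_Integration.integral_add integrable_abs)
  also have "\<dots> \<le> conc_bound C e"
    using h dd by (simp add: conc_bound_def algebra_simps)
  finally show ?thesis .
qed

end

section \<open>Stein's method for the off-diagonal quadratic form\<close>

lemma mv_unitv_id: "i < d \<Longrightarrow> mv d unitv u i = u i"
  using dot_unitv[of i d u] by (simp add: mv_def dot_def)

lemma dot_mv_unitv: "dot d v (mv d unitv u) = dot d v u"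
  by (intro dot_cong mv_unitv_id refl)

text \<open>Here r stands for the modulus of exp (i t D) - 1 - i t D, with x = |X_k| and s = |S|. If
  x <= e' and s <= K, then |D| is at most 2 a e' K and the quadratic bound on r gives a small
  multiple of D^2. Otherwise the linear bound on r leaves D^2 on an exceptional event, and for large
  x a further Cauchy-Schwarz step separates x from s so that independence can be used.\<close>

lemma remainder_product_bound:
  fixes D t a p x s e' K :: real
  assumes D: "D = 2 * a * p" and p: "\<bar>p\<bar> \<le> x * s" and a: "0 \<le> a" and xs: "0 \<le> x" "0 \<le> s" and eK: "0 \<le> e'" "0 \<le> K"
    and r: "r \<le> t\<^sup>2 * D\<^sup>2 / 2" "r \<le> 2 * \<bar>t * D\<bar>"
  shows "\<bar>D\<bar> * r \<le> t\<^sup>2 * (a * e' * K) * D\<^sup>2 + 2 * \<bar>t\<bar> * (D\<^sup>2 * (if K < s then 1 else 0))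
    + 8 * \<bar>t\<bar> * a\<^sup>2 * ((x\<^sup>2 * (if e' < x then 1 else 0)) * s\<^sup>2)"
proof -
  have n: "0 \<le> t\<^sup>2 * (a * e' * K) * D\<^sup>2" "0 \<le> 2 * \<bar>t\<bar> * (D\<^sup>2 * (if K < s then 1 else 0))"
    "0 \<le> 8 * \<bar>t\<bar> * a\<^sup>2 * ((x\<^sup>2 * (if e' < x then 1 else 0)) * s\<^sup>2)"
    using a eK by auto
  have "\<bar>D\<bar> * r \<le> \<bar>D\<bar> * (2 * \<bar>t * D\<bar>)" using r(2) by (rule mult_left_mono) simp
  also have "\<dots> = 2 * \<bar>t\<bar> * D\<^sup>2" by (simp add: abs_mult power2_eq_square)
  finally have r2: "\<bar>D\<bar> * r \<le> 2 * \<bar>t\<bar> * D\<^sup>2" .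
  have "\<bar>D\<bar> = 2 * a * \<bar>p\<bar>" using a by (simp add: D abs_mult)
  then have Dx: "\<bar>D\<bar> \<le> 2 * a * (x * s)" using mult_left_mono[OF p, of "2 * a"] a by simp
  consider "K < s" | "e' < x" | "s \<le> K" "x \<le> e'" by linarith
  then show ?thesis
  proof cases
    case 1
    then have i: "(if K < s then 1 else 0) = (1::real)" by simp
    show ?thesis using r2 n unfolding i mult_1_right by linarith
  next
    case 2
    have "D\<^sup>2 \<le> (2 * a * (x * s))\<^sup>2"
      using Dx by (metis abs_ge_zero power2_abs power_mono)
    then have "2 * \<bar>t\<bar> * D\<^sup>2 \<le> 2 * \<bar>t\<bar> * (2 * a * (x * s))\<^sup>2" by (intro mult_left_mono) auto
    also have "\<dots> = 8 * \<bar>t\<bar> * a\<^sup>2 * (x\<^sup>2 * s\<^sup>2)" by (simp add: power2_eq_square)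
    finally have 3: "2 * \<bar>t\<bar> * D\<^sup>2 \<le> 8 * \<bar>t\<bar> * a\<^sup>2 * (x\<^sup>2 * s\<^sup>2)" .
    have i: "(if e' < x then 1 else 0) = (1::real)" using 2 by simp
    show ?thesis using 3 r2 n unfolding i mult_1_right by linarith
  next
    case 3
    have "x * s \<le> e' * K" using 3 xs eK by (intro mult_mono) auto
    then have "\<bar>D\<bar> \<le> 2 * a * (e' * K)" using Dx mult_left_mono[of "x * s" "e' * K" "2 * a"] a by simp
    have "\<bar>D\<bar> * r \<le> \<bar>D\<bar> * (t\<^sup>2 * D\<^sup>2 / 2)" using r(1) by (rule mult_left_mono) simp
    also have "\<dots> \<le> 2 * a * (e' * K) * (t\<^sup>2 * D\<^sup>2 / 2)"
      by (rule mult_right_mono) (fact, simp)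
    also have "\<dots> = t\<^sup>2 * (a * e' * K) * D\<^sup>2" by simp
    finally show ?thesis using n by linarith
  qed
qed

lemma iexp_bounded_mult_integrable:
  assumes "integrable M f" "g \<in> borel_measurable M"
  shows "integrable M (\<lambda>\<omega>. of_real (f \<omega>) * iexp (g \<omega>))"
proof (rule Bochner_Integration.integrable_bound[OF assms(1)])
  have [measurable]: "f \<in> borel_measurable M" "g \<in> borel_measurable M" using assms by auto
  show "(\<lambda>\<omega>. of_real (f \<omega>) * iexp (g \<omega>)) \<in> borel_measurable M" by measurable
qed (simp add: norm_mult)

context iid_vectors
begin

text \<open>The integral form matches the centring in \<open>quadratic_concentration\<close>; by
  \<open>T2_eq\<close> this is the trace of the square of V.\<close>

definition T2 :: real where "T2 = (\<integral>z. dot d (X z) (mv d V (X z)) \<partial>Q)"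

text \<open>The off-diagonal form over n observations has variance 2 n (n - 1) T2, so this
  normalises it up to a factor that tends to 1.\<close>

definition scale :: real where "scale = 1 / (real (card I) * sqrt (2 * T2))"

definition qf :: "nat set \<Rightarrow> (nat \<Rightarrow> 'z) \<Rightarrow> real" where
  "qf J z = scale * H unitv J z"

lemma dot_S_mv_S_integral:
  assumes "J \<subseteq> I"
  shows "(\<integral>\<omega>. dot d (S J (zeta \<omega>)) (mv d A (S J (zeta \<omega>))) \<partial>M)
    = real (card J) * (\<integral>z. dot d (X z) (mv d A (X z)) \<partial>Q)"
proof -
  have e: "dot d u (mv d A u) = (\<Sum>k<d. \<Sum>l<d. A k l * (u k * u l))" for u
    unfolding mv_def dot_def sum_distrib_left by (intro sum.cong refl) simp
  have "(\<integral>\<omega>. dot d (S J (zeta \<omega>)) (mv d A (S J (zeta \<omega>))) \<partial>M)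
    = (\<Sum>k<d. \<Sum>l<d. A k l * (real (card J) * V k l))"
    unfolding e
    by (subst integral_double_sum) (auto simp: S_mult_integrable[OF assms] S_mult_integral[OF assms])
  also have "\<dots> = real (card J) * (\<Sum>k<d. \<Sum>l<d. A k l * V k l)"
    unfolding sum_distrib_left by (intro sum.cong refl) simp
  also have "(\<Sum>k<d. \<Sum>l<d. A k l * V k l) = (\<integral>z. dot d (X z) (mv d A (X z)) \<partial>Q)"
    unfolding e by (subst integral_double_sum) (auto simp: XX_integrable V_def)
  finally show ?thesis .
qed

lemma T2_eq: "T2 = (\<Sum>a<d. \<Sum>b<d. V a b * V a b)"
proof -
  have e: "dot d u (mv d V u) = (\<Sum>k<d. \<Sum>l<d. V k l * (u k * u l))" for u
    unfolding mv_def dot_def sum_distrib_left by (intro sum.cong refl) simp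
  show ?thesis
    unfolding T2_def e by (subst integral_double_sum) (auto simp: XX_integrable V_def)
qed

lemma unitv_symmetric: "symmetric unitv"
  unfolding symmetric_def by (simp add: dot_mv_unitv dot_commute)

lemma qf_insert: "finite J \<Longrightarrow> k \<notin> J \<Longrightarrow> qf (insert k J) z = qf J z + 2 * scale * dot d (X (z k)) (S J z)"
  unfolding qf_def by (simp add: H_insert[OF _ _ unitv_symmetric] dot_mv_unitv algebra_simps)

lemma past_qf: "past Q J (qf J)"
  unfolding qf_def[abs_def] by (intro past_mult past_const past_H)

lemma past_iexp_qf: "past Q J (\<lambda>z. iexp (t * qf J z))"
  by (rule past_compose[OF past_qf]) simp

lemma qf_measurable: "J \<subseteq> I \<Longrightarrow> (\<lambda>\<omega>. qf J (zeta \<omega>)) \<in> borel_measurable M"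
  by (rule past_measurable[OF past_qf])

text \<open>Every unordered pair of observations occurs in two of the summands, once for each of its
  members, whence the factor 1/2.\<close>

lemma qf_eq_sum:
  "qf I z = 1 / 2 * (\<Sum>k\<in>I. 2 * scale * dot d (X (z k)) (S (I - {k}) z))"
proof -
  have S: "S (I - {k}) z = (\<lambda>a. S I z a - X (z k) a)" if "k \<in> I" for k
    using that fin by (auto simp: S_def sum_diff1)
  have "(\<Sum>k\<in>I. dot d (X (z k)) (S (I - {k}) z)) = (\<Sum>k\<in>I. dot d (S I z) (X (z k)) - dot d (X (z k)) (X (z k)))"
    by (intro sum.cong refl) (simp add: S dot_diff_right dot_commute)
  also have "\<dots> = dot d (S I z) (\<lambda>a. \<Sum>k\<in>I. X (z k) a) - (\<Sum>k\<in>I. dot d (X (z k)) (X (z k)))"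
    by (simp add: sum_subtractf dot_sum_right)
  also have "\<dots> = H unitv I z"
    unfolding H_def dot_mv_unitv by (simp add: S_def[abs_def])
  finally have "(\<Sum>k\<in>I. dot d (X (z k)) (S (I - {k}) z)) = H unitv I z" .
  then show ?thesis by (simp add: qf_def sum_distrib_left[symmetric])
qed

context
  fixes C c e :: real
  assumes ne: "I \<noteq> {}" and d: "0 < d" and C: "1 \<le> C" and c: "0 < c" and e: "0 \<le> e"
    and V1: "\<And>u. dot d u (mv d V u) \<le> C * dot d u u"
    and V2: "\<And>u. dot d (mv d V u) (mv d V u) \<le> C\<^sup>2 * dot d u u"
    and T2c: "c * real d \<le> T2"
begin

abbreviation (input) n :: real where "n \<equiv> real (card I)"
text \<open>The mean of |S|^2 is at most C n d. Twice this bound is the threshold, so |S| > K can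
  only occur when |S|^2 deviates substantially from its mean.\<close>

abbreviation (input) K :: real where "K \<equiv> sqrt (2 * C * n * real d)"

lemma T2_pos: "0 < T2"
  using T2c c d by (meson less_le_trans mult_pos_pos of_nat_0_less_iff)

lemma n_pos: "0 < n"
  using ne fin by (simp add: card_gt_0_iff)

lemma scale_pos: "0 < scale"
  using T2_pos n_pos by (simp add: scale_def)

lemma scale_sq: "scale\<^sup>2 = 1 / (2 * n\<^sup>2 * T2)"
  using T2_pos by (simp add: scale_def power_divide power_mult_distrib)

lemma conc_V:
  assumes "J \<subseteq> I"
  shows "(\<integral>\<omega>. \<bar>dot d (S J (zeta \<omega>)) (mv d V (S J (zeta \<omega>))) - real (card J) * T2\<bar> \<partial>M) \<le> conc_bound C e"
  unfolding T2_def by (rule quadratic_concentration[OF C e V_symmetric V_nonneg V1 V2 V1 assms])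

lemma conc_id:
  assumes "J \<subseteq> I"
  shows "(\<integral>\<omega>. \<bar>dot d (S J (zeta \<omega>)) (S J (zeta \<omega>)) - real (card J) * trV\<bar> \<partial>M) \<le> conc_bound C e"
proof -
  have 2: "dot d (mv d unitv u) (mv d unitv u) \<le> C\<^sup>2 * dot d u u" for u
  proof -
    have "dot d (mv d unitv u) (mv d unitv u) = dot d u u"
      by (intro dot_cong mv_unitv_id)
    moreover have "1 * dot d u u \<le> C\<^sup>2 * dot d u u"
      using C by (intro mult_right_mono) (auto simp: one_le_power)
    ultimately show ?thesis by simp
  qed
  have 1: "dot d u (mv d unitv u) \<le> C * dot d u u" for u
    using mult_right_mono[OF C, of "dot d u u"] by (simp add: dot_mv_unitv)
  have 0: "0 \<le> dot d u (mv d unitv u)" for u by (simp add: dot_mv_unitv)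
  show ?thesis
    using quadratic_concentration[OF C e unitv_symmetric 0 1 2 V1 assms]
    by (simp add: dot_mv_unitv trV_eq)
qed

text \<open>Where |S| exceeds K, the square of |S| is more than twice its mean, hence at most twice
  its deviation from the mean. Concentration therefore controls the truncated second moment of
  S.\<close>

lemma large_S_bound:
  assumes J: "J \<subseteq> I"
  shows "(\<integral>\<omega>. dot d (S J (zeta \<omega>)) (S J (zeta \<omega>)) * (if K < nrm d (S J (zeta \<omega>)) then 1 else 0) \<partial>M)
    \<le> 2 * conc_bound C e"
    and large_S_integrable:
    "integrable M (\<lambda>\<omega>. dot d (S J (zeta \<omega>)) (S J (zeta \<omega>)) * (if K < nrm d (S J (zeta \<omega>)) then 1 else 0))"
proof -
  let ?s2 = "\<lambda>\<omega>. dot d (S J (zeta \<omega>)) (S J (zeta \<omega>))"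
  have m: "(\<lambda>\<omega>. nrm d (S J (zeta \<omega>))) \<in> borel_measurable M"
    unfolding nrm_def by (intro past_measurable[OF _ J] past_sqrt past_dot past_S)
  have [measurable]: "?s2 \<in> borel_measurable M" using dot_S_integrable[OF J] by auto
  note [measurable] = m
  show i: "integrable M (\<lambda>\<omega>. ?s2 \<omega> * (if K < nrm d (S J (zeta \<omega>)) then 1 else 0))"
    by (rule Bochner_Integration.integrable_bound[OF dot_S_integrable[OF J]]) auto
  have "(\<integral>\<omega>. ?s2 \<omega> * (if K < nrm d (S J (zeta \<omega>)) then 1 else 0) \<partial>M)
    \<le> (\<integral>\<omega>. 2 * \<bar>?s2 \<omega> - real (card J) * trV\<bar> \<partial>M)"
  proof (rule integral_mono[OF i])
    show "integrable M (\<lambda>\<omega>. 2 * \<bar>?s2 \<omega> - real (card J) * trV\<bar>)"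
      using dot_S_integrable[OF J] by auto
    fix \<omega>
    show "?s2 \<omega> * (if K < nrm d (S J (zeta \<omega>)) then 1 else 0) \<le> 2 * \<bar>?s2 \<omega> - real (card J) * trV\<bar>"
    proof (cases "K < nrm d (S J (zeta \<omega>))")
      case True
      then have "2 * C * n * real d < ?s2 \<omega>" unfolding nrm_def by simp
      moreover have "real (card J) * trV \<le> n * (C * real d)"
        using card_mono[OF fin J] trV_le[OF V1] C
        by (intro mult_mono) (auto simp: trV_eq intro!: Bochner_Integration.integral_nonneg)
      ultimately have "2 * (real (card J) * trV) < ?s2 \<omega>" by (simp add: mult_ac)
      then have "?s2 \<omega> \<le> 2 * (?s2 \<omega> - real (card J) * trV)" by (simp add: right_diff_distrib)
      also have "\<dots> \<le> 2 * \<bar>?s2 \<omega> - real (card J) * trV\<bar>"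
        by (intro mult_left_mono abs_ge_self) simp
      finally show ?thesis using True by simp
    qed simp
  qed
  also have "\<dots> \<le> 2 * conc_bound C e" using conc_id[OF J] by simp
  finally show "(\<integral>\<omega>. ?s2 \<omega> * (if K < nrm d (S J (zeta \<omega>)) then 1 else 0) \<partial>M) \<le> 2 * conc_bound C e" .
qed

text \<open>The first three summands come from the Taylor remainder, one for each case of
  \<open>remainder_product_bound\<close>. The fourth is the error in replacing the conditional
  second moment of D by 2 / n, and the last is the cost of putting observation k back into the
  exponential.\<close>

definition term_bound :: "real \<Rightarrow> real" where
  "term_bound t = t\<^sup>2 * (scale * (e * sqrt n) * K) * (2 / n) + 8 * \<bar>t\<bar> * scale\<^sup>2 * C * (2 * conc_bound C e)
     + 8 * \<bar>t\<bar> * scale\<^sup>2 * (tail e * (n * (C * real d)))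
     + \<bar>t\<bar> * (4 * scale\<^sup>2 * (conc_bound C e + T2)) + 2 / n * t\<^sup>2 * sqrt (2 / n)"

text \<open>\<open>D\<close> collects the terms of the off-diagonal form that involve the observation \<open>k\<close>. Given the
  other observations it is centred, so only its conditional second moment survives in the expansion
  of \<open>exp (\<i> t D)\<close>, and that concentrates at \<open>2 / n\<close>.\<close>

lemma stein_term:
  assumes k: "k \<in> I"
  defines "D \<equiv> \<lambda>\<omega>. 2 * scale * dot d (X (Z k \<omega>)) (S (I - {k}) (zeta \<omega>))"
  shows "cmod ((\<integral>\<omega>. of_real (D \<omega>) * iexp (t * qf I (zeta \<omega>)) \<partial>M)
      - 2 * \<i> * t / n * (\<integral>\<omega>. iexp (t * qf I (zeta \<omega>)) \<partial>M)) \<le> term_bound t"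
    and stein_term_integrable: "integrable M (\<lambda>\<omega>. of_real (D \<omega>) * iexp (t * qf I (zeta \<omega>)))"
proof -
  define J where "J = I - {k}"
  have J: "J \<subseteq> I" "k \<in> I" "k \<notin> J" and IJ: "I = insert k J" and fJ: "finite J"
    using k fin by (auto simp: J_def)
  have cJ: "real (card J) = n - 1" using card.remove[OF fin k] by (simp add: J_def)
  let ?S = "\<lambda>\<omega>. S J (zeta \<omega>)"
  let ?p = "\<lambda>\<omega>. dot d (X (Z k \<omega>)) (?S \<omega>)"
  let ?E = "\<lambda>\<omega>. iexp (t * qf J (zeta \<omega>))"
  have D: "D \<omega> = 2 * scale * ?p \<omega>" for \<omega> by (simp add: D_def J_def)
  have Sm: "(\<lambda>\<omega>. ?S \<omega> a) \<in> borel_measurable M" if "a < d" for a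
    by (rule past_measurable[OF past_S[OF that] J(1)])
  have Si: "integrable M (\<lambda>\<omega>. ?S \<omega> a)" if "a < d" for a
    by (rule square_integrable_imp[OF prob_space_axioms Sm[OF that]])
      (simp only: power2_eq_square S_mult_integrable[OF J(1) that that])
  have qm: "(\<lambda>\<omega>. t * qf J (zeta \<omega>)) \<in> borel_measurable M"
    using qf_measurable[OF J(1)] by auto
  have qIm: "(\<lambda>\<omega>. t * qf I (zeta \<omega>)) \<in> borel_measurable M"
    using qf_measurable[of I] by auto
  have S1: "integrable M (\<lambda>\<omega>. of_real (?S \<omega> a) * (1::real))" if "a < d" for a
    using Si[OF that] by simp
  have pint: "integrable M ?p"
    using linear_term_integrable[OF J past_S past_const S1] by simp
  have SS: "integrable M (\<lambda>\<omega>. of_real (?S \<omega> a * ?S \<omega> b) * (1::real))" if "a < d" "b < d" for a b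
    using S_mult_integrable[OF J(1) that] by simp
  have p2: "integrable M (\<lambda>\<omega>. (?p \<omega>)\<^sup>2)"
    using quad_term_integrable[OF J past_S past_const SS] by simp
  have p2V: "(\<integral>\<omega>. (?p \<omega>)\<^sup>2 \<partial>M) = real (card J) * T2"
    using quad_term_integral[OF J past_S past_const SS] dot_S_mv_S_integral[OF J(1), of V]
    by (simp add: T2_def)
  have Dint: "integrable M D" unfolding D using pint by auto
  have D2int: "integrable M (\<lambda>\<omega>. (D \<omega>)\<^sup>2)" unfolding D power_mult_distrib using p2 by auto
  have "(\<integral>\<omega>. (D \<omega>)\<^sup>2 \<partial>M) = 4 * scale\<^sup>2 * (real (card J) * T2)"
    unfolding D power_mult_distrib using p2V by simp
  also have "\<dots> \<le> 4 * scale\<^sup>2 * (n * T2)"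
    using cJ T2_pos by (intro mult_left_mono mult_right_mono) auto
  also have "\<dots> = 2 / n" unfolding scale_sq using T2_pos n_pos by (simp add: field_simps power2_eq_square)
  finally have D2: "(\<integral>\<omega>. (D \<omega>)\<^sup>2 \<partial>M) \<le> 2 / n" .
  have ED: "(\<integral>\<omega>. \<bar>D \<omega>\<bar> \<partial>M) \<le> sqrt (2 / n)"
    using Dint by (intro abs_expectation_le_sqrt[OF _ D2int D2]) auto
  show int: "integrable M (\<lambda>\<omega>. of_real (D \<omega>) * iexp (t * qf I (zeta \<omega>)))"
    by (rule iexp_bounded_mult_integrable[OF Dint qIm])
  have qI: "t * qf I (zeta \<omega>) = t * D \<omega> + t * qf J (zeta \<omega>)" for \<omega>
  proof -
    have "qf I (zeta \<omega>) = qf (insert k J) (zeta \<omega>)" by (simp only: IJ[symmetric])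
    then show ?thesis unfolding qf_insert[OF fJ J(3)] D by (simp add: algebra_simps)
  qed
  have ex: "iexp (t * qf I (zeta \<omega>)) = iexp (t * D \<omega>) * ?E \<omega>" for \<omega>
    unfolding qI of_real_add distrib_left exp_add by simp
  define R where "R = (\<lambda>\<omega>. iexp (t * D \<omega>) - 1 - \<i> * of_real (t * D \<omega>))"
  have iDE: "integrable M (\<lambda>\<omega>. of_real (D \<omega>) * ?E \<omega>)"
    by (rule iexp_bounded_mult_integrable[OF Dint qm])
  have iD2E: "integrable M (\<lambda>\<omega>. of_real ((D \<omega>)\<^sup>2) * ?E \<omega>)"
    by (rule iexp_bounded_mult_integrable[OF D2int qm])
  have split: "of_real (D \<omega>) * iexp (t * qf I (zeta \<omega>)) = of_real (D \<omega>) * R \<omega> * ?E \<omega>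
    + of_real (D \<omega>) * ?E \<omega> + \<i> * t * (of_real ((D \<omega>)\<^sup>2) * ?E \<omega>)" for \<omega>
    unfolding ex R_def by (simp add: algebra_simps power2_eq_square)
  have iR: "integrable M (\<lambda>\<omega>. of_real (D \<omega>) * R \<omega> * ?E \<omega>)"
  proof -
    have "of_real (D \<omega>) * R \<omega> * ?E \<omega> = of_real (D \<omega>) * iexp (t * qf I (zeta \<omega>))
      - of_real (D \<omega>) * ?E \<omega> - \<i> * t * (of_real ((D \<omega>)\<^sup>2) * ?E \<omega>)" for \<omega>
      using split[of \<omega>] by simp
    then show ?thesis using int iDE iD2E by simp
  qed
  have SE: "integrable M (\<lambda>\<omega>. of_real (?S \<omega> a) * ?E \<omega>)" if "a < d" for a
    by (rule iexp_bounded_mult_integrable[OF Si[OF that] qm])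
  have "(\<integral>\<omega>. of_real (?p \<omega>) * ?E \<omega> \<partial>M) = 0"
    by (rule linear_term_integral[OF J past_S past_iexp_qf SE])
  then have z: "(\<integral>\<omega>. of_real (D \<omega>) * ?E \<omega> \<partial>M) = 0"
    unfolding D of_real_mult mult.assoc by simp
  have SSE: "integrable M (\<lambda>\<omega>. of_real (?S \<omega> a * ?S \<omega> b) * ?E \<omega>)" if "a < d" "b < d" for a b
    by (rule iexp_bounded_mult_integrable[OF S_mult_integrable[OF J(1) that] qm])
  have "(\<integral>\<omega>. of_real ((?p \<omega>)\<^sup>2) * ?E \<omega> \<partial>M) = (\<integral>\<omega>. of_real (dot d (?S \<omega>) (mv d V (?S \<omega>))) * ?E \<omega> \<partial>M)"
    by (rule quad_term_integral[OF J past_S past_iexp_qf SSE])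
  then have q: "(\<integral>\<omega>. of_real ((D \<omega>)\<^sup>2) * ?E \<omega> \<partial>M)
    = 4 * scale\<^sup>2 * (\<integral>\<omega>. of_real (dot d (?S \<omega>) (mv d V (?S \<omega>))) * ?E \<omega> \<partial>M)"
    unfolding D power_mult_distrib of_real_mult mult.assoc by simp
  let ?B = "\<lambda>\<omega>. dot d (?S \<omega>) (mv d V (?S \<omega>))"
  have iB: "integrable M ?B" by (rule dot_S_mv_S_integrable[OF J(1)])
  have iE: "integrable M ?E"
    using iexp_bounded_mult_integrable[of M "\<lambda>_. 1", OF _ qm] by simp
  have iEI: "integrable M (\<lambda>\<omega>. iexp (t * qf I (zeta \<omega>)))"
    using iexp_bounded_mult_integrable[of M "\<lambda>_. 1", OF _ qIm] by simp
  have iBE: "integrable M (\<lambda>\<omega>. of_real (?B \<omega>) * ?E \<omega>)"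
    by (rule iexp_bounded_mult_integrable[OF iB qm])
  \<comment> \<open>Three errors remain once the linear term has dropped out: the Taylor remainder,
    the deviation of the V-form of S from n T2, and the change from J back to I in the exponential.
    The leading terms match because 4 scale^2 n T2 = 2 / n.\<close>
  have main: "(\<integral>\<omega>. of_real (D \<omega>) * iexp (t * qf I (zeta \<omega>)) \<partial>M)
      - 2 * \<i> * t / n * (\<integral>\<omega>. iexp (t * qf I (zeta \<omega>)) \<partial>M)
    = (\<integral>\<omega>. of_real (D \<omega>) * R \<omega> * ?E \<omega> \<partial>M)
      + \<i> * t * (4 * scale\<^sup>2 * (\<integral>\<omega>. of_real (?B \<omega> - n * T2) * ?E \<omega> \<partial>M))
      + 2 * \<i> * t / n * (\<integral>\<omega>. ?E \<omega> - iexp (t * qf I (zeta \<omega>)) \<partial>M)"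
  proof -
    have 1: "(\<integral>\<omega>. of_real (D \<omega>) * iexp (t * qf I (zeta \<omega>)) \<partial>M)
      = (\<integral>\<omega>. of_real (D \<omega>) * R \<omega> * ?E \<omega> \<partial>M) + \<i> * t * (4 * scale\<^sup>2 * (\<integral>\<omega>. of_real (?B \<omega>) * ?E \<omega> \<partial>M))"
      unfolding split q[symmetric] using iR iDE iD2E z by simp
    have 2: "(\<integral>\<omega>. of_real (?B \<omega> - n * T2) * ?E \<omega> \<partial>M)
      = (\<integral>\<omega>. of_real (?B \<omega>) * ?E \<omega> \<partial>M) - of_real (n * T2) * (\<integral>\<omega>. ?E \<omega> \<partial>M)"
      unfolding of_real_diff left_diff_distrib using iBE iE by (subst Bochner_Integration.integral_diff) auto
    have 3: "(\<integral>\<omega>. ?E \<omega> - iexp (t * qf I (zeta \<omega>)) \<partial>M) = (\<integral>\<omega>. ?E \<omega> \<partial>M) - (\<integral>\<omega>. iexp (t * qf I (zeta \<omega>)) \<partial>M)"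
      using iE iEI by (rule Bochner_Integration.integral_diff)
    have 4: "4 * scale\<^sup>2 * (n * T2) = 2 / n"
      unfolding scale_sq using T2_pos n_pos by (simp add: field_simps power2_eq_square)
    have 5: "4 * (of_real scale)\<^sup>2 * of_real (n * T2) = (of_real (2 / n) :: complex)"
      unfolding 4[symmetric] by simp
    show ?thesis
      unfolding 1 2 3 right_diff_distrib mult.assoc[symmetric]
      using 5 by (simp add: algebra_simps)
  qed
  have t1: "cmod (\<integral>\<omega>. of_real (D \<omega>) * R \<omega> * ?E \<omega> \<partial>M) \<le> t\<^sup>2 * (scale * (e * sqrt n) * K) * (2 / n)
     + 8 * \<bar>t\<bar> * scale\<^sup>2 * C * (2 * conc_bound C e) + 8 * \<bar>t\<bar> * scale\<^sup>2 * (tail e * (n * (C * real d)))"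
  proof -
    let ?x = "\<lambda>\<omega>. nrm d (X (Z k \<omega>))" and ?s = "\<lambda>\<omega>. nrm d (?S \<omega>)"
    let ?i = "\<lambda>\<omega>. if K < ?s \<omega> then 1 else (0::real)"
    let ?f = "\<lambda>z. (nrm d (X z))\<^sup>2 * (if e * sqrt n < nrm d (X z) then 1 else 0)"
    have pi: "past Q J (\<lambda>z. if K < nrm d (S J z) then 1 else (0::real))"
    proof -
      have "past Q J (\<lambda>z. nrm d (S J z))" unfolding nrm_def by (intro past_sqrt past_dot past_S)
      then show ?thesis by (rule past_compose) simp
    qed
    have im: "?i \<in> borel_measurable M" by (rule past_measurable[OF pi J(1)])
    have SSi: "integrable M (\<lambda>\<omega>. of_real (?S \<omega> a * ?S \<omega> b) * ?i \<omega>)" if "a < d" "b < d" for a b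
    proof (rule Bochner_Integration.integrable_bound[OF S_mult_integrable[OF J(1) that]])
      show "(\<lambda>\<omega>. of_real (?S \<omega> a * ?S \<omega> b) * ?i \<omega>) \<in> borel_measurable M"
        unfolding of_real_mult of_real_eq_id id_apply using that by (intro borel_measurable_times im Sm)
    qed auto
    have i2: "integrable M (\<lambda>\<omega>. (?p \<omega>)\<^sup>2 * ?i \<omega>)"
      using quad_term_integrable[OF J past_S pi SSi] by simp
    have "(\<integral>\<omega>. (?p \<omega>)\<^sup>2 * ?i \<omega> \<partial>M) = (\<integral>\<omega>. ?B \<omega> * ?i \<omega> \<partial>M)"
      using quad_term_integral[OF J past_S pi SSi] by simp
    also have "\<dots> \<le> (\<integral>\<omega>. C * (dot d (?S \<omega>) (?S \<omega>) * ?i \<omega>) \<partial>M)"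
    proof (rule integral_mono)
      show "integrable M (\<lambda>\<omega>. ?B \<omega> * ?i \<omega>)"
        using quad_term_V_integrable[OF J past_S pi SSi] by simp
      show "integrable M (\<lambda>\<omega>. C * (dot d (?S \<omega>) (?S \<omega>) * ?i \<omega>))"
        using large_S_integrable[OF J(1)] by (rule integrable_mult_right)
      show "?B \<omega> * ?i \<omega> \<le> C * (dot d (?S \<omega>) (?S \<omega>) * ?i \<omega>)" for \<omega>
        using V1[of "?S \<omega>"] by simp
    qed
    also have "\<dots> \<le> C * (2 * conc_bound C e)"
      using large_S_bound[OF J(1)] C by (simp only: integral_mult_right_zero) (auto intro: mult_left_mono)
    finally have b2: "(\<integral>\<omega>. (?p \<omega>)\<^sup>2 * ?i \<omega> \<partial>M) \<le> C * (2 * conc_bound C e)" .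
    have f: "?f = (\<lambda>z. dot d (X z) (X z) * indicator {z. e * sqrt n < nrm d (X z)} z)"
      by (auto simp: nrm_power2 indicator_def)
    have fi: "integrable Q ?f" unfolding f by (rule tail_integrable)
    have ft: "(\<integral>z. ?f z \<partial>Q) = tail e" unfolding f tail_def ..
    have ps: "past Q J (\<lambda>z. dot d (S J z) (S J z))" by (intro past_dot past_S)
    have i3: "integrable M (\<lambda>\<omega>. ?f (Z k \<omega>) * dot d (?S \<omega>) (?S \<omega>))"
      by (rule indep_coord_integrable[OF J fi ps dot_S_integrable[OF J(1)]])
    have "(\<integral>\<omega>. ?f (Z k \<omega>) * dot d (?S \<omega>) (?S \<omega>) \<partial>M) = tail e * (real (card J) * trV)"
      unfolding indep_coord_integral[OF J fi ps dot_S_integrable[OF J(1)]] ft dot_S_integral[OF J(1)] ..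
    also have "\<dots> \<le> tail e * (n * (C * real d))"
      using cJ trV_le[OF V1] tail_nonneg C
      by (intro mult_left_mono mult_mono) (auto simp: trV_eq intro!: Bochner_Integration.integral_nonneg)
    finally have b3: "(\<integral>\<omega>. ?f (Z k \<omega>) * dot d (?S \<omega>) (?S \<omega>) \<partial>M) \<le> tail e * (n * (C * real d))" .
    have "cmod (\<integral>\<omega>. of_real (D \<omega>) * R \<omega> * ?E \<omega> \<partial>M) \<le> (\<integral>\<omega>. cmod (of_real (D \<omega>) * R \<omega> * ?E \<omega>) \<partial>M)"
      by (rule integral_norm_bound)
    also have "\<dots> \<le> (\<integral>\<omega>. t\<^sup>2 * (scale * (e * sqrt n) * K) * (D \<omega>)\<^sup>2
        + 2 * \<bar>t\<bar> * (4 * scale\<^sup>2 * ((?p \<omega>)\<^sup>2 * ?i \<omega>))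
        + 8 * \<bar>t\<bar> * scale\<^sup>2 * (?f (Z k \<omega>) * dot d (?S \<omega>) (?S \<omega>)) \<partial>M)"
    proof (rule integral_mono)
      show "integrable M (\<lambda>\<omega>. cmod (of_real (D \<omega>) * R \<omega> * ?E \<omega>))" using iR by (rule integrable_norm)
      show "integrable M (\<lambda>\<omega>. t\<^sup>2 * (scale * (e * sqrt n) * K) * (D \<omega>)\<^sup>2
        + 2 * \<bar>t\<bar> * (4 * scale\<^sup>2 * ((?p \<omega>)\<^sup>2 * ?i \<omega>))
        + 8 * \<bar>t\<bar> * scale\<^sup>2 * (?f (Z k \<omega>) * dot d (?S \<omega>) (?S \<omega>)))"
        by (intro Bochner_Integration.integrable_add integrable_mult_right D2int i2 i3)
      fix \<omega>
      have "cmod (of_real (D \<omega>) * R \<omega> * ?E \<omega>) = \<bar>D \<omega>\<bar> * cmod (R \<omega>)" by (simp add: norm_mult)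
      also have "\<dots> \<le> t\<^sup>2 * (scale * (e * sqrt n) * K) * (D \<omega>)\<^sup>2 + 2 * \<bar>t\<bar> * ((D \<omega>)\<^sup>2 * ?i \<omega>)
        + 8 * \<bar>t\<bar> * scale\<^sup>2 * (((?x \<omega>)\<^sup>2 * (if e * sqrt n < ?x \<omega> then 1 else 0)) * (?s \<omega>)\<^sup>2)"
      \<comment> \<open>The thresholds are e sqrt n for |X_k|, as in \<open>tail\<close>, and
        \<open>K\<close> for |S|, as in \<open>large_S_bound\<close>.\<close>
      proof (rule remainder_product_bound[OF D dot_le_nrm])
        show "cmod (R \<omega>) \<le> t\<^sup>2 * (D \<omega>)\<^sup>2 / 2"
          using iexp_approx1[of "t * D \<omega>" 1] unfolding R_def
          by (simp add: algebra_simps power_mult_distrib power2_eq_square abs_mult)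
        show "cmod (R \<omega>) \<le> 2 * \<bar>t * D \<omega>\<bar>"
          using iexp_approx2[of "t * D \<omega>" 1] unfolding R_def by (simp add: algebra_simps)
      qed (use scale_pos e C in auto)
      also have "(D \<omega>)\<^sup>2 * ?i \<omega> = 4 * scale\<^sup>2 * ((?p \<omega>)\<^sup>2 * ?i \<omega>)"
        unfolding D power_mult_distrib by simp
      finally show "cmod (of_real (D \<omega>) * R \<omega> * ?E \<omega>) \<le> t\<^sup>2 * (scale * (e * sqrt n) * K) * (D \<omega>)\<^sup>2
        + 2 * \<bar>t\<bar> * (4 * scale\<^sup>2 * ((?p \<omega>)\<^sup>2 * ?i \<omega>))
        + 8 * \<bar>t\<bar> * scale\<^sup>2 * (?f (Z k \<omega>) * dot d (?S \<omega>) (?S \<omega>))"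
        unfolding nrm_power2[of d "?S \<omega>"] .
    qed
    also have "\<dots> = t\<^sup>2 * (scale * (e * sqrt n) * K) * (\<integral>\<omega>. (D \<omega>)\<^sup>2 \<partial>M)
        + 2 * \<bar>t\<bar> * (4 * scale\<^sup>2 * (\<integral>\<omega>. (?p \<omega>)\<^sup>2 * ?i \<omega> \<partial>M))
        + 8 * \<bar>t\<bar> * scale\<^sup>2 * (\<integral>\<omega>. ?f (Z k \<omega>) * dot d (?S \<omega>) (?S \<omega>) \<partial>M)"
      using integrable_mult_right[OF D2int] integrable_mult_right[OF integrable_mult_right[OF i2]] integrable_mult_right[OF i3]
      by (subst Bochner_Integration.integral_add Bochner_Integration.integral_add | simp only: integral_mult_right_zero Bochner_Integration.integrable_add)+
    also have "\<dots> \<le> t\<^sup>2 * (scale * (e * sqrt n) * K) * (2 / n)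
        + 2 * \<bar>t\<bar> * (4 * scale\<^sup>2 * (C * (2 * conc_bound C e)))
        + 8 * \<bar>t\<bar> * scale\<^sup>2 * (tail e * (n * (C * real d)))"
      using scale_pos e C by (intro add_mono mult_left_mono D2 b2 b3) auto
    finally show ?thesis by (simp add: mult_ac)
  qed
  have t2: "cmod (\<integral>\<omega>. of_real (?B \<omega> - n * T2) * ?E \<omega> \<partial>M) \<le> conc_bound C e + T2"
  proof -
    have "cmod (\<integral>\<omega>. of_real (?B \<omega> - n * T2) * ?E \<omega> \<partial>M) \<le> (\<integral>\<omega>. cmod (of_real (?B \<omega> - n * T2) * ?E \<omega>) \<partial>M)"
      by (rule integral_norm_bound)
    also have "\<dots> = (\<integral>\<omega>. \<bar>?B \<omega> - n * T2\<bar> \<partial>M)"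
      by (simp only: norm_mult norm_of_real norm_exp_i_times mult_1_right)
    \<comment> \<open>The form concentrates at card J * T2 = (n - 1) T2, so centring it at n T2
      costs one further T2.\<close>
    also have "\<dots> \<le> (\<integral>\<omega>. \<bar>?B \<omega> - real (card J) * T2\<bar> + T2 \<partial>M)"
    proof (rule integral_mono)
      show "\<bar>?B \<omega> - n * T2\<bar> \<le> \<bar>?B \<omega> - real (card J) * T2\<bar> + T2" for \<omega>
        using T2_pos unfolding cJ by (simp add: algebra_simps)
    qed (use iB in auto)
    also have "\<dots> = (\<integral>\<omega>. \<bar>?B \<omega> - real (card J) * T2\<bar> \<partial>M) + T2"
      using iB by (subst Bochner_Integration.integral_add) (auto simp: prob_space)
    finally show ?thesis using conc_V[OF J(1)] by linarith
  qed
  have t3: "cmod (\<integral>\<omega>. ?E \<omega> - iexp (t * qf I (zeta \<omega>)) \<partial>M) \<le> \<bar>t\<bar> * sqrt (2 / n)"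
  proof -
    have "cmod (\<integral>\<omega>. ?E \<omega> - iexp (t * qf I (zeta \<omega>)) \<partial>M) \<le> (\<integral>\<omega>. cmod (?E \<omega> - iexp (t * qf I (zeta \<omega>))) \<partial>M)"
      by (rule integral_norm_bound)
    also have "\<dots> \<le> (\<integral>\<omega>. \<bar>t\<bar> * \<bar>D \<omega>\<bar> \<partial>M)"
    proof (rule integral_mono)
      show "integrable M (\<lambda>\<omega>. cmod (?E \<omega> - iexp (t * qf I (zeta \<omega>))))"
        by (intro integrable_norm Bochner_Integration.integrable_diff iE iEI)
      show "integrable M (\<lambda>\<omega>. \<bar>t\<bar> * \<bar>D \<omega>\<bar>)" using Dint by auto
      fix \<omega>
      have "?E \<omega> - iexp (t * qf I (zeta \<omega>)) = - ((iexp (t * D \<omega>) - 1) * ?E \<omega>)"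
        unfolding ex by (simp add: algebra_simps)
      then have "cmod (?E \<omega> - iexp (t * qf I (zeta \<omega>))) = cmod (iexp (t * D \<omega>) - 1)"
        by (simp add: norm_mult)
      also have "\<dots> \<le> \<bar>t * D \<omega>\<bar>" using iexp_approx1[of "t * D \<omega>" 0] by simp
      finally show "cmod (?E \<omega> - iexp (t * qf I (zeta \<omega>))) \<le> \<bar>t\<bar> * \<bar>D \<omega>\<bar>" by (simp add: abs_mult)
    qed
    also have "\<dots> = \<bar>t\<bar> * (\<integral>\<omega>. \<bar>D \<omega>\<bar> \<partial>M)" by simp
    also have "\<dots> \<le> \<bar>t\<bar> * sqrt (2 / n)" by (intro mult_left_mono ED) auto
    finally show ?thesis .
  qed
  let ?a = "\<integral>\<omega>. of_real (D \<omega>) * R \<omega> * ?E \<omega> \<partial>M"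
  let ?b = "\<integral>\<omega>. of_real (?B \<omega> - n * T2) * ?E \<omega> \<partial>M"
  let ?c = "\<integral>\<omega>. ?E \<omega> - iexp (t * qf I (zeta \<omega>)) \<partial>M"
  have "cmod (?a + \<i> * t * (4 * scale\<^sup>2 * ?b) + 2 * \<i> * t / n * ?c)
    \<le> cmod ?a + cmod (\<i> * t * (4 * scale\<^sup>2 * ?b)) + cmod (2 * \<i> * t / n * ?c)"
    by (meson add_mono_thms_linordered_semiring(3) norm_triangle_le order_refl norm_triangle_ineq)
  also have "cmod (\<i> * t * (4 * scale\<^sup>2 * ?b)) = \<bar>t\<bar> * (4 * scale\<^sup>2 * cmod ?b)"
    by (simp add: norm_mult norm_power)
  also have "cmod (2 * \<i> * t / n * ?c) = 2 / n * \<bar>t\<bar> * cmod ?c"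
    by (simp add: norm_mult norm_divide)
  also have "cmod ?a + \<bar>t\<bar> * (4 * scale\<^sup>2 * cmod ?b) + 2 / n * \<bar>t\<bar> * cmod ?c
    \<le> (t\<^sup>2 * (scale * (e * sqrt n) * K) * (2 / n)
     + 8 * \<bar>t\<bar> * scale\<^sup>2 * C * (2 * conc_bound C e) + 8 * \<bar>t\<bar> * scale\<^sup>2 * (tail e * (n * (C * real d))))
     + \<bar>t\<bar> * (4 * scale\<^sup>2 * (conc_bound C e + T2)) + 2 / n * \<bar>t\<bar> * (\<bar>t\<bar> * sqrt (2 / n))"
    using n_pos by (intro add_mono t1 mult_left_mono t2 t3) auto
  also have "\<dots> = term_bound t"
    by (simp add: term_bound_def power2_eq_square)
  finally show "cmod ((\<integral>\<omega>. of_real (D \<omega>) * iexp (t * qf I (zeta \<omega>)) \<partial>M)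
      - 2 * \<i> * t / n * (\<integral>\<omega>. iexp (t * qf I (zeta \<omega>)) \<partial>M)) \<le> term_bound t"
    unfolding main .
qed

end

end

text \<open>A finite second moment bounds the first order Taylor error of the exponential by (s -
  t)^2 Y^2 / 2. The difference quotient therefore converges at the explicit rate |s - t|.\<close>

lemma (in prob_space) char_has_vector_derivative:
  fixes Y :: "'a \<Rightarrow> real"
  assumes Y: "Y \<in> borel_measurable M" "integrable M (\<lambda>x. (Y x)\<^sup>2)"
  shows "((\<lambda>t. \<integral>x. iexp (t * Y x) \<partial>M) has_vector_derivative
    (\<integral>x. \<i> * (of_real (Y x) * iexp (t * Y x)) \<partial>M)) (at t within A)"
proof -
  let ?f = "\<lambda>t. \<integral>x. iexp (t * Y x) \<partial>M" and ?D = "\<integral>x. \<i> * (of_real (Y x) * iexp (t * Y x)) \<partial>M"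
  have Yi: "integrable M Y"
    by (rule square_integrable_imp[OF prob_space_axioms Y])
  have m: "(\<lambda>x. s * Y x) \<in> borel_measurable M" for s using Y by auto
  have i1: "integrable M (\<lambda>x. iexp (s * Y x))" for s
    using iexp_bounded_mult_integrable[of M "\<lambda>_. 1", OF _ m] by simp
  have i2: "integrable M (\<lambda>x. \<i> * (of_real (Y x) * iexp (t * Y x)))"
    by (intro integrable_mult_right iexp_bounded_mult_integrable Yi m)
  have bound: "norm (?f s - ?f t - (s - t) *\<^sub>R ?D) \<le> (s - t)\<^sup>2 * ((\<integral>x. (Y x)\<^sup>2 \<partial>M) / 2)" for s
  proof -
    let ?g = "\<lambda>x. iexp (s * Y x) - iexp (t * Y x) - (s - t) *\<^sub>R (\<i> * (of_real (Y x) * iexp (t * Y x)))"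
    have ig: "integrable M ?g" by (intro Bochner_Integration.integrable_diff i1 integrable_scaleR_right i2)
    have eq: "?f s - ?f t - (s - t) *\<^sub>R ?D = (\<integral>x. ?g x \<partial>M)"
      using i1 i2 by (simp add: Bochner_Integration.integral_diff)
    have "norm (?f s - ?f t - (s - t) *\<^sub>R ?D) \<le> (\<integral>x. norm (?g x) \<partial>M)"
      unfolding eq by (rule integral_norm_bound)
    also have "\<dots> \<le> (\<integral>x. (s - t)\<^sup>2 / 2 * (Y x)\<^sup>2 \<partial>M)"
    proof (rule integral_mono)
      show "integrable M (\<lambda>x. norm (?g x))" by (rule integrable_norm[OF ig])
      show "integrable M (\<lambda>x. (s - t)\<^sup>2 / 2 * (Y x)\<^sup>2)" by (rule integrable_mult_right[OF Y(2)])
      fix x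
      let ?h = "(s - t) * Y x"
      have "s * Y x = ?h + t * Y x" by (simp add: algebra_simps)
      then have "iexp (s * Y x) = iexp ?h * iexp (t * Y x)"
        by (simp only: of_real_add distrib_left exp_add)
      then have "?g x = (iexp ?h - 1 - \<i> * of_real ?h) * iexp (t * Y x)"
        by (simp add: algebra_simps scaleR_conv_of_real)
      then have "norm (?g x) = cmod (iexp ?h - 1 - \<i> * of_real ?h)" by (simp add: norm_mult)
      also have "\<dots> \<le> ?h\<^sup>2 / 2"
        using iexp_approx1[of ?h 1] by (simp add: algebra_simps power2_eq_square abs_mult)
      finally show "norm (?g x) \<le> (s - t)\<^sup>2 / 2 * (Y x)\<^sup>2" by (simp add: power_mult_distrib)
    qed
    also have "\<dots> = (s - t)\<^sup>2 * ((\<integral>x. (Y x)\<^sup>2 \<partial>M) / 2)" by simp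
    finally show ?thesis .
  qed
  show ?thesis
    unfolding has_vector_derivative_def
  proof (rule has_derivativeI_sandwich[where e = 1 and H = "\<lambda>s. \<bar>s - t\<bar> * ((\<integral>x. (Y x)\<^sup>2 \<partial>M) / 2)"])
    show "bounded_linear (\<lambda>x. x *\<^sub>R ?D)" by (rule bounded_linear_scaleR_left)
    fix s assume "s \<noteq> t"
    then have "norm (?f s - ?f t - (s - t) *\<^sub>R ?D) / norm (s - t) \<le> (s - t)\<^sup>2 * ((\<integral>x. (Y x)\<^sup>2 \<partial>M) / 2) / norm (s - t)"
      by (intro divide_right_mono bound) auto
    also have "\<dots> = \<bar>s - t\<bar> * ((\<integral>x. (Y x)\<^sup>2 \<partial>M) / 2)"
    proof -
      have "a\<^sup>2 * k / a = a * k" if "0 < a" for a k :: real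
        using that by (simp add: power2_eq_square)
      from this[of "\<bar>s - t\<bar>"] show ?thesis using \<open>s \<noteq> t\<close> by simp
    qed
    finally show "norm (?f s - ?f t - (s - t) *\<^sub>R ?D) / norm (s - t) \<le> \<bar>s - t\<bar> * ((\<integral>x. (Y x)\<^sup>2 \<partial>M) / 2)" .
  next
    have "((\<lambda>s. \<bar>s - t\<bar> * ((\<integral>x. (Y x)\<^sup>2 \<partial>M) / 2)) \<longlongrightarrow> \<bar>t - t\<bar> * ((\<integral>x. (Y x)\<^sup>2 \<partial>M) / 2)) (at t within A)"
      by (intro tendsto_intros)
    then show "((\<lambda>s. \<bar>s - t\<bar> * ((\<integral>x. (Y x)\<^sup>2 \<partial>M) / 2)) \<longlongrightarrow> 0) (at t within A)" by simp
  qed simp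
qed

text \<open>The Gaussian characteristic function solves \<open>\<psi>' = - t \<psi>\<close>; approximate solutions stay close to it.\<close>

lemma gaussian_ode_stability:
  fixes \<psi> \<psi>' :: "real \<Rightarrow> complex"
  assumes D: "\<And>s A. (\<psi> has_vector_derivative \<psi>' s) (at s within A)" and 0: "\<psi> 0 = 1"
    and R: "\<And>s. \<bar>s\<bar> \<le> \<bar>t\<bar> \<Longrightarrow> cmod (\<psi>' s + s * \<psi> s) \<le> R"
  shows "cmod (\<psi> t - of_real (exp (- (t\<^sup>2) / 2))) \<le> \<bar>t\<bar> * R"
proof -
  let ?E = "\<lambda>s::real. exp (s\<^sup>2 / 2)"
  \<comment> \<open>Integrating factor: the derivative of ?F is exp (s^2 / 2) times the defect that
    \<open>R\<close> bounds. The symmetric interval below treats both signs of t at once.\<close>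
  let ?F = "\<lambda>s. ?E s *\<^sub>R \<psi> s"
  let ?S = "{-\<bar>t\<bar>..\<bar>t\<bar>}"
  have F: "(?F has_vector_derivative ?E s *\<^sub>R (\<psi>' s + s * \<psi> s)) (at s within A)" for s A
  proof -
    have "(?E has_real_derivative ?E s * s) (at s within A)"
      by (auto intro!: derivative_eq_intros)
    then have "(?F has_vector_derivative (?E s *\<^sub>R \<psi>' s + (?E s * s) *\<^sub>R \<psi> s)) (at s within A)"
      by (rule has_vector_derivative_scaleR[OF _ D])
    then show ?thesis by (simp add: scaleR_conv_of_real algebra_simps)
  qed
  have "norm (?F t - ?F 0) \<le> (?E t * R) * norm (t - 0)"
  proof (rule differentiable_bound[where S = ?S and f' = "\<lambda>s h. h *\<^sub>R (?E s *\<^sub>R (\<psi>' s + s * \<psi> s))"])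
    fix s assume "s \<in> ?S"
    then have s: "\<bar>s\<bar> \<le> \<bar>t\<bar>" by auto
    show "(?F has_derivative (\<lambda>h. h *\<^sub>R (?E s *\<^sub>R (\<psi>' s + s * \<psi> s)))) (at s within ?S)"
      using F unfolding has_vector_derivative_def .
    show "onorm (\<lambda>h. h *\<^sub>R (?E s *\<^sub>R (\<psi>' s + s * \<psi> s))) \<le> ?E t * R"
    proof (rule onorm_le)
      fix h
      have "s\<^sup>2 \<le> t\<^sup>2" using s by (simp add: abs_le_square_iff)
      then have "?E s \<le> ?E t" by simp
      then have "?E s * cmod (\<psi>' s + s * \<psi> s) \<le> ?E t * R"
        using R[OF s] by (intro mult_mono) auto
      then have "\<bar>h\<bar> * (?E s * cmod (\<psi>' s + s * \<psi> s)) \<le> \<bar>h\<bar> * (?E t * R)" by (intro mult_left_mono) auto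
      then show "norm (h *\<^sub>R (?E s *\<^sub>R (\<psi>' s + s * \<psi> s))) \<le> ?E t * R * norm h"
        by (simp add: abs_mult mult_ac)
    qed
  qed auto
  then have le: "cmod (?E t *\<^sub>R \<psi> t - 1) \<le> ?E t * R * \<bar>t\<bar>" using 0 by simp
  have "\<psi> t - of_real (exp (- (t\<^sup>2) / 2)) = exp (- (t\<^sup>2) / 2) *\<^sub>R (?E t *\<^sub>R \<psi> t - 1)"
    by (simp add: scaleR_conv_of_real algebra_simps exp_minus flip: of_real_mult exp_add)
  then have "cmod (\<psi> t - of_real (exp (- (t\<^sup>2) / 2))) = exp (- (t\<^sup>2) / 2) * cmod (?E t *\<^sub>R \<psi> t - 1)"
    by simp
  also have "\<dots> \<le> exp (- (t\<^sup>2) / 2) * (?E t * R * \<bar>t\<bar>)" by (intro mult_left_mono le) auto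
  also have "\<dots> = \<bar>t\<bar> * R" by (simp add: exp_minus)
  finally show ?thesis .
qed

context iid_vectors
begin

context
  fixes C c e :: real
  assumes ne: "I \<noteq> {}" and d: "0 < d" and C: "1 \<le> C" and c: "0 < c" and e: "0 \<le> e"
    and V1: "\<And>u. dot d u (mv d V u) \<le> C * dot d u u"
    and V2: "\<And>u. dot d (mv d V u) (mv d V u) \<le> C\<^sup>2 * dot d u u"
    and T2c: "c * real d \<le> T2"
begin

lemmas ctx = ne d C c e V1 V2 T2c

lemma qf_square_integrable: "integrable M (\<lambda>\<omega>. (qf I (zeta \<omega>))\<^sup>2)"
proof -
  have "dot d (mv d unitv u) (mv d unitv u) = dot d u u" for u
    by (intro dot_cong mv_unitv_id)
  then have "dot d (mv d unitv u) (mv d unitv u) \<le> 1 * dot d u u" for u by simp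
  from H_second_moment[OF unitv_symmetric this V1 _ _ order_refl]
  have "integrable M (\<lambda>\<omega>. (H unitv I (zeta \<omega>))\<^sup>2)" using C by simp
  then show ?thesis by (simp add: qf_def power_mult_distrib)
qed

text \<open>By \<open>qf_eq_sum\<close> the derivative is i / 2 times the sum of the Stein terms.
  Each is close to 2 i t / n times the characteristic function, and n times (i / 2) (2 i t / n)
  equals -t.\<close>

lemma stein_equation_bound:
  "cmod ((\<integral>\<omega>. \<i> * (of_real (qf I (zeta \<omega>)) * iexp (t * qf I (zeta \<omega>))) \<partial>M)
    + t * (\<integral>\<omega>. iexp (t * qf I (zeta \<omega>)) \<partial>M)) \<le> real (card I) / 2 * term_bound C e t"
proof -
  let ?n = "real (card I)"
  let ?D = "\<lambda>k \<omega>. 2 * scale * dot d (X (Z k \<omega>)) (S (I - {k}) (zeta \<omega>))"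
  let ?E = "\<lambda>\<omega>. iexp (t * qf I (zeta \<omega>))"
  have n: "0 < ?n" using ne fin by (simp add: card_gt_0_iff)
  note tb = stein_term[OF ctx] stein_term_integrable[OF ctx]
  have "\<i> * (of_real (qf I (zeta \<omega>)) * ?E \<omega>) = (\<Sum>k\<in>I. \<i> / 2 * (of_real (?D k \<omega>) * ?E \<omega>))" for \<omega>
    unfolding qf_eq_sum[of "zeta \<omega>"] of_real_mult of_real_sum
    by (simp add: sum_distrib_left sum_distrib_right mult_ac del: of_real_mult)
  then have "(\<integral>\<omega>. \<i> * (of_real (qf I (zeta \<omega>)) * ?E \<omega>) \<partial>M) = (\<integral>\<omega>. (\<Sum>k\<in>I. \<i> / 2 * (of_real (?D k \<omega>) * ?E \<omega>)) \<partial>M)"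
    by (rule arg_cong[of _ _ "integral\<^sup>L M", OF ext])
  also have "\<dots> = (\<Sum>k\<in>I. \<integral>\<omega>. \<i> / 2 * (of_real (?D k \<omega>) * ?E \<omega>) \<partial>M)"
    by (rule Bochner_Integration.integral_sum) (intro integrable_mult_right tb(2))
  also have "\<dots> = (\<Sum>k\<in>I. \<i> / 2 * (\<integral>\<omega>. of_real (?D k \<omega>) * ?E \<omega> \<partial>M))"
    by (simp only: integral_mult_right_zero)
  finally have 1: "(\<integral>\<omega>. \<i> * (of_real (qf I (zeta \<omega>)) * ?E \<omega>) \<partial>M) = (\<Sum>k\<in>I. \<i> / 2 * (\<integral>\<omega>. of_real (?D k \<omega>) * ?E \<omega> \<partial>M))" .
  have 2: "t * (\<integral>\<omega>. ?E \<omega> \<partial>M) = - (\<Sum>k\<in>I. \<i> / 2 * (2 * \<i> * t / ?n * (\<integral>\<omega>. ?E \<omega> \<partial>M)))"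
    using n by simp
  have eq: "(\<integral>\<omega>. \<i> * (of_real (qf I (zeta \<omega>)) * ?E \<omega>) \<partial>M) + t * (\<integral>\<omega>. ?E \<omega> \<partial>M)
    = (\<Sum>k\<in>I. \<i> / 2 * ((\<integral>\<omega>. of_real (?D k \<omega>) * ?E \<omega> \<partial>M) - 2 * \<i> * t / ?n * (\<integral>\<omega>. ?E \<omega> \<partial>M)))"
    unfolding 1 2 by (simp only: right_diff_distrib sum_subtractf add_uminus_conv_diff)
  have "cmod ((\<integral>\<omega>. \<i> * (of_real (qf I (zeta \<omega>)) * ?E \<omega>) \<partial>M) + t * (\<integral>\<omega>. ?E \<omega> \<partial>M))
    \<le> (\<Sum>k\<in>I. cmod (\<i> / 2 * ((\<integral>\<omega>. of_real (?D k \<omega>) * ?E \<omega> \<partial>M) - 2 * \<i> * t / ?n * (\<integral>\<omega>. ?E \<omega> \<partial>M))))"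
    unfolding eq by (rule norm_sum)
  also have "\<dots> \<le> (\<Sum>k\<in>I. 1 / 2 * term_bound C e t)"
  proof (rule sum_mono)
    fix k assume "k \<in> I"
    have "cmod (\<i> / 2 * ((\<integral>\<omega>. of_real (?D k \<omega>) * ?E \<omega> \<partial>M) - 2 * \<i> * t / ?n * (\<integral>\<omega>. ?E \<omega> \<partial>M)))
      = 1 / 2 * cmod ((\<integral>\<omega>. of_real (?D k \<omega>) * ?E \<omega> \<partial>M) - 2 * \<i> * t / ?n * (\<integral>\<omega>. ?E \<omega> \<partial>M))"
      by (simp only: norm_mult) (simp add: norm_divide)
    also have "\<dots> \<le> 1 / 2 * term_bound C e t" by (intro mult_left_mono tb(1) \<open>k \<in> I\<close>) auto
    finally show "cmod (\<i> / 2 * ((\<integral>\<omega>. of_real (?D k \<omega>) * ?E \<omega> \<partial>M) - 2 * \<i> * t / ?n * (\<integral>\<omega>. ?E \<omega> \<partial>M)))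
      \<le> 1 / 2 * term_bound C e t" .
  qed
  also have "\<dots> = ?n / 2 * term_bound C e t" by simp
  finally show ?thesis .
qed

text \<open>Only d, n and the tail are left, since T2 has been replaced by its lower bound c d. For
  fixed e every summand except t^2 e sqrt (C / c) vanishes as n and d grow. Monotonicity in |t| lets
  one value serve the whole interval of the differential equation.\<close>

definition rate :: "real \<Rightarrow> real" where
  "rate t = t\<^sup>2 * (e * sqrt (C / c) + sqrt (2 / real (card I)))
    + \<bar>t\<bar> * ((4 * C + 1) * ((2 + e) * C\<^sup>2 / (c * sqrt (real d)) + 2 * C * tail e / (c * real d))
      + 2 * C * tail e / c + 1 / real (card I))"

lemma term_bound_le_rate: "real (card I) / 2 * term_bound C e t \<le> rate t"
proof -
  let ?n = "real (card I)"
  have n: "0 < ?n" using ne fin by (simp add: card_gt_0_iff)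
  have d0: "0 < real d" using d by simp
  have T2: "0 < T2" by (rule T2_pos[OF ctx])
  have sc: "scale = 1 / (?n * sqrt (2 * T2))" by (rule scale_def)
  have sq: "scale\<^sup>2 = 1 / (2 * ?n\<^sup>2 * T2)" by (rule scale_sq[OF ctx])
  have tl: "0 \<le> tail e" by (rule tail_nonneg)
  \<comment> \<open>This is \<open>conc_bound C e\<close> divided by n.\<close>
  define \<kappa> where "\<kappa> = (2 + e) * C\<^sup>2 * sqrt (real d) + 2 * C * tail e"
  have cb: "conc_bound C e = ?n * \<kappa>" by (simp add: conc_bound_def \<kappa>_def)
  have \<kappa>0: "0 \<le> \<kappa>" using e C tl by (simp add: \<kappa>_def)
  have 1: "?n / 2 * (t\<^sup>2 * (scale * (e * sqrt ?n) * sqrt (2 * C * ?n * real d)) * (2 / ?n))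
      \<le> t\<^sup>2 * (e * sqrt (C / c))"
  proof -
    have "scale * (e * sqrt ?n) * sqrt (2 * C * ?n * real d) = e * sqrt (C * real d / T2)"
      using n T2 by (simp add: sc real_sqrt_mult real_sqrt_divide field_simps)
    also have "\<dots> \<le> e * sqrt (C / c)"
    proof (intro mult_left_mono real_sqrt_le_mono e)
      have "C * (c * real d) \<le> C * T2" using T2c C by (intro mult_left_mono) auto
      then show "C * real d / T2 \<le> C / c" using T2 c by (simp add: field_simps)
    qed
    finally have "t\<^sup>2 * (scale * (e * sqrt ?n) * sqrt (2 * C * ?n * real d)) \<le> t\<^sup>2 * (e * sqrt (C / c))"
      by (intro mult_left_mono) auto
    then show ?thesis using n by simp
  qed
  have \<kappa>T: "\<kappa> / T2 \<le> \<kappa> / (c * real d)" using T2c c d0 \<kappa>0 by (intro divide_left_mono) (auto simp: T2)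
  have 2: "?n / 2 * (8 * \<bar>t\<bar> * scale\<^sup>2 * C * (2 * conc_bound C e)) \<le> \<bar>t\<bar> * (4 * C * (\<kappa> / (c * real d)))"
  proof -
    have "?n / 2 * (8 * \<bar>t\<bar> * scale\<^sup>2 * C * (2 * conc_bound C e)) = \<bar>t\<bar> * (4 * C * (\<kappa> / T2))"
      unfolding sq cb using n T2 by (simp add: field_simps power2_eq_square)
    also have "\<dots> \<le> \<bar>t\<bar> * (4 * C * (\<kappa> / (c * real d)))"
      using C by (intro mult_left_mono \<kappa>T) auto
    finally show ?thesis .
  qed
  have 3: "?n / 2 * (8 * \<bar>t\<bar> * scale\<^sup>2 * (tail e * (?n * (C * real d)))) \<le> \<bar>t\<bar> * (2 * C * tail e / c)"
  proof -
    have "?n / 2 * (8 * \<bar>t\<bar> * scale\<^sup>2 * (tail e * (?n * (C * real d)))) = \<bar>t\<bar> * (2 * C * tail e * (real d / T2))"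
      unfolding sq using n T2 by (simp add: field_simps power2_eq_square)
    also have "\<dots> \<le> \<bar>t\<bar> * (2 * C * tail e * (1 / c))"
      using C tl T2c T2 c by (intro mult_left_mono) (auto simp: field_simps)
    finally show ?thesis by simp
  qed
  have 4: "?n / 2 * (\<bar>t\<bar> * (4 * scale\<^sup>2 * (conc_bound C e + T2))) \<le> \<bar>t\<bar> * (\<kappa> / (c * real d) + 1 / ?n)"
  proof -
    have "?n / 2 * (\<bar>t\<bar> * (4 * scale\<^sup>2 * (conc_bound C e + T2))) = \<bar>t\<bar> * (\<kappa> / T2 + 1 / ?n)"
      unfolding sq cb using n T2 by (simp add: field_simps power2_eq_square)
    also have "\<dots> \<le> \<bar>t\<bar> * (\<kappa> / (c * real d) + 1 / ?n)"
      using \<kappa>T by (intro mult_left_mono) auto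
    finally show ?thesis .
  qed
  have 5: "?n / 2 * (2 / ?n * t\<^sup>2 * sqrt (2 / ?n)) = t\<^sup>2 * sqrt (2 / ?n)"
    using n by simp
  have \<kappa>d: "\<kappa> / (c * real d) = (2 + e) * C\<^sup>2 / (c * sqrt (real d)) + 2 * C * tail e / (c * real d)"
  proof -
    have *: "sqrt (real d) / real d = 1 / sqrt (real d)" using d0 by (simp add: field_simps)
    have "(2 + e) * C\<^sup>2 * sqrt (real d) / (c * real d) = (2 + e) * C\<^sup>2 / c * (sqrt (real d) / real d)"
      by simp
    also have "\<dots> = (2 + e) * C\<^sup>2 / (c * sqrt (real d))" unfolding * by simp
    finally have "(2 + e) * C\<^sup>2 * sqrt (real d) / (c * real d) = (2 + e) * C\<^sup>2 / (c * sqrt (real d))" .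
    then show ?thesis by (simp add: \<kappa>_def add_divide_distrib)
  qed
  have "?n / 2 * term_bound C e t \<le> t\<^sup>2 * (e * sqrt (C / c)) + \<bar>t\<bar> * (4 * C * (\<kappa> / (c * real d)))
    + \<bar>t\<bar> * (2 * C * tail e / c) + \<bar>t\<bar> * (\<kappa> / (c * real d) + 1 / ?n) + t\<^sup>2 * sqrt (2 / ?n)"
    unfolding term_bound_def[OF ctx] distrib_left[of "?n / 2"] using 1 2 3 4 5 by linarith
  also have "\<dots> = rate t"
    unfolding rate_def \<kappa>d[symmetric] by (simp add: algebra_simps)
  finally show ?thesis .
qed

lemma rate_mono: "\<bar>s\<bar> \<le> \<bar>t\<bar> \<Longrightarrow> rate s \<le> rate t"
  unfolding rate_def using C c e tail_nonneg[of e]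
  by (intro add_mono mult_right_mono abs_le_square_iff[THEN iffD1] add_nonneg_nonneg mult_nonneg_nonneg
      divide_nonneg_nonneg) auto

lemma char_qf_bound:
  "cmod ((\<integral>\<omega>. iexp (t * qf I (zeta \<omega>)) \<partial>M) - of_real (exp (- (t\<^sup>2) / 2))) \<le> \<bar>t\<bar> * rate t"
proof (rule gaussian_ode_stability)
  show "((\<lambda>t. \<integral>\<omega>. iexp (t * qf I (zeta \<omega>)) \<partial>M) has_vector_derivative
      (\<integral>\<omega>. \<i> * (of_real (qf I (zeta \<omega>)) * iexp (s * qf I (zeta \<omega>))) \<partial>M)) (at s within A)" for s A
    by (rule char_has_vector_derivative[OF qf_measurable[OF order_refl] qf_square_integrable])
  show "(\<integral>\<omega>. iexp (0 * qf I (zeta \<omega>)) \<partial>M) = 1" by (simp add: prob_space)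
  fix s assume "\<bar>s\<bar> \<le> \<bar>t\<bar>"
  from order_trans[OF order_trans[OF stein_equation_bound term_bound_le_rate] rate_mono[OF this]]
  show "cmod ((\<integral>\<omega>. \<i> * (of_real (qf I (zeta \<omega>)) * iexp (s * qf I (zeta \<omega>))) \<partial>M)
    + s * (\<integral>\<omega>. iexp (s * qf I (zeta \<omega>)) \<partial>M)) \<le> rate t" .
qed

end

end

section \<open>Limits along an array\<close>

text \<open>A double limit: for each fixed truncation parameter e the bound converges in n to K e,
  and e is sent to 0 afterwards.\<close>

lemma tendsto_zero_of_bounds:
  fixes p :: "nat \<Rightarrow> real"
  assumes p: "\<And>n. 0 \<le> p n" and K: "0 \<le> K"
    and le: "\<And>e. 0 < e \<Longrightarrow> \<forall>\<^sub>F n in sequentially. p n \<le> b e n"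
    and lim: "\<And>e. 0 < e \<Longrightarrow> b e \<longlonglongrightarrow> K * e"
  shows "p \<longlonglongrightarrow> 0"
proof (rule tendstoI)
  fix \<epsilon> :: real assume \<epsilon>: "0 < \<epsilon>"
  \<comment> \<open>Dividing by K + 1 also covers K = 0.\<close>
  define e where "e = \<epsilon> / (2 * (K + 1))"
  have e: "0 < e" using \<epsilon> K by (simp add: e_def)
  have "K * e < \<epsilon>"
  proof -
    have "K * e \<le> (K + 1) * e" using e by (intro mult_right_mono) auto
    also have "\<dots> = \<epsilon> / 2" using K by (simp add: e_def field_simps)
    finally show ?thesis using \<epsilon> by simp
  qed
  then have "\<forall>\<^sub>F n in sequentially. b e n < \<epsilon>" by (rule order_tendstoD(2)[OF lim[OF e]])
  with le[OF e] show "\<forall>\<^sub>F n in sequentially. dist (p n) 0 < \<epsilon>"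
    by eventually_elim (use p in simp)
qed

lemma (in prob_space) prob_gt_le_expectation:
  assumes "integrable M f" "0 < c" "(\<integral>x. \<bar>f x\<bar> \<partial>M) \<le> B"
  shows "prob {x \<in> space M. c < \<bar>f x\<bar>} \<le> B / c"
proof -
  have [measurable]: "f \<in> borel_measurable M" using assms by auto
  have "prob {x \<in> space M. c < \<bar>f x\<bar>} \<le> prob {x \<in> space M. c \<le> \<bar>f x\<bar>}"
    by (intro finite_measure_mono) auto
  also have "\<dots> \<le> (\<integral>x. \<bar>f x\<bar> \<partial>M) / c"
    using assms by (intro integral_Markov_inequality_measure[where A = "{}"]) auto
  also have "\<dots> \<le> B / c" using assms by (intro divide_right_mono) auto
  finally show ?thesis .
qed

lemma isCont_cdf_std_normal: "isCont (cdf std_normal_distribution) t"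
proof -
  interpret N: real_distribution std_normal_distribution by (rule real_dist_normal_dist)
  have "{t} \<in> null_sets std_normal_distribution"
  proof (subst null_sets_density_iff)
    have "AE x in lborel. x \<in> {t} \<longrightarrow> ennreal (std_normal_density x) = 0"
      using AE_lborel_singleton[of t] by eventually_elim simp
    then show "{t} \<in> sets lborel \<and> (AE x in lborel. x \<in> {t} \<longrightarrow> ennreal (std_normal_density x) = 0)"
      by simp
  qed simp
  then have "measure std_normal_distribution {t} = 0"
    by (simp add: measure_def null_setsD1)
  then show ?thesis by (simp add: N.isCont_cdf)
qed

text \<open>The bounds on \<open>V\<close> are only eventual because |U_n|_o = O(1) leaves finitely
  many n free. The probabilistic structure is required for every n, including 0, so that the locale
  of a single sample can be imported with n as a parameter.\<close>

locale vector_array =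
  fixes M :: "'w measure" and Q :: "'z measure" and Z :: "nat \<Rightarrow> 'w \<Rightarrow> 'z"
    and m :: "nat \<Rightarrow> nat" and X :: "nat \<Rightarrow> 'z \<Rightarrow> nat \<Rightarrow> real" and C c :: real
  assumes iid: "\<And>n. iid_vectors M Q Z {1..n} (m n) (X n)"
    and C: "1 \<le> C" and c: "0 < c" and m_lim: "filterlim m at_top sequentially"
    and V1: "\<forall>\<^sub>F n in sequentially. \<forall>u. dot (m n) u (mv (m n) (iid_vectors.V Q (X n)) u) \<le> C * dot (m n) u u"
    and V2: "\<forall>\<^sub>F n in sequentially. \<forall>u. dot (m n) (mv (m n) (iid_vectors.V Q (X n)) u)
      (mv (m n) (iid_vectors.V Q (X n)) u) \<le> C\<^sup>2 * dot (m n) u u"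
    and T2c: "\<forall>\<^sub>F n in sequentially. c * real (m n) \<le> iid_vectors.T2 Q (m n) (X n)"
    and tail: "\<And>e. 0 < e \<Longrightarrow> (\<lambda>n. iid_vectors.tail Q {1..n} (m n) (X n) e) \<longlonglongrightarrow> 0"
begin

sublocale A: iid_vectors M Q Z "{1..n}" "m n" "X n" for n by (rule iid)

abbreviation zeta :: "'w \<Rightarrow> nat \<Rightarrow> 'z" where "zeta \<omega> \<equiv> \<lambda>j. Z j \<omega>"

lemma eventually_ctx:
  "\<forall>\<^sub>F n in sequentially. {1..n} \<noteq> {} \<and> 0 < m n \<and> (\<forall>u. dot (m n) u (mv (m n) (A.V n) u) \<le> C * dot (m n) u u) \<and>
    (\<forall>u. dot (m n) (mv (m n) (A.V n) u) (mv (m n) (A.V n) u) \<le> C\<^sup>2 * dot (m n) u u) \<and> c * real (m n) \<le> A.T2 n"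
proof -
  have "\<forall>\<^sub>F n in sequentially. 1 \<le> m n" using m_lim by (simp add: filterlim_at_top)
  then show ?thesis
    using V1 V2 T2c eventually_ge_at_top[of 1] by eventually_elim auto
qed

lemma inverse_m: "(\<lambda>n. 1 / real (m n)) \<longlonglongrightarrow> 0"
  using filterlim_compose[OF lim_1_over_n m_lim] by simp

lemma inverse_sqrt_m: "(\<lambda>n. 1 / sqrt (real (m n))) \<longlonglongrightarrow> 0"
  using tendsto_real_sqrt[OF inverse_m] by (simp add: real_sqrt_divide)

lemma tail_over_m: "0 < e \<Longrightarrow> (\<lambda>n. A.tail n e / real (m n)) \<longlonglongrightarrow> 0"
  using tendsto_mult[OF tail[of e] inverse_m] by simp

lemma rate_tendsto:
  assumes e: "0 < e"
  shows "(\<lambda>n. A.rate n C c e t) \<longlonglongrightarrow> t\<^sup>2 * sqrt (C / c) * e"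
proof -
  have "(\<lambda>n. sqrt (2 * (1 / real n))) \<longlonglongrightarrow> sqrt (2 * 0)"
    by (intro tendsto_real_sqrt tendsto_mult tendsto_const lim_1_over_n)
  then have s: "(\<lambda>n. sqrt (2 / real n)) \<longlonglongrightarrow> 0" by simp
  define b where "b = (\<lambda>n. t\<^sup>2 * (e * sqrt (C / c) + sqrt (2 / real n)) + \<bar>t\<bar> * ((4 * C + 1) *
      ((2 + e) * C\<^sup>2 / c * (1 / sqrt (real (m n))) + 2 * C / c * (A.tail n e / real (m n)))
      + 2 * C / c * A.tail n e + 1 / real n))"
  have "b \<longlonglongrightarrow> t\<^sup>2 * (e * sqrt (C / c) + 0)
      + \<bar>t\<bar> * ((4 * C + 1) * ((2 + e) * C\<^sup>2 / c * 0 + 2 * C / c * 0) + 2 * C / c * 0 + 0)"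
    unfolding b_def
    by (intro tendsto_add tendsto_mult tendsto_const s inverse_sqrt_m tail_over_m tail e lim_1_over_n)
  then have "b \<longlonglongrightarrow> t\<^sup>2 * sqrt (C / c) * e" by (simp add: mult_ac)
  \<comment> \<open>Outside its context \<open>rate_def\<close> carries the assumptions of that
    context, which hold only from some n on.\<close>
  moreover have "\<forall>\<^sub>F n in sequentially. b n = A.rate n C c e t"
    using eventually_ctx
  proof eventually_elim
    case (elim n)
    then show ?case
      using A.rate_def[of n C c e t] C c e by (simp add: b_def del: One_nat_def)
  qed
  ultimately show ?thesis by (rule Lim_transform_eventually)
qed

lemma qf_char_tendsto:
  "(\<lambda>n. \<integral>\<omega>. iexp (t * A.qf n {1..n} (zeta \<omega>)) \<partial>M) \<longlonglongrightarrow> of_real (exp (- (t\<^sup>2) / 2))"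
proof -
  let ?p = "\<lambda>n. cmod ((\<integral>\<omega>. iexp (t * A.qf n {1..n} (zeta \<omega>)) \<partial>M) - of_real (exp (- (t\<^sup>2) / 2)))"
  have "?p \<longlonglongrightarrow> 0"
  proof (rule tendsto_zero_of_bounds)
    fix e :: real assume e: "0 < e"
    show "\<forall>\<^sub>F n in sequentially. ?p n \<le> \<bar>t\<bar> * A.rate n C c e t"
      using eventually_ctx
    proof eventually_elim
      case (elim n)
      then show ?case
        using e by (intro A.char_qf_bound[of n C c e t] C c) auto
    qed
    have "(\<lambda>n. \<bar>t\<bar> * A.rate n C c e t) \<longlonglongrightarrow> \<bar>t\<bar> * (t\<^sup>2 * sqrt (C / c) * e)"
      by (intro tendsto_mult tendsto_const rate_tendsto e)
    then show "(\<lambda>n. \<bar>t\<bar> * A.rate n C c e t) \<longlonglongrightarrow> \<bar>t\<bar> * t\<^sup>2 * sqrt (C / c) * e"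
      by (simp add: mult_ac)
  qed (use C c in auto)
  then show ?thesis
    using Lim_null tendsto_norm_zero_iff by blast
qed

theorem qf_cdf_tendsto:
  "(\<lambda>n. measure M {\<omega> \<in> space M. A.qf n {1..n} (zeta \<omega>) \<le> t}) \<longlonglongrightarrow> cdf std_normal_distribution t"
proof -
  let ?Y = "\<lambda>n \<omega>. A.qf n {1..n} (zeta \<omega>)"
  define \<mu> where "\<mu> = (\<lambda>n. distr M borel (?Y n))"
  have Y: "?Y n \<in> borel_measurable M" for n by (rule A.qf_measurable[OF order_refl])
  have r: "real_distribution (\<mu> n)" for n unfolding \<mu>_def by (rule A.real_distribution_distr[OF Y])
  have "weak_conv_m \<mu> std_normal_distribution"
  proof (rule levy_continuity[OF r real_dist_normal_dist])
    fix t
    have "char (\<mu> n) t = (\<integral>\<omega>. iexp (t * ?Y n \<omega>) \<partial>M)" for n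
      unfolding char_def \<mu>_def by (rule integral_distr[OF Y]) simp
    then show "(\<lambda>n. char (\<mu> n) t) \<longlonglongrightarrow> char std_normal_distribution t"
      using qf_char_tendsto[of t] by (simp add: char_std_normal_distribution)
  qed
  then have "(\<lambda>n. cdf (\<mu> n) t) \<longlonglongrightarrow> cdf std_normal_distribution t"
    using isCont_cdf_std_normal[of t] by (simp add: weak_conv_m_def weak_conv_def)
  moreover have "cdf (\<mu> n) t = measure M {\<omega> \<in> space M. ?Y n \<omega> \<le> t}" for n
    unfolding cdf_def \<mu>_def by (subst measure_distr[OF Y]) (auto intro!: arg_cong[where f = "measure M"])
  ultimately show ?thesis by simp
qed

text \<open>Here the precision is n sqrt m, at which the full concentration bound would leave a
  constant 2 C^2. The diagonal alone contributes e C^2 and a tail, so the limit in n followed by e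
  tending to 0 does give 0.\<close>

lemma diagonal_negligible:
  assumes \<eta>: "0 < \<eta>"
  shows "(\<lambda>n. measure M {\<omega> \<in> space M. \<eta> * (real n * sqrt (real (m n))) <
    \<bar>(\<Sum>j\<in>{1..n}. dot (m n) (X n (Z j \<omega>)) (X n (Z j \<omega>))) - real n * A.trV n\<bar>}) \<longlonglongrightarrow> 0"
proof (rule tendsto_zero_of_bounds)
  fix e :: real assume e: "0 < e"
  let ?b = "\<lambda>n. (C\<^sup>2 * e + 2 * C * A.tail n e * (1 / sqrt (real (m n)))) / \<eta>"
  show "\<forall>\<^sub>F n in sequentially. measure M {\<omega> \<in> space M. \<eta> * (real n * sqrt (real (m n))) <
    \<bar>(\<Sum>j\<in>{1..n}. dot (m n) (X n (Z j \<omega>)) (X n (Z j \<omega>))) - real n * A.trV n\<bar>} \<le> ?b n"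
    using eventually_ctx
  proof eventually_elim
    case (elim n)
    let ?f = "\<lambda>\<omega>. (\<Sum>j\<in>{1..n}. dot (m n) (X n (Z j \<omega>)) (X n (Z j \<omega>))) - real n * A.trV n"
    have n: "0 < real n" "0 < sqrt (real (m n))" using elim by auto
    have 1: "0 \<le> dot (m n) u (mv (m n) unitv u)" "dot (m n) u (mv (m n) unitv u) \<le> C * dot (m n) u u" for u
      using mult_right_mono[OF C, of "dot (m n) u u"] by (auto simp: dot_mv_unitv)
    have V: "\<And>u. dot (m n) u (mv (m n) (A.V n) u) \<le> C * dot (m n) u u" using elim by blast
    have b: "(\<integral>\<omega>. \<bar>?f \<omega>\<bar> \<partial>M) \<le> real n * (e * C\<^sup>2 * sqrt (real (m n)) + 2 * C * A.tail n e)"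
      using A.diagonal_deviation[OF C less_imp_le[OF e] 1 V order_refl]
      by (simp add: dot_mv_unitv A.trV_eq)
    have i: "integrable M ?f"
    proof (rule Bochner_Integration.integrable_diff)
      show "integrable M (\<lambda>\<omega>. \<Sum>j\<in>{1..n}. dot (m n) (X n (Z j \<omega>)) (X n (Z j \<omega>)))"
        by (rule Bochner_Integration.integrable_sum) (rule A.coord_integrable[OF _ A.dot_X_X_integrable])
    qed simp
    have "measure M {\<omega> \<in> space M. \<eta> * (real n * sqrt (real (m n))) < \<bar>?f \<omega>\<bar>}
      \<le> real n * (e * C\<^sup>2 * sqrt (real (m n)) + 2 * C * A.tail n e) / (\<eta> * (real n * sqrt (real (m n))))"
      using n \<eta> by (intro A.prob_gt_le_expectation i b mult_pos_pos)
    also have "\<dots> = ?b n" using n \<eta> by (simp add: field_simps)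
    finally show ?case .
  qed
  have "?b \<longlonglongrightarrow> (C\<^sup>2 * e + 2 * C * 0 * 0) / \<eta>"
    using \<eta> by (intro tendsto_divide tendsto_add tendsto_mult tendsto_const tail e inverse_sqrt_m) auto
  then show "?b \<longlonglongrightarrow> (C\<^sup>2 / \<eta>) * e" by simp
qed (use \<eta> in auto)

text \<open>At precision n m the whole concentration bound is already negligible, so the fixed
  truncation parameter 1 suffices. As the mean is at most C n m, exceeding 2 C n m is a deviation of
  at least C n m.\<close>

lemma large_sum_negligible:
  "(\<lambda>n. measure M {\<omega> \<in> space M. 2 * C * (real n * real (m n)) <
    dot (m n) (A.S n {1..n} (zeta \<omega>)) (A.S n {1..n} (zeta \<omega>))}) \<longlonglongrightarrow> 0"
proof (rule tendsto_sandwich[OF _ _ tendsto_const])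
  let ?b = "\<lambda>n. (3 * C\<^sup>2 * (1 / sqrt (real (m n))) + 2 * C * (A.tail n 1 / real (m n))) / C"
  show "\<forall>\<^sub>F n in sequentially. measure M {\<omega> \<in> space M. 2 * C * (real n * real (m n)) <
    dot (m n) (A.S n {1..n} (zeta \<omega>)) (A.S n {1..n} (zeta \<omega>))} \<le> ?b n"
    using eventually_ctx
  proof eventually_elim
    case (elim n)
    let ?s = "\<lambda>\<omega>. dot (m n) (A.S n {1..n} (zeta \<omega>)) (A.S n {1..n} (zeta \<omega>))"
    let ?f = "\<lambda>\<omega>. ?s \<omega> - real n * A.trV n"
    have n: "0 < real n" "0 < real (m n)" using elim by auto
    have V: "\<And>u. dot (m n) u (mv (m n) (A.V n) u) \<le> C * dot (m n) u u" using elim by blast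
    have b: "(\<integral>\<omega>. \<bar>?f \<omega>\<bar> \<partial>M) \<le> A.conc_bound n C 1"
      using A.conc_id[of n C c 1 "{1..n}"] elim C c by simp
    have i: "integrable M ?f" using A.dot_S_integrable[of "{1..n}" n] by auto
    have tr: "real n * A.trV n \<le> C * (real n * real (m n))"
      using A.trV_le[OF V] n by (simp add: mult_ac)
    have [measurable]: "?s \<in> borel_measurable M" using A.dot_S_integrable[of "{1..n}" n] by auto
    have "measure M {\<omega> \<in> space M. 2 * C * (real n * real (m n)) < ?s \<omega>}
      \<le> measure M {\<omega> \<in> space M. C * (real n * real (m n)) < \<bar>?f \<omega>\<bar>}"
    proof (rule A.finite_measure_mono)
      show "{\<omega> \<in> space M. 2 * C * (real n * real (m n)) < ?s \<omega>} \<subseteq> {\<omega> \<in> space M. C * (real n * real (m n)) < \<bar>?f \<omega>\<bar>}"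
        using tr by auto
    qed measurable
    also have "\<dots> \<le> A.conc_bound n C 1 / (C * (real n * real (m n)))"
      using n C by (intro A.prob_gt_le_expectation i b mult_pos_pos) auto
    also have "\<dots> = ?b n"
    proof -
      have "sqrt (real (m n)) / real (m n) = 1 / sqrt (real (m n))" using n by (simp add: field_simps)
      then have "(3 * C\<^sup>2 * (sqrt (real (m n)) / real (m n)) + 2 * C * (A.tail n 1 / real (m n))) / C = ?b n" by simp
      moreover have "A.conc_bound n C 1 / (C * (real n * real (m n)))
        = (3 * C\<^sup>2 * (sqrt (real (m n)) / real (m n)) + 2 * C * (A.tail n 1 / real (m n))) / C"
        using n C by (simp add: A.conc_bound_def add_divide_distrib del: One_nat_def)
      ultimately show ?thesis by simp
    qed
    finally show ?case .
  qed
  have "?b \<longlonglongrightarrow> (3 * C\<^sup>2 * 0 + 2 * C * 0) / C"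
    using C by (intro tendsto_divide tendsto_add tendsto_mult tendsto_const inverse_sqrt_m tail_over_m) auto
  then show "?b \<longlonglongrightarrow> 0" by simp
qed simp

end

text \<open>Slutsky's lemma in terms of events. The sets \<open>E n\<close> will be sublevel sets of
  an extended-real statistic, whose difference from \<open>Y n\<close> may be infinite. Closeness is
  therefore expressed by inclusions that may fail on a set \<open>B n\<close> of vanishing
  probability.\<close>

lemma (in prob_space) slutsky_cdf:
  assumes Y: "\<And>n. Y n \<in> borel_measurable M"
    and lim: "\<And>t::real. (\<lambda>n. prob {\<omega> \<in> space M. Y n \<omega> \<le> t}) \<longlonglongrightarrow> F t" and cont: "isCont F t"
    and E: "\<forall>\<^sub>F n in sequentially. E n \<in> events"
    and close: "\<And>\<epsilon>. 0 < \<epsilon> \<Longrightarrow> \<exists>B. (\<forall>\<^sub>F n in sequentially. B n \<in> events) \<and> (\<lambda>n. prob (B n)) \<longlonglongrightarrow> 0 \<and>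
      (\<forall>\<^sub>F n in sequentially. {\<omega> \<in> space M. Y n \<omega> \<le> t - \<epsilon>} \<subseteq> E n \<union> B n \<and>
        E n \<subseteq> {\<omega> \<in> space M. Y n \<omega> \<le> t + \<epsilon>} \<union> B n)"
  shows "(\<lambda>n. prob (E n)) \<longlonglongrightarrow> F t"
proof (rule tendstoI)
  fix \<eta> :: real assume \<eta>: "0 < \<eta>"
  from cont have "\<exists>\<delta>>0. \<forall>s. dist s t < \<delta> \<longrightarrow> dist (F s) (F t) < \<eta> / 2"
    unfolding continuous_at_eps_delta using \<eta> by (metis half_gt_zero)
  then obtain \<delta> where \<delta>: "0 < \<delta>" "\<And>s. dist s t < \<delta> \<Longrightarrow> dist (F s) (F t) < \<eta> / 2" by blast
  define \<epsilon> where "\<epsilon> = \<delta> / 2"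
  have \<epsilon>: "0 < \<epsilon>" using \<delta> by (simp add: \<epsilon>_def)
  have F: "F t - \<eta> / 2 < F (t - \<epsilon>)" "F (t + \<epsilon>) < F t + \<eta> / 2"
  proof -
    have "dist (F (t - \<epsilon>)) (F t) < \<eta> / 2" "dist (F (t + \<epsilon>)) (F t) < \<eta> / 2"
      by (rule \<delta>(2), use \<delta>(1) in \<open>simp add: dist_real_def \<epsilon>_def\<close>)+
    then show "F t - \<eta> / 2 < F (t - \<epsilon>)" "F (t + \<epsilon>) < F t + \<eta> / 2"
      unfolding dist_real_def by linarith+
  qed
  obtain B where B: "\<forall>\<^sub>F n in sequentially. B n \<in> events" "(\<lambda>n. prob (B n)) \<longlonglongrightarrow> 0"
    "\<forall>\<^sub>F n in sequentially. {\<omega> \<in> space M. Y n \<omega> \<le> t - \<epsilon>} \<subseteq> E n \<union> B n \<and>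
        E n \<subseteq> {\<omega> \<in> space M. Y n \<omega> \<le> t + \<epsilon>} \<union> B n"
    using close[OF \<epsilon>] by blast
  have "\<forall>\<^sub>F n in sequentially. F t - \<eta> / 2 < prob {\<omega> \<in> space M. Y n \<omega> \<le> t - \<epsilon>}"
    using F(1) by (rule order_tendstoD(1)[OF lim])
  moreover have "\<forall>\<^sub>F n in sequentially. prob {\<omega> \<in> space M. Y n \<omega> \<le> t + \<epsilon>} < F t + \<eta> / 2"
    using F(2) by (rule order_tendstoD(2)[OF lim])
  moreover have "\<forall>\<^sub>F n in sequentially. prob (B n) < \<eta> / 2"
    using \<eta> by (intro order_tendstoD(2)[OF B(2)]) auto
  ultimately show "\<forall>\<^sub>F n in sequentially. dist (prob (E n)) (F t) < \<eta>"
    using B(1,3) E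
  proof eventually_elim
    case (elim n)
    have ev: "{\<omega> \<in> space M. Y n \<omega> \<le> s} \<in> events" for s using Y[of n] by measurable
    have "prob {\<omega> \<in> space M. Y n \<omega> \<le> t - \<epsilon>} \<le> prob (E n \<union> B n)"
      using elim by (intro finite_measure_mono) auto
    also have "\<dots> \<le> prob (E n) + prob (B n)" using elim by (intro measure_Un_le)
    finally have 1: "prob {\<omega> \<in> space M. Y n \<omega> \<le> t - \<epsilon>} \<le> prob (E n) + prob (B n)" .
    have "prob (E n) \<le> prob ({\<omega> \<in> space M. Y n \<omega> \<le> t + \<epsilon>} \<union> B n)"
      using elim ev by (intro finite_measure_mono) auto
    also have "\<dots> \<le> prob {\<omega> \<in> space M. Y n \<omega> \<le> t + \<epsilon>} + prob (B n)"
      using elim ev by (intro measure_Un_le)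
    finally have 2: "prob (E n) \<le> prob {\<omega> \<in> space M. Y n \<omega> \<le> t + \<epsilon>} + prob (B n)" .
    show ?case using 1 2 elim by (simp add: dist_real_def abs_less_iff)
  qed
qed

section \<open>Empirical likelihood\<close>

definition log_lik :: "nat \<Rightarrow> nat \<Rightarrow> (nat \<Rightarrow> nat \<Rightarrow> real) \<Rightarrow> (nat \<Rightarrow> real) \<Rightarrow> real" where
  "log_lik d n X z = (\<Sum>j\<in>{1..n}. ln (1 + dot d z (X j)))"

definition el_feasible :: "nat \<Rightarrow> nat \<Rightarrow> (nat \<Rightarrow> nat \<Rightarrow> real) \<Rightarrow> (nat \<Rightarrow> real) \<Rightarrow> bool" where
  "el_feasible d n X p \<longleftrightarrow> p \<in> prob_weights n \<and> (\<forall>i<d. (\<Sum>j\<in>{1..n}. p j * X j i) = 0)"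

lemma emp_lik_eq:
  assumes "1 \<le> n" and "\<And>j. 1 \<le> j \<Longrightarrow> j \<le> n \<Longrightarrow> x j \<in> carrier_vec d"
  shows "emp_lik d n x = Sup (insert 0 {\<Prod>j\<in>{1..n}. real n * p j | p. el_feasible d n (\<lambda>j i. x j $ i) p})"
proof -
  have "mean_vec d n (\<lambda>j. p j \<cdot>\<^sub>v x j) = 0\<^sub>v d \<longleftrightarrow> (\<forall>i<d. (\<Sum>j\<in>{1..n}. p j * x j $ i) = 0)" for p
  proof -
    have "(\<Sum>j\<in>{1..n}. (p j \<cdot>\<^sub>v x j) $ i) = (\<Sum>j\<in>{1..n}. p j * x j $ i)" if "i < d" for i
    proof (intro sum.cong refl)
      fix j assume "j \<in> {1..n}"
      then have "dim_vec (x j) = d" using assms(2)[of j] by auto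
      then show "(p j \<cdot>\<^sub>v x j) $ i = p j * x j $ i" using that by simp
    qed
    then show ?thesis
      using assms(1) by (auto simp: mean_vec_def vec_eq_iff)
  qed
  then show ?thesis
    by (simp add: emp_lik_def el_feasible_def)
qed

text \<open>Weak duality: by the constraints the numbers n p_j (1 + z . x_j) sum to n, and y <= exp
  (y - 1) then bounds their product by 1.\<close>

lemma feasible_prod_le:
  assumes "el_feasible d n X p" and pos: "\<And>j. j \<in> {1..n} \<Longrightarrow> 0 < 1 + dot d z (X j)" and n: "1 \<le> n"
  shows "(\<Prod>j\<in>{1..n}. real n * p j) \<le> exp (- log_lik d n X z)"
proof -
  let ?y = "\<lambda>j. 1 + dot d z (X j)"
  have p: "\<And>j. j \<in> {1..n} \<Longrightarrow> 0 \<le> p j" "(\<Sum>j\<in>{1..n}. p j) = 1"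
    and c: "\<And>i. i < d \<Longrightarrow> (\<Sum>j\<in>{1..n}. p j * X j i) = 0"
    using assms(1) by (auto simp: el_feasible_def prob_weights_def PiE_iff)
  have "(\<Sum>j\<in>{1..n}. p j * dot d z (X j)) = (\<Sum>i<d. z i * (\<Sum>j\<in>{1..n}. p j * X j i))"
    unfolding dot_def sum_distrib_left by (subst sum.swap) (simp add: algebra_simps)
  then have zero: "(\<Sum>j\<in>{1..n}. p j * dot d z (X j)) = 0"
    using c by simp
  have "(\<Prod>j\<in>{1..n}. real n * p j) * (\<Prod>j\<in>{1..n}. ?y j) = (\<Prod>j\<in>{1..n}. real n * p j * ?y j)"
    by (simp add: prod.distrib)
  also have "\<dots> \<le> (\<Prod>j\<in>{1..n}. exp (real n * p j * ?y j - 1))"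
    using p pos by (intro prod_mono conjI mult_nonneg_nonneg)
      (auto simp: less_imp_le intro: order_trans[OF _ exp_ge_add_one_self])
  also have "\<dots> = exp (\<Sum>j\<in>{1..n}. real n * p j * ?y j - 1)"
    by (simp add: exp_sum)
  also have "(\<Sum>j\<in>{1..n}. real n * p j * ?y j - 1) = real n * (\<Sum>j\<in>{1..n}. p j)
      + real n * (\<Sum>j\<in>{1..n}. p j * dot d z (X j)) - real n"
    by (simp add: algebra_simps sum.distrib sum_subtractf sum_distrib_left)
  finally have "(\<Prod>j\<in>{1..n}. real n * p j) * (\<Prod>j\<in>{1..n}. ?y j) \<le> 1"
    using p zero by simp
  moreover have "(\<Prod>j\<in>{1..n}. ?y j) = exp (log_lik d n X z)"
    unfolding log_lik_def by (subst exp_sum) (use pos in auto)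
  ultimately show ?thesis
    by (simp add: exp_minus divide_simps)
qed

text \<open>Weak duality at z = 0, where \<open>log_lik\<close> vanishes, bounds every product by
  1.\<close>

lemma feasible_bdd_above:
  assumes "1 \<le> n"
  shows "bdd_above (insert 0 {\<Prod>j\<in>{1..n}. real n * p j | p. el_feasible d n X p})"
  unfolding bdd_above_def using feasible_prod_le[of d n X _ "\<lambda>_. 0"] assms
  by (intro exI[of _ "exp (- log_lik d n X (\<lambda>_. 0))"]) (auto simp: dot_def)

lemma emp_lik_upper:
  assumes "1 \<le> n" and "\<And>j. 1 \<le> j \<Longrightarrow> j \<le> n \<Longrightarrow> x j \<in> carrier_vec d"
    and "\<And>j. j \<in> {1..n} \<Longrightarrow> 0 < 1 + dot d z (($) (x j))"
  shows "emp_lik d n x \<le> exp (- log_lik d n (\<lambda>j i. x j $ i) z)"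
proof -
  have "emp_lik d n x = Sup (insert 0 {\<Prod>j\<in>{1..n}. real n * p j | p. el_feasible d n (\<lambda>j i. x j $ i) p})"
    by (rule emp_lik_eq) (use assms in auto)
  also have "\<dots> \<le> exp (- log_lik d n (\<lambda>j i. x j $ i) z)"
    using feasible_prod_le[of d n "\<lambda>j i. x j $ i" _ z] assms(1,3) by (intro cSup_least) auto
  finally show ?thesis .
qed

text \<open>At a critical point z the weights 1 / (n (1 + z . x_j)) are feasible. The critical
  equation is the mean constraint, and contracting it with z shows that the weights sum to
  1.\<close>

lemma emp_lik_lower:
  assumes n: "1 \<le> n" and "\<And>j. 1 \<le> j \<Longrightarrow> j \<le> n \<Longrightarrow> x j \<in> carrier_vec d"
    and pos: "\<And>j. j \<in> {1..n} \<Longrightarrow> 0 < 1 + dot d z (($) (x j))"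
    and crit: "\<And>i. i < d \<Longrightarrow> (\<Sum>j\<in>{1..n}. x j $ i / (1 + dot d z (($) (x j)))) = 0"
  shows "exp (- log_lik d n (\<lambda>j i. x j $ i) z) \<le> emp_lik d n x"
proof -
  let ?y = "\<lambda>j. 1 + dot d z (($) (x j))"
  define p where "p = (\<lambda>j\<in>{1..n}. 1 / (real n * ?y j))"
  have "(\<Sum>j\<in>{1..n}. dot d z (($) (x j)) / ?y j) = (\<Sum>i<d. z i * (\<Sum>j\<in>{1..n}. x j $ i / ?y j))"
    unfolding dot_def sum_distrib_left sum_divide_distrib by (subst sum.swap) simp
  then have zero: "(\<Sum>j\<in>{1..n}. dot d z (($) (x j)) / ?y j) = 0"
    using crit by simp
  have "(\<Sum>j\<in>{1..n}. 1 / ?y j) = (\<Sum>j\<in>{1..n}. 1 - dot d z (($) (x j)) / ?y j)"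
  proof (intro sum.cong refl)
    fix j assume "j \<in> {1..n}"
    from pos[OF this] show "1 / ?y j = 1 - dot d z (($) (x j)) / ?y j"
      by (simp add: field_simps)
  qed
  then have "(\<Sum>j\<in>{1..n}. 1 / ?y j) = real n"
    using zero by (simp add: sum_subtractf)
  then have sum1: "(\<Sum>j\<in>{1..n}. p j) = 1"
  proof -
    have "(\<Sum>j\<in>{1..n}. p j) = (\<Sum>j\<in>{1..n}. 1 / ?y j / real n)"
      by (intro sum.cong) (auto simp: p_def)
    also have "\<dots> = (\<Sum>j\<in>{1..n}. 1 / ?y j) / real n"
      by (rule sum_divide_distrib[symmetric])
    finally show ?thesis
      using \<open>(\<Sum>j\<in>{1..n}. 1 / ?y j) = real n\<close> n by simp
  qed
  have p0: "0 \<le> p j" if "j \<in> {1..n}" for j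
    using pos[OF that] that by (simp add: p_def)
  have p1: "p j \<le> 1" if "j \<in> {1..n}" for j
    using member_le_sum[of j "{1..n}" p] p0 that sum1 by auto
  have c: "(\<Sum>j\<in>{1..n}. p j * x j $ i) = 0" if "i < d" for i
  proof -
    have "(\<Sum>j\<in>{1..n}. p j * x j $ i) = (\<Sum>j\<in>{1..n}. x j $ i / ?y j / real n)"
      by (intro sum.cong refl) (simp add: p_def)
    also have "\<dots> = (\<Sum>j\<in>{1..n}. x j $ i / ?y j) / real n"
      by (rule sum_divide_distrib[symmetric])
    finally show ?thesis
      using crit[OF that] by simp
  qed
  have f: "el_feasible d n (\<lambda>j i. x j $ i) p"
    unfolding el_feasible_def prob_weights_def using p0 p1 sum1 c by (auto simp: p_def)
  have "exp (- log_lik d n (\<lambda>j i. x j $ i) z) = (\<Prod>j\<in>{1..n}. exp (- ln (?y j)))"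
    by (simp add: log_lik_def exp_sum flip: sum_negf)
  also have "\<dots> = (\<Prod>j\<in>{1..n}. real n * p j)"
    using n pos by (intro prod.cong refl) (simp add: p_def exp_minus inverse_eq_divide)
  also have "\<dots> \<le> Sup (insert 0 {\<Prod>j\<in>{1..n}. real n * p j | p. el_feasible d n (\<lambda>j i. x j $ i) p})"
    by (intro cSup_upper feasible_bdd_above n) (use f in auto)
  also have "\<dots> = emp_lik d n x"
    by (rule emp_lik_eq[symmetric]) (use assms in auto)
  finally show ?thesis .
qed

text \<open>Fixing the coordinates from d on at 0 places the ball inside a product of compact
  intervals, which is compact by Tychonoff. The remaining conditions are closed because coordinates
  are continuous.\<close>

lemma compact_coord_ball:
  "compact {z. (\<forall>i\<ge>d. z i = 0) \<and> dot d z z \<le> r\<^sup>2}"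
proof -
  have "compactin (product_topology (\<lambda>_. euclidean) UNIV) (PiE UNIV (\<lambda>_::nat. {-\<bar>r\<bar>..\<bar>r\<bar>}))"
    unfolding compactin_PiE by simp
  then have c: "compact (PiE UNIV (\<lambda>_::nat. {-\<bar>r\<bar>..\<bar>r\<bar>}))"
    by (simp add: euclidean_product_topology)
  have cont: "continuous_on UNIV (\<lambda>z::nat \<Rightarrow> real. z i)" for i
    by (rule continuous_on_product_coordinates)
  have "closed {z::nat \<Rightarrow> real. dot d z z \<le> r\<^sup>2}"
    unfolding dot_def by (intro closed_Collect_le continuous_intros cont)
  moreover have "closed {z::nat \<Rightarrow> real. \<forall>i\<ge>d. z i = 0}"
    by (intro closed_Collect_all closed_Collect_imp closed_Collect_eq continuous_intros cont) auto
  ultimately have "closed ({z::nat \<Rightarrow> real. \<forall>i\<ge>d. z i = 0} \<inter> {z. dot d z z \<le> r\<^sup>2})"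
    by (rule closed_Int[rotated])
  then have cl: "closed {z::nat \<Rightarrow> real. (\<forall>i\<ge>d. z i = 0) \<and> dot d z z \<le> r\<^sup>2}"
    by (simp add: Collect_conj_eq)
  have "{z. (\<forall>i\<ge>d. z i = 0) \<and> dot d z z \<le> r\<^sup>2} \<subseteq> PiE UNIV (\<lambda>_. {-\<bar>r\<bar>..\<bar>r\<bar>})"
  proof (clarsimp simp: PiE_iff)
    fix z :: "nat \<Rightarrow> real" and i
    assume z: "\<forall>i\<ge>d. z i = 0" "dot d z z \<le> r\<^sup>2"
    have "nrm d z \<le> \<bar>r\<bar>"
      using z(2) unfolding nrm_def by (metis real_sqrt_abs real_sqrt_le_mono)
    then have "\<bar>z i\<bar> \<le> \<bar>r\<bar>"
      using abs_coord_le_nrm[of i d z] z(1) by (cases "i < d") auto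
    then show "- \<bar>r\<bar> \<le> z i \<and> z i \<le> \<bar>r\<bar>" by auto
  qed
  then show ?thesis
    using compact_Int_closed[OF c cl] by (simp add: Int_absorb1)
qed

text \<open>The function is 0 at the origin and negative on the sphere, so its maximum over the ball
  lies in the interior and all partial derivatives vanish there. The smallness condition keeps the
  arguments of the logarithm away from 0.\<close>

lemma log_lik_critical_point:
  assumes r: "0 < r" and small: "\<And>j. j \<in> {1..n} \<Longrightarrow> nrm d (X j) * r \<le> 1 / 4"
    and bd: "\<And>z. nrm d z = r \<Longrightarrow> log_lik d n X z < 0"
  shows "\<exists>z. nrm d z < r \<and> (\<forall>i<d. (\<Sum>j\<in>{1..n}. X j i / (1 + dot d z (X j))) = 0)"
proof -
  let ?K = "{z. (\<forall>i\<ge>d. z i = 0) \<and> dot d z z \<le> r\<^sup>2}"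
  have Kn: "nrm d z \<le> r" if "z \<in> ?K" for z
    using that r unfolding nrm_def by (metis (mono_tags, lifting) mem_Collect_eq real_sqrt_le_mono real_sqrt_abs abs_of_pos)
  have y: "\<bar>dot d z (X j)\<bar> \<le> 1 / 4" if "nrm d z \<le> r" "j \<in> {1..n}" for z j
  proof -
    have "\<bar>dot d z (X j)\<bar> \<le> nrm d z * nrm d (X j)" by (rule dot_le_nrm)
    also have "\<dots> \<le> nrm d (X j) * r"
      using that by (subst mult.commute, intro mult_left_mono) auto
    finally show ?thesis using small[OF that(2)] by linarith
  qed
  have cont: "continuous_on A (\<lambda>z::nat \<Rightarrow> real. z i)" for A i
    by (rule continuous_on_subset[OF continuous_on_product_coordinates]) auto
  have "\<exists>z\<in>?K. \<forall>u\<in>?K. log_lik d n X u \<le> log_lik d n X z"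
  proof (rule continuous_attains_sup[OF compact_coord_ball])
    show "?K \<noteq> {}" by (auto intro!: exI[of _ "\<lambda>_. 0"] simp: dot_def)
    show "continuous_on ?K (log_lik d n X)"
      unfolding log_lik_def[abs_def]
    proof (intro continuous_on_sum continuous_on_ln)
      fix j show "continuous_on ?K (\<lambda>z. 1 + dot d z (X j))"
        unfolding dot_def by (intro continuous_intros cont)
    next
      fix j assume "j \<in> {1..n}"
      show "\<forall>z\<in>?K. 1 + dot d z (X j) \<noteq> 0"
      proof
        fix z assume "z \<in> ?K"
        from y[OF Kn[OF this] \<open>j \<in> {1..n}\<close>] show "1 + dot d z (X j) \<noteq> 0" by linarith
      qed
    qed
  qed
  then obtain z where z: "z \<in> ?K" "\<And>u. u \<in> ?K \<Longrightarrow> log_lik d n X u \<le> log_lik d n X z" by blast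
  have "log_lik d n X (\<lambda>_. 0) \<le> log_lik d n X z"
    by (rule z(2)) (auto simp: dot_def)
  then have "0 \<le> log_lik d n X z" by (simp add: log_lik_def dot_def)
  then have zr: "nrm d z < r" using Kn[OF z(1)] bd[of z] by fastforce
  have "(\<Sum>j\<in>{1..n}. X j i / (1 + dot d z (X j))) = 0" if i: "i < d" for i
  proof -
    define u where "u = (\<lambda>t::real. z(i := z i + t))"
    have du: "dot d (u t) q = dot d z q + t * q i" for t q
    proof -
      have "dot d (u t) q = (\<Sum>k<d. z k * q k + (if k = i then t * q i else 0))"
        unfolding dot_def u_def by (intro sum.cong) (auto simp: algebra_simps)
      then show ?thesis using i by (simp add: sum.distrib dot_def)
    qed
    have nu: "nrm d (u t) \<le> nrm d z + \<bar>t\<bar>" for t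
    proof -
      let ?e = "\<lambda>k. if k = i then t else 0"
      have "dot d ?e ?e = (\<Sum>k<d. if k = i then t\<^sup>2 else 0)"
        unfolding dot_def by (intro sum.cong) (auto simp: power2_eq_square)
      then have "nrm d ?e = \<bar>t\<bar>" using i by (simp add: nrm_def)
      moreover have "u t = (\<lambda>k. z k + ?e k)" by (auto simp: u_def)
      ultimately show ?thesis using nrm_triangle[of d z ?e] by simp
    qed
    have "((\<lambda>t. log_lik d n X (u t)) has_real_derivative (\<Sum>j\<in>{1..n}. X j i / (1 + dot d z (X j)))) (at 0)"
      unfolding log_lik_def du
    proof (intro DERIV_sum)
      fix j assume "j \<in> {1..n}"
      then have "1 + dot d z (X j) > 0" using y[OF Kn[OF z(1)], of j] by linarith
      then show "((\<lambda>t. ln (1 + (dot d z (X j) + t * X j i))) has_real_derivative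
          X j i / (1 + dot d z (X j))) (at 0)"
        by (auto intro!: derivative_eq_intros)
    qed
    moreover have "\<forall>t. \<bar>0 - t\<bar> < r - nrm d z \<longrightarrow> log_lik d n X (u t) \<le> log_lik d n X (u 0)"
    proof (intro allI impI)
      fix t assume t: "\<bar>0 - t\<bar> < r - nrm d z"
      have "nrm d (u t) \<le> r" using nu[of t] t by simp
      then have "(nrm d (u t))\<^sup>2 \<le> r\<^sup>2" by (simp add: power_mono)
      then have "u t \<in> ?K" using z(1) i by (auto simp: nrm_power2 u_def)
      moreover have "u 0 = z" by (simp add: u_def)
      ultimately show "log_lik d n X (u t) \<le> log_lik d n X (u 0)" using z(2) by simp
    qed
    ultimately show ?thesis
      using DERIV_local_max[of _ _ 0 "r - nrm d z"] zr by simp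
  qed
  then show ?thesis using zr by blast
qed

text \<open>The difference has derivative x^2 / (1 + x), at most 2 y^2 between -|y| and |y| since 1
  + x >= 1/2 there.\<close>

lemma ln_one_plus_cubic:
  fixes y :: real
  assumes "\<bar>y\<bar> \<le> 1 / 2"
  shows "\<bar>ln (1 + y) - (y - y\<^sup>2 / 2)\<bar> \<le> 2 * \<bar>y\<bar> ^ 3"
proof (cases "y = 0")
  case False
  let ?f = "\<lambda>x::real. ln (1 + x) - (x - x\<^sup>2 / 2)"
  have D: "(?f has_real_derivative x\<^sup>2 / (1 + x)) (at x)" if "\<bar>x\<bar> \<le> 1 / 2" for x
  proof -
    have "1 + x > 0" using that by linarith
    then show ?thesis
      by (auto intro!: derivative_eq_intros simp: field_simps power2_eq_square)
  qed
  have "norm (?f y - ?f 0) \<le> (2 * y\<^sup>2) * norm (y - 0)"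
  proof (rule field_differentiable_bound[where S = "{-\<bar>y\<bar>..\<bar>y\<bar>}" and f' = "\<lambda>x. x\<^sup>2 / (1 + x)"])
    fix x assume x: "x \<in> {-\<bar>y\<bar>..\<bar>y\<bar>}"
    then have "\<bar>x\<bar> \<le> 1 / 2" using assms by auto
    then show "(?f has_field_derivative x\<^sup>2 / (1 + x)) (at x within {-\<bar>y\<bar>..\<bar>y\<bar>})"
      by (rule has_field_derivative_at_within[OF D])
    have "x\<^sup>2 \<le> y\<^sup>2" using x by (intro abs_le_square_iff[THEN iffD1]) auto
    moreover have "1 / 2 \<le> 1 + x" using \<open>\<bar>x\<bar> \<le> 1 / 2\<close> by linarith
    ultimately have "x\<^sup>2 / (1 + x) \<le> y\<^sup>2 / (1 / 2)"
      by (intro frac_le) auto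
    then show "norm (x\<^sup>2 / (1 + x)) \<le> 2 * y\<^sup>2"
      using \<open>1 / 2 \<le> 1 + x\<close> by simp
  qed auto
  then show ?thesis
    by (simp add: power3_eq_cube power2_eq_square abs_mult)
qed auto

text \<open>Deterministic core of the likelihood expansion. On a ball of radius of order sqrt (d /
  n) the dual function is uniformly close to n (u . xbar - u . W u / 2), whose maximum n (xbar . xi)
  / 2 is attained at the solution xi of W xi = xbar. The dual bound at xi and the primal weights at
  the true critical point enclose the likelihood.\<close>

lemma emp_lik_quadratic_approx:
  fixes n d :: nat and x :: "nat \<Rightarrow> real vec" and W :: "nat \<Rightarrow> nat \<Rightarrow> real" and \<xi> :: "nat \<Rightarrow> real"
  defines "xbar \<equiv> \<lambda>i. (\<Sum>j\<in>{1..n}. x j $ i) / real n"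
  assumes n: "1 \<le> n" and d: "1 \<le> d" and dim: "\<And>j. 1 \<le> j \<Longrightarrow> j \<le> n \<Longrightarrow> x j \<in> carrier_vec d"
    and c: "0 < c0" "0 \<le> c1" and k: "0 < \<kappa>" and \<delta>: "0 \<le> \<delta>" "\<delta> \<le> 1" "\<delta> \<le> c0 / 2" "9 * \<kappa> / c0 * \<delta> \<le> 1 / 8"
    and W_sym: "\<And>u v. dot d u (mv d W v) = dot d v (mv d W u)"
    and W_lower: "\<And>u. c0 * dot d u u \<le> dot d u (mv d W u)"
    and W_upper: "\<And>u. dot d u (mv d W u) \<le> c1 * dot d u u"
    and cov: "\<And>u. \<bar>(\<Sum>j\<in>{1..n}. (dot d u (($) (x j)))\<^sup>2) / real n - dot d u (mv d W u)\<bar>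
      \<le> \<delta> / sqrt (real d) * dot d u u"
    and max: "\<And>j. j \<in> {1..n} \<Longrightarrow> real d * nrm d (($) (x j)) \<le> \<delta> * sqrt (real n)"
    and xbar_bound: "nrm d xbar \<le> \<kappa> * sqrt (real d / real n)"
    and \<xi>: "\<And>i. i < d \<Longrightarrow> mv d W \<xi> i = xbar i"
  shows "0 < emp_lik d n x \<and> \<bar>- 2 * ln (emp_lik d n x) - real n * dot d xbar \<xi>\<bar>
    \<le> \<delta> * sqrt (real d) * ((9 * \<kappa> / c0)\<^sup>2 + 4 * (9 * \<kappa> / c0) ^ 3 * (c1 + 1))"
proof -
  \<comment> \<open>On the sphere of radius r the linear term is at most n r |xbar|, while the
    quadratic term, after absorbing the cubic error, is at least n c0 r^2 / 8. Negativity asks for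
    c0 rho > 8 kappa, and 9 leaves a margin.\<close>
  define \<rho> where "\<rho> = 9 * \<kappa> / c0"
  define r where "r = \<rho> * sqrt (real d / real n)"
  define X where "X = (\<lambda>j i. x j $ i)"
  define q where "q = (\<lambda>u. (\<Sum>j\<in>{1..n}. (dot d u (X j))\<^sup>2) / real n)"
  \<comment> \<open>Uniform error of the quadratic model on the ball: rho^2 / 2 stems from replacing
    the sample covariance by W, the other summand from the cubic term. The conclusion carries twice
    this amount because it concerns -2 ln.\<close>
  define \<eta> where "\<eta> = \<delta> * sqrt (real d) * (\<rho>\<^sup>2 / 2 + 2 * \<rho> ^ 3 * (c1 + 1))"
  have dn: "0 < real d" "0 < real n" using n d by auto
  have \<rho>: "0 < \<rho>" using k c by (simp add: \<rho>_def)
  have r: "0 < r" using \<rho> dn by (simp add: r_def)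
  have sd: "1 \<le> sqrt (real d)" using d by simp
  have nr2: "real n * r\<^sup>2 = \<rho>\<^sup>2 * real d"
    using dn by (simp add: r_def power_mult_distrib)
  have Xr: "nrm d (X j) * r \<le> \<rho> * \<delta> / sqrt (real d)" if "j \<in> {1..n}" for j
  proof -
    have "nrm d (X j) \<le> \<delta> * sqrt (real n) / real d"
      using max[OF that] dn by (simp add: X_def field_simps)
    then have "nrm d (X j) * r \<le> \<delta> * sqrt (real n) / real d * r"
      using r by (intro mult_right_mono) auto
    also have "\<dots> = \<rho> * \<delta> * (sqrt (real d) / real d)"
      using dn by (simp add: r_def real_sqrt_divide)
    also have "sqrt (real d) / real d = 1 / sqrt (real d)"
      using dn by (simp add: field_simps)
    finally show ?thesis by simp
  qed
  have \<rho>\<delta>: "\<rho> * \<delta> / sqrt (real d) \<le> 1 / 8"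
  proof -
    have "\<rho> * \<delta> / sqrt (real d) \<le> \<rho> * \<delta> / 1"
      using sd \<rho> \<delta> by (intro divide_left_mono) auto
    then show ?thesis using \<delta>(4) by (simp add: \<rho>_def)
  qed
  have y: "\<bar>dot d u (X j)\<bar> \<le> \<rho> * \<delta> / sqrt (real d)" if "nrm d u \<le> r" "j \<in> {1..n}" for u j
  proof -
    have "\<bar>dot d u (X j)\<bar> \<le> nrm d u * nrm d (X j)" by (rule dot_le_nrm)
    also have "\<dots> \<le> r * nrm d (X j)"
      using that by (intro mult_right_mono) auto
    finally show ?thesis using Xr[OF that(2)] by (simp add: mult.commute)
  qed
  have q0: "0 \<le> q u" for u by (simp add: q_def sum_nonneg)
  have \<delta>d: "\<delta> / sqrt (real d) \<le> \<delta>"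
  proof -
    have "\<delta> / sqrt (real d) \<le> \<delta> / 1"
      using sd \<delta>(1) by (intro divide_left_mono) auto
    then show ?thesis by simp
  qed
  have qW: "\<bar>q u - dot d u (mv d W u)\<bar> \<le> \<delta> / sqrt (real d) * dot d u u" for u
    using cov[of u] by (simp add: q_def X_def)
  have qW': "\<bar>q u - dot d u (mv d W u)\<bar> \<le> \<delta> * dot d u u" for u
    using qW[of u] mult_right_mono[OF \<delta>d, of "dot d u u"] by simp
  have q_lower: "c0 / 2 * dot d u u \<le> q u" for u
  proof -
    have "\<delta> * dot d u u \<le> c0 / 2 * dot d u u"
      using \<delta>(3) by (intro mult_right_mono) auto
    then show ?thesis using qW'[of u] W_lower[of u] by linarith
  qed
  have q_upper: "q u \<le> (c1 + 1) * dot d u u" for u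
  proof -
    have "\<delta> * dot d u u \<le> 1 * dot d u u"
      using \<delta>(2) by (intro mult_right_mono) auto
    then show ?thesis using qW'[of u] W_upper[of u] by (simp add: algebra_simps)
  qed
  have lin: "(\<Sum>j\<in>{1..n}. dot d u (X j)) = real n * dot d u xbar" for u
  proof -
    have "(\<Sum>j\<in>{1..n}. dot d u (X j)) = dot d u (\<lambda>i. \<Sum>j\<in>{1..n}. X j i)"
      by (simp add: dot_sum_right)
    also have "(\<lambda>i. \<Sum>j\<in>{1..n}. X j i) = (\<lambda>i. real n * xbar i)"
      using dn by (simp add: xbar_def X_def)
    finally show ?thesis by (simp add: dot_scale_right)
  qed
  have taylor: "\<bar>log_lik d n X u - (real n * dot d u xbar - real n * q u / 2)\<bar>
      \<le> 2 * (\<rho> * \<delta> / sqrt (real d)) * (real n * q u)" if u: "nrm d u \<le> r" for u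
  proof -
    have "log_lik d n X u - (real n * dot d u xbar - real n * q u / 2)
        = (\<Sum>j\<in>{1..n}. ln (1 + dot d u (X j)) - (dot d u (X j) - (dot d u (X j))\<^sup>2 / 2))"
      using dn by (simp add: log_lik_def lin q_def sum_subtractf sum_divide_distrib[symmetric] del: One_nat_def)
    also have "\<bar>\<dots>\<bar> \<le> (\<Sum>j\<in>{1..n}. 2 * (\<rho> * \<delta> / sqrt (real d)) * (dot d u (X j))\<^sup>2)"
    proof (intro order_trans[OF sum_abs] sum_mono)
      fix j assume j: "j \<in> {1..n}"
      let ?y = "dot d u (X j)"
      have "\<bar>ln (1 + ?y) - (?y - ?y\<^sup>2 / 2)\<bar> \<le> 2 * \<bar>?y\<bar> ^ 3"
        using y[OF u j] \<rho>\<delta> by (intro ln_one_plus_cubic) linarith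
      also have "\<dots> = 2 * \<bar>?y\<bar> * ?y\<^sup>2"
        by (simp add: power3_eq_cube power2_eq_square)
      also have "\<dots> \<le> 2 * (\<rho> * \<delta> / sqrt (real d)) * ?y\<^sup>2"
        using y[OF u j] by (intro mult_right_mono mult_left_mono) auto
      finally show "\<bar>ln (1 + ?y) - (?y - ?y\<^sup>2 / 2)\<bar> \<le> 2 * (\<rho> * \<delta> / sqrt (real d)) * ?y\<^sup>2" .
    qed
    also have "\<dots> = 2 * (\<rho> * \<delta> / sqrt (real d)) * (real n * q u)"
      unfolding sum_distrib_left[symmetric] using dn by (simp add: q_def)
    finally show ?thesis .
  qed
  have boundary: "log_lik d n X u < 0" if u: "nrm d u = r" for u
  proof -
    have uu: "dot d u u = r\<^sup>2" using u nrm_power2[of d u] by simp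
    \<comment> \<open>The cubic error uses up at most half of the quadratic term n q / 2.\<close>
    have "2 * (\<rho> * \<delta> / sqrt (real d)) * (real n * q u) \<le> 2 * (1 / 8) * (real n * q u)"
      using \<rho>\<delta> q0[of u] by (intro mult_right_mono mult_left_mono) auto
    then have "log_lik d n X u \<le> real n * dot d u xbar - real n * q u / 4"
      using taylor[of u] u by linarith
    also have "\<dots> \<le> real n * (r * nrm d xbar) - real n * (c0 / 2 * r\<^sup>2) / 4"
      using dot_le_nrm[of d u xbar] u q_lower[of u] uu
      by (intro diff_mono mult_left_mono divide_right_mono) auto
    also have "\<dots> = real n * r * (nrm d xbar - c0 * r / 8)"
      by (simp add: algebra_simps power2_eq_square)
    also have "\<dots> < 0"
    proof -
      have "c0 * r / 8 = 9 / 8 * (\<kappa> * sqrt (real d / real n))"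
        using c by (simp add: r_def \<rho>_def)
      moreover have "0 < \<kappa> * sqrt (real d / real n)" using k dn by simp
      ultimately have "nrm d xbar < c0 * r / 8" using xbar_bound by linarith
      then show ?thesis using dn r by (simp add: mult_less_0_iff)
    qed
    finally show ?thesis .
  qed
  have approx: "\<bar>log_lik d n X u - real n * (dot d u xbar - dot d u (mv d W u) / 2)\<bar> \<le> \<eta>"
    if u: "nrm d u \<le> r" for u
  proof -
    have "(nrm d u)\<^sup>2 \<le> r\<^sup>2" using u by (simp add: power_mono)
    then have uu: "dot d u u \<le> r\<^sup>2" by (simp add: nrm_power2)
    have "2 * (\<rho> * \<delta> / sqrt (real d)) * (real n * q u)
        \<le> 2 * (\<rho> * \<delta> / sqrt (real d)) * (real n * ((c1 + 1) * r\<^sup>2))"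
      using c \<rho> \<delta> by (intro mult_left_mono order_trans[OF q_upper[of u]] uu) auto
    also have "\<dots> = 2 * (\<rho> * \<delta> / sqrt (real d)) * (c1 + 1) * (real n * r\<^sup>2)"
      by simp
    also have "\<dots> = \<delta> * (2 * \<rho> ^ 3 * (c1 + 1)) * (real d / sqrt (real d))"
      unfolding nr2 by (simp add: power3_eq_cube power2_eq_square)
    also have "\<dots> = \<delta> * (2 * \<rho> ^ 3 * (c1 + 1)) * sqrt (real d)"
      by (simp add: real_div_sqrt)
    finally have 1: "\<bar>log_lik d n X u - (real n * dot d u xbar - real n * q u / 2)\<bar>
        \<le> \<delta> * (2 * \<rho> ^ 3 * (c1 + 1)) * sqrt (real d)"
      using taylor[OF u] by linarith
    have "real n / 2 * \<bar>q u - dot d u (mv d W u)\<bar> \<le> real n / 2 * (\<delta> / sqrt (real d) * r\<^sup>2)"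
      using \<delta> by (intro mult_left_mono order_trans[OF qW[of u]] uu) auto
    also have "\<dots> = \<delta> / sqrt (real d) / 2 * (real n * r\<^sup>2)" by (simp add: field_simps)
    also have "\<dots> = \<delta> * (\<rho>\<^sup>2 / 2) * (real d / sqrt (real d))"
      unfolding nr2 by simp
    also have "\<dots> = \<delta> * (\<rho>\<^sup>2 / 2) * sqrt (real d)"
      by (simp add: real_div_sqrt)
    finally have 2: "real n / 2 * \<bar>q u - dot d u (mv d W u)\<bar> \<le> \<delta> * (\<rho>\<^sup>2 / 2) * sqrt (real d)" .
    have "\<bar>log_lik d n X u - real n * (dot d u xbar - dot d u (mv d W u) / 2)\<bar>
      \<le> \<bar>log_lik d n X u - (real n * dot d u xbar - real n * q u / 2)\<bar>
        + \<bar>real n / 2 * (q u - dot d u (mv d W u))\<bar>"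
      by (simp add: algebra_simps)
    also have "\<bar>real n / 2 * (q u - dot d u (mv d W u))\<bar> = real n / 2 * \<bar>q u - dot d u (mv d W u)\<bar>"
      using dn by (simp add: abs_mult)
    also have "\<bar>log_lik d n X u - (real n * dot d u xbar - real n * q u / 2)\<bar> + \<dots> \<le> \<eta>"
      using 1 2 by (simp add: \<eta>_def algebra_simps)
    finally show ?thesis .
  qed
  have pos: "0 < 1 + dot d u (X j)" if "nrm d u \<le> r" "j \<in> {1..n}" for u j
    using y[OF that] \<rho>\<delta> by linarith
  have W\<xi>: "dot d u (mv d W \<xi>) = dot d u xbar" for u
    using \<xi> by (intro dot_cong) auto
  have \<xi>r: "nrm d \<xi> \<le> r"
  proof -
    have "c0 * (nrm d \<xi>)\<^sup>2 \<le> dot d \<xi> xbar"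
      using W_lower[of \<xi>] W\<xi>[of \<xi>] by (simp add: nrm_power2)
    also have "\<dots> \<le> nrm d \<xi> * nrm d xbar" using dot_le_nrm[of d \<xi> xbar] by linarith
    also have "\<dots> \<le> nrm d \<xi> * (c0 * r)"
    proof (intro mult_left_mono)
      have "c0 * r = 9 * (\<kappa> * sqrt (real d / real n))"
        using c by (simp add: r_def \<rho>_def)
      moreover have "0 < \<kappa> * sqrt (real d / real n)" using k dn by simp
      ultimately show "nrm d xbar \<le> c0 * r" using xbar_bound by linarith
    qed simp
    finally have "c0 * nrm d \<xi> * nrm d \<xi> \<le> c0 * r * nrm d \<xi>"
      by (simp add: power2_eq_square algebra_simps)
    then have "nrm d \<xi> = 0 \<or> c0 * nrm d \<xi> \<le> c0 * r"
      by (metis mult_le_cancel_right nrm_nonneg order_le_less)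
    then show ?thesis using c r by auto
  qed
  have lower: "dot d \<xi> (mv d W \<xi>) = dot d xbar \<xi>"
    using W\<xi>[of \<xi>] by (simp add: dot_commute)
  \<comment> \<open>The upper bound is taken at the explicit point xi, the lower bound at the
    critical point z. The two points may differ, but the model controls the dual function at
    both.\<close>
  have "emp_lik d n x \<le> exp (- log_lik d n X \<xi>)"
    unfolding X_def by (rule emp_lik_upper[OF n]) (use dim pos[OF \<xi>r] in \<open>auto simp: X_def\<close>)
  moreover have "\<exists>z. nrm d z < r \<and> (\<forall>i<d. (\<Sum>j\<in>{1..n}. X j i / (1 + dot d z (X j))) = 0)"
  proof (rule log_lik_critical_point[OF r _ boundary])
    fix j assume "j \<in> {1..n}"
    from Xr[OF this] show "nrm d (X j) * r \<le> 1 / 4" using \<rho>\<delta> by linarith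
  qed
  then obtain z where z: "nrm d z < r"
    "\<And>i. i < d \<Longrightarrow> (\<Sum>j\<in>{1..n}. X j i / (1 + dot d z (X j))) = 0" by blast
  have el_low: "exp (- log_lik d n X z) \<le> emp_lik d n x"
    unfolding X_def
    by (rule emp_lik_lower[OF n]) (use dim pos[of z] z in \<open>auto simp: X_def\<close>)
  have R: "0 < emp_lik d n x" using less_le_trans[OF exp_gt_zero el_low] .
  ultimately have ln_up: "ln (emp_lik d n x) \<le> - log_lik d n X \<xi>"
    by (metis ln_exp ln_le_cancel_iff exp_gt_zero)
  have ln_low: "- log_lik d n X z \<le> ln (emp_lik d n x)"
    using el_low R by (metis ln_exp ln_le_cancel_iff exp_gt_zero)
  \<comment> \<open>Completing the square around xi: the model at z is at most its maximum.\<close>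
  have "dot d z xbar - dot d z (mv d W z) / 2 \<le> dot d xbar \<xi> / 2"
  proof -
    have "0 \<le> c0 * dot d (\<lambda>i. z i - \<xi> i) (\<lambda>i. z i - \<xi> i)" using c by simp
    also have "\<dots> \<le> dot d (\<lambda>i. z i - \<xi> i) (mv d W (\<lambda>i. z i - \<xi> i))" by (rule W_lower)
    also have "mv d W (\<lambda>i. z i - \<xi> i) = (\<lambda>i. mv d W z i - mv d W \<xi> i)"
      by (simp add: fun_eq_iff mv_def algebra_simps sum_subtractf)
    also have "dot d (\<lambda>i. z i - \<xi> i) (\<lambda>i. mv d W z i - mv d W \<xi> i)
        = dot d z (mv d W z) - 2 * dot d z xbar + dot d xbar \<xi>"
      using W_sym[of \<xi> z] W\<xi>[of z] lower by (simp add: dot_diff_left dot_diff_right)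
    finally show ?thesis by simp
  qed
  then have "real n * (dot d z xbar - dot d z (mv d W z) / 2) \<le> real n * (dot d xbar \<xi> / 2)"
    by (intro mult_left_mono) auto
  then have "log_lik d n X z \<le> real n * (dot d xbar \<xi> / 2) + \<eta>"
    using approx[of z] z(1) by linarith
  moreover have "real n * (dot d xbar \<xi> / 2) - \<eta> \<le> log_lik d n X \<xi>"
  proof -
    have "dot d \<xi> xbar - dot d \<xi> (mv d W \<xi>) / 2 = dot d xbar \<xi> / 2"
      using lower dot_commute[of d xbar \<xi>] by simp
    from approx[OF \<xi>r, unfolded this] show ?thesis by linarith
  qed
  ultimately have "\<bar>- 2 * ln (emp_lik d n x) - real n * dot d xbar \<xi>\<bar> \<le> 2 * \<eta>"
    using ln_up ln_low by (simp add: abs_le_iff)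
  also have "2 * \<eta> = \<delta> * sqrt (real d) * (\<rho>\<^sup>2 + 4 * \<rho> ^ 3 * (c1 + 1))"
    by (simp add: \<eta>_def algebra_simps)
  finally show ?thesis using R by (simp add: \<rho>_def)
qed

section \<open>Measurability of operator norm and empirical likelihood through countable
  families\<close>

definition rat_vec :: "int list \<Rightarrow> nat \<Rightarrow> nat \<Rightarrow> real" where
  "rat_vec l N j = (if j < length l then real_of_int (l ! j) / real N else 0)"

lemma floor_quotient_tendsto: "(\<lambda>N. real_of_int \<lfloor>real N * a\<rfloor> / real N) \<longlonglongrightarrow> a"
proof (rule tendsto_sandwich)
  show "\<forall>\<^sub>F N in sequentially. a - 1 / real N \<le> real_of_int \<lfloor>real N * a\<rfloor> / real N"
  proof (rule eventually_sequentiallyI[of 1])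
    fix N :: nat assume N: "1 \<le> N"
    have "real N * a - 1 \<le> real_of_int \<lfloor>real N * a\<rfloor>" by linarith
    then have "(real N * a - 1) / real N \<le> real_of_int \<lfloor>real N * a\<rfloor> / real N"
      by (intro divide_right_mono) auto
    then show "a - 1 / real N \<le> real_of_int \<lfloor>real N * a\<rfloor> / real N"
      using N by (simp add: diff_divide_distrib)
  qed
  show "\<forall>\<^sub>F N in sequentially. real_of_int \<lfloor>real N * a\<rfloor> / real N \<le> a"
  proof (rule eventually_sequentiallyI[of 1])
    fix N :: nat assume N: "1 \<le> N"
    have "real_of_int \<lfloor>real N * a\<rfloor> \<le> real N * a" by linarith
    then show "real_of_int \<lfloor>real N * a\<rfloor> / real N \<le> a"
      using N by (simp add: divide_le_eq mult.commute)
  qed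
  show "(\<lambda>N. a - 1 / real N) \<longlonglongrightarrow> a"
    using tendsto_diff[OF tendsto_const[of a] lim_1_over_n] by simp
qed simp

text \<open>Lists of integers over a common denominator form a countable type of parameters, and
  floors approximate any finite set of coordinates. Conditions stable under limits can thus be
  tested on countably many vectors.\<close>

lemma rat_vec_dense:
  obtains l where "\<And>j. j \<le> n \<Longrightarrow> (\<lambda>N. rat_vec (l N) N j) \<longlonglongrightarrow> p j"
proof -
  let ?l = "\<lambda>N. map (\<lambda>j. \<lfloor>real N * p j\<rfloor>) [0..<Suc n]"
  have "(\<lambda>N. rat_vec (?l N) N j) \<longlonglongrightarrow> p j" if "j \<le> n" for j
  proof -
    have "rat_vec (?l N) N j = real_of_int \<lfloor>real N * p j\<rfloor> / real N" for N
      using that by (simp add: rat_vec_def del: upt_Suc)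
    then show ?thesis using floor_quotient_tendsto by simp
  qed
  from that[OF this] show ?thesis .
qed

lemma nrm_eq_0_iff: "nrm d u = 0 \<longleftrightarrow> (\<forall>i<d. u i = 0)"
  unfolding nrm_def dot_def by (auto simp: sum_nonneg_eq_0_iff)

lemma vnorm_eq_nrm: "v \<in> carrier_vec d \<Longrightarrow> vnorm v = nrm d (($) v)"
  by (auto simp: vnorm_def nrm_def dot_def scalar_prod_def atLeast0LessThan)

lemma mult_mat_vec_nth_eq_mv:
  assumes "A \<in> carrier_mat d d" "u \<in> carrier_vec d" "i < d"
  shows "(A *\<^sub>v u) $ i = mv d (\<lambda>i k. A $$ (i, k)) (($) u) i"
  using assms by (auto simp: mv_def scalar_prod_def atLeast0LessThan)

lemma nrm_cong: "(\<And>i. i < d \<Longrightarrow> u i = v i) \<Longrightarrow> nrm d u = nrm d v"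
  unfolding nrm_def by (simp cong: dot_cong)

lemma vnorm_mult_mat_vec:
  assumes "A \<in> carrier_mat d d" "u \<in> carrier_vec d"
  shows "vnorm (A *\<^sub>v u) = nrm d (mv d (\<lambda>i k. A $$ (i, k)) (($) u))"
proof -
  have "A *\<^sub>v u \<in> carrier_vec d" using assms by simp
  then show ?thesis
    unfolding vnorm_eq_nrm[OF \<open>A *\<^sub>v u \<in> carrier_vec d\<close>]
    using mult_mat_vec_nth_eq_mv[OF assms] by (intro nrm_cong)
qed

text \<open>Provides the finite bound that makes the real-valued supremum in \<open>op_norm\<close>
  meaningful.\<close>

lemma nrm_mv_le_frobenius: "nrm d (mv d F u) \<le> sqrt (\<Sum>i<d. dot d (F i) (F i)) * nrm d u"
proof -
  have "dot d (mv d F u) (mv d F u) = (\<Sum>i<d. (dot d (F i) u)\<^sup>2)"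
    by (simp add: dot_def mv_def power2_eq_square)
  also have "\<dots> \<le> (\<Sum>i<d. dot d (F i) (F i) * dot d u u)"
    unfolding dot_def using Cauchy_Schwarz_ineq_sum[of _ u "{..<d}"]
    by (intro sum_mono) (simp add: power2_eq_square)
  also have "\<dots> = (\<Sum>i<d. dot d (F i) (F i)) * dot d u u"
    by (simp add: sum_distrib_right)
  finally show ?thesis
    unfolding nrm_def real_sqrt_mult[symmetric] by (rule real_sqrt_le_mono)
qed

text \<open>Homogeneity extends the inequality from the sphere, nonempty because 0 < d, to all u. In
  this form the condition is closed in u and is free of normalisation.\<close>

lemma op_norm_le_iff:
  assumes A: "A \<in> carrier_mat d d" and d: "0 < d"
  shows "op_norm A \<le> c \<longleftrightarrow> (\<forall>u. nrm d (mv d (\<lambda>i k. A $$ (i, k)) u) \<le> c * nrm d u)"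
proof -
  let ?F = "\<lambda>i k. A $$ (i, k)"
  have dc: "dim_col A = d" using A by auto
  have v: "vnorm (A *\<^sub>v u) = nrm d (mv d ?F (($) u))" "nrm d (($) u) = 1" if "u \<in> unit_sphere d" for u
    using that vnorm_mult_mat_vec[OF A, of u] vnorm_eq_nrm[of u d] by (auto simp: unit_sphere_def)
  have ne: "unit_sphere d \<noteq> {}"
  proof -
    have "unit_vec d 0 \<in> unit_sphere d"
      using d by (auto simp: unit_sphere_def vnorm_def)
    then show ?thesis by auto
  qed
  have bdd: "bdd_above ((\<lambda>u. vnorm (A *\<^sub>v u)) ` unit_sphere d)"
  proof (rule bdd_aboveI2)
    fix u assume "u \<in> unit_sphere d"
    then show "vnorm (A *\<^sub>v u) \<le> sqrt (\<Sum>i<d. dot d (?F i) (?F i))"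
      using nrm_mv_le_frobenius[of d ?F "($) u"] v[of u] by simp
  qed
  have "op_norm A \<le> c \<longleftrightarrow> (\<forall>u\<in>unit_sphere d. vnorm (A *\<^sub>v u) \<le> c)"
    unfolding op_norm_def dc by (rule cSUP_le_iff[OF ne bdd])
  also have "\<dots> \<longleftrightarrow> (\<forall>u. nrm d (mv d ?F u) \<le> c * nrm d u)"
  proof (intro iffI ballI allI)
    fix u assume *: "\<forall>u\<in>unit_sphere d. vnorm (A *\<^sub>v u) \<le> c"
    show "nrm d (mv d ?F u) \<le> c * nrm d u"
    proof (cases "nrm d u = 0")
      case True
      then have "mv d ?F u i = 0" for i by (simp add: nrm_eq_0_iff mv_def)
      then have "nrm d (mv d ?F u) = 0" by (simp add: nrm_eq_0_iff)
      then show ?thesis using True by simp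
    next
      case False
      then have pos: "0 < nrm d u" using nrm_nonneg[of d u] by linarith
      define w where "w = vec d (\<lambda>i. (1 / nrm d u) * u i)"
      have wc: "w \<in> carrier_vec d" by (simp add: w_def)
      have "nrm d (($) w) = nrm d (\<lambda>i. (1 / nrm d u) * u i)"
        by (intro nrm_cong) (simp add: w_def)
      also have "\<dots> = 1" using pos by (subst nrm_scale) simp
      finally have ws: "w \<in> unit_sphere d"
        using wc by (simp add: unit_sphere_def vnorm_eq_nrm)
      have "nrm d (mv d ?F (($) w)) = nrm d (\<lambda>i. (1 / nrm d u) * mv d ?F u i)"
        by (intro nrm_cong) (simp add: w_def mv_def sum_distrib_left mult_ac)
      also have "\<dots> = nrm d (mv d ?F u) / nrm d u" using pos by (subst nrm_scale) simp
      finally have "nrm d (mv d ?F u) / nrm d u \<le> c"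
        using * ws v(1)[OF ws] by auto
      then show ?thesis using pos by (simp add: divide_le_eq)
    qed
  next
    fix u assume *: "\<forall>u. nrm d (mv d ?F u) \<le> c * nrm d u" and u: "u \<in> unit_sphere d"
    show "vnorm (A *\<^sub>v u) \<le> c" using *[rule_format, of "($) u"] v[OF u] by simp
  qed
  finally show ?thesis .
qed

text \<open>Both sides of the homogeneous inequality are continuous in u, so it holds for all u as
  soon as it holds for the countably many vectors \<open>rat_vec l N\<close>.\<close>

lemma op_norm_level_measurable:
  assumes A: "\<And>\<omega>. \<omega> \<in> space M \<Longrightarrow> A \<omega> \<in> carrier_mat d d" and d: "0 < d"
    and meas: "\<And>i k. i < d \<Longrightarrow> k < d \<Longrightarrow> (\<lambda>\<omega>. A \<omega> $$ (i, k)) \<in> borel_measurable M"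
  shows "{\<omega> \<in> space M. op_norm (A \<omega>) \<le> c} \<in> sets M"
proof -
  let ?F = "\<lambda>\<omega> i k. A \<omega> $$ (i, k)"
  have eq: "op_norm (A \<omega>) \<le> c \<longleftrightarrow>
      (\<forall>l N. nrm d (mv d (?F \<omega>) (rat_vec l N)) \<le> c * nrm d (rat_vec l N))" if \<omega>: "\<omega> \<in> space M" for \<omega>
    unfolding op_norm_le_iff[OF A[OF \<omega>] d]
  proof (intro iffI allI)
    fix u assume *: "\<forall>l N. nrm d (mv d (?F \<omega>) (rat_vec l N)) \<le> c * nrm d (rat_vec l N)"
    obtain l where l: "\<And>j. j \<le> d \<Longrightarrow> (\<lambda>N. rat_vec (l N) N j) \<longlonglongrightarrow> u j"
      using rat_vec_dense by blast
    have "(\<lambda>N. nrm d (mv d (?F \<omega>) (rat_vec (l N) N))) \<longlonglongrightarrow> nrm d (mv d (?F \<omega>) u)"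
      unfolding nrm_def dot_def mv_def by (intro tendsto_intros l) auto
    moreover have "(\<lambda>N. c * nrm d (rat_vec (l N) N)) \<longlonglongrightarrow> c * nrm d u"
      unfolding nrm_def dot_def by (intro tendsto_intros l) auto
    ultimately show "nrm d (mv d (?F \<omega>) u) \<le> c * nrm d u"
      using * by (intro LIMSEQ_le) auto
  qed auto
  have "{\<omega> \<in> space M. \<forall>l N. nrm d (mv d (?F \<omega>) (rat_vec l N)) \<le> c * nrm d (rat_vec l N)} \<in> sets M"
  proof (intro sets.sets_Collect_countable_All)
    fix l N
    have "(\<lambda>\<omega>. nrm d (mv d (?F \<omega>) (rat_vec l N))) \<in> borel_measurable M"
      unfolding nrm_def dot_def mv_def
      by (intro measurable_compose[OF _ borel_measurable_sqrt] borel_measurable_sum borel_measurable_times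
          meas borel_measurable_const) auto
    then show "{\<omega> \<in> space M. nrm d (mv d (?F \<omega>) (rat_vec l N)) \<le> c * nrm d (rat_vec l N)} \<in> sets M"
      by measurable
  qed
  also have "{\<omega> \<in> space M. \<forall>l N. nrm d (mv d (?F \<omega>) (rat_vec l N)) \<le> c * nrm d (rat_vec l N)}
      = {\<omega> \<in> space M. op_norm (A \<omega>) \<le> c}"
    using eq by blast
  finally show ?thesis .
qed

text \<open>Feasibility with every constraint relaxed by e. Vectors from the countable family can in
  general not satisfy the equality constraints exactly, but they can do so up to any
  tolerance.\<close>

definition el_approx :: "nat \<Rightarrow> nat \<Rightarrow> (nat \<Rightarrow> nat \<Rightarrow> real) \<Rightarrow> real \<Rightarrow> real \<Rightarrow> (nat \<Rightarrow> real) \<Rightarrow> bool" where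
  "el_approx d n X r e p \<longleftrightarrow> (\<forall>j\<in>{1..n}. - e \<le> p j \<and> p j \<le> 1 + e) \<and> \<bar>(\<Sum>j\<in>{1..n}. p j) - 1\<bar> \<le> e
     \<and> (\<forall>i<d. \<bar>\<Sum>j\<in>{1..n}. p j * X j i\<bar> \<le> e) \<and> r - e \<le> (\<Prod>j\<in>{1..n}. real n * p j)"

text \<open>A feasible p satisfies each of the finitely many relaxed conditions with room to spare,
  so nearby members of the countable family satisfy all of them.\<close>

lemma approx_of_feasible:
  assumes p: "el_feasible d n X p" and prod: "r - e < (\<Prod>j\<in>{1..n}. real n * p j)" and e: "0 < e"
  shows "\<exists>l N. el_approx d n X r e (rat_vec l N)"
proof -
  obtain l where l: "\<And>j. j \<le> n \<Longrightarrow> (\<lambda>N. rat_vec (l N) N j) \<longlonglongrightarrow> p j"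
    using rat_vec_dense by blast
  have 1: "\<forall>\<^sub>F N in sequentially. - e < rat_vec (l N) N j" "\<forall>\<^sub>F N in sequentially. rat_vec (l N) N j < 1 + e"
    if "j \<in> {1..n}" for j
  proof -
    have "0 \<le> p j" "p j \<le> 1" using p that by (auto simp: el_feasible_def prob_weights_def PiE_iff)
    then show "\<forall>\<^sub>F N in sequentially. - e < rat_vec (l N) N j" "\<forall>\<^sub>F N in sequentially. rat_vec (l N) N j < 1 + e"
      using that e by (auto intro!: order_tendstoD[OF l])
  qed
  have "(\<lambda>N. \<bar>(\<Sum>j\<in>{1..n}. rat_vec (l N) N j) - 1\<bar>) \<longlonglongrightarrow> \<bar>(\<Sum>j\<in>{1..n}. p j) - 1\<bar>"
    by (intro tendsto_intros l) auto
  moreover have "(\<Sum>j\<in>{1..n}. p j) = 1"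
    using p by (auto simp: el_feasible_def prob_weights_def)
  ultimately have 2: "\<forall>\<^sub>F N in sequentially. \<bar>(\<Sum>j\<in>{1..n}. rat_vec (l N) N j) - 1\<bar> < e"
    using e by (intro order_tendstoD(2)[of _ "\<bar>(\<Sum>j\<in>{1..n}. p j) - 1\<bar>"]) simp_all
  have 3: "\<forall>\<^sub>F N in sequentially. \<bar>\<Sum>j\<in>{1..n}. rat_vec (l N) N j * X j i\<bar> < e" if "i < d" for i
  proof -
    have "(\<lambda>N. \<bar>\<Sum>j\<in>{1..n}. rat_vec (l N) N j * X j i\<bar>) \<longlonglongrightarrow> \<bar>\<Sum>j\<in>{1..n}. p j * X j i\<bar>"
      by (intro tendsto_intros l) auto
    moreover have "(\<Sum>j\<in>{1..n}. p j * X j i) = 0" using p that by (auto simp: el_feasible_def)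
    ultimately show ?thesis
      using e by (intro order_tendstoD(2)[of _ "\<bar>\<Sum>j\<in>{1..n}. p j * X j i\<bar>"]) simp_all
  qed
  have "(\<lambda>N. \<Prod>j\<in>{1..n}. real n * rat_vec (l N) N j) \<longlonglongrightarrow> (\<Prod>j\<in>{1..n}. real n * p j)"
    by (intro tendsto_intros l) auto
  then have 4: "\<forall>\<^sub>F N in sequentially. r - e < (\<Prod>j\<in>{1..n}. real n * rat_vec (l N) N j)"
    using prod by (rule order_tendstoD)
  have "\<forall>\<^sub>F N in sequentially. \<forall>j\<in>{1..n}. - e < rat_vec (l N) N j \<and> rat_vec (l N) N j < 1 + e"
    using 1 by (intro eventually_ball_finite ballI eventually_conj) auto
  moreover have "\<forall>\<^sub>F N in sequentially. \<forall>i\<in>{..<d}. \<bar>\<Sum>j\<in>{1..n}. rat_vec (l N) N j * X j i\<bar> < e"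
    using 3 by (intro eventually_ball_finite ballI) auto
  ultimately have "\<forall>\<^sub>F N in sequentially. el_approx d n X r e (rat_vec (l N) N)"
    using 2 4 by eventually_elim (auto simp: el_approx_def less_imp_le)
  then show ?thesis
    unfolding eventually_sequentially by (metis order_refl)
qed

text \<open>Approximate solutions lie in a sequentially compact cube, and along a convergent
  subsequence the tolerances vanish, so the limit satisfies the exact constraints.\<close>

lemma feasible_of_approx:
  assumes "\<And>k. el_approx d n X r (1 / real (Suc k)) (p k)"
  shows "\<exists>p. el_feasible d n X p \<and> r \<le> (\<Prod>j\<in>{1..n}. real n * p j)"
proof -
  \<comment> \<open>Extension by 0 outside {1..n} places the whole sequence in the product of the
    intervals from -1 to 2.\<close>
  define q where "q = (\<lambda>k j. if j \<in> {1..n} then p k j else 0)"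
  have "compactin (product_topology (\<lambda>_. euclidean) UNIV) (PiE UNIV (\<lambda>_::nat. {-1..2::real}))"
    unfolding compactin_PiE by simp
  then have "compact (PiE UNIV (\<lambda>_::nat. {-1..2::real}))"
    by (simp add: euclidean_product_topology)
  then have sc: "seq_compact (PiE UNIV (\<lambda>_::nat. {-1..2::real}))"
    by (simp add: compact_eq_seq_compact_metric)
  have qK: "q k \<in> PiE UNIV (\<lambda>_::nat. {-1..2::real})" for k
  proof -
    have "1 / real (Suc k) \<le> 1" by simp
    then have "-1 \<le> p k j \<and> p k j \<le> 2" if "j \<in> {1..n}" for j
      using assms[of k] that unfolding el_approx_def by (smt (verit))
    then show ?thesis by (auto simp: q_def PiE_iff)
  qed
  obtain L s where s: "strict_mono (s :: nat \<Rightarrow> nat)" and L: "(q \<circ> s) \<longlonglongrightarrow> L"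
  proof (rule seq_compactE[OF sc])
    show "\<forall>k. q k \<in> PiE UNIV (\<lambda>_::nat. {-1..2::real})" by (rule allI) (rule qK)
  qed (rule that)
  have Lj: "(\<lambda>k. p (s k) j) \<longlonglongrightarrow> L j" if "j \<in> {1..n}" for j
  proof -
    have "(\<lambda>k. (q \<circ> s) k j) \<longlonglongrightarrow> L j"
      using continuous_on_tendsto_compose[OF continuous_on_product_coordinates[of j] L] by simp
    then show ?thesis using that by (simp add: q_def)
  qed
  define p' where "p' = restrict L {1..n}"
  have e: "(\<lambda>k. 1 / real (Suc (s k))) \<longlonglongrightarrow> 0"
    using LIMSEQ_subseq_LIMSEQ[OF LIMSEQ_inverse_real_of_nat s] by (simp add: o_def inverse_eq_divide)
  have a: "el_approx d n X r (1 / real (Suc (s k))) (p (s k))" for k by (rule assms)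
  have b0: "0 \<le> L j" if "j \<in> {1..n}" for j
    by (rule LIMSEQ_le[OF tendsto_minus[OF e, simplified] Lj[OF that]])
      (use a that in \<open>auto simp: el_approx_def\<close>)
  have b1: "L j \<le> 1" if "j \<in> {1..n}" for j
  proof -
    have "(\<lambda>k. 1 + 1 / real (Suc (s k))) \<longlonglongrightarrow> 1"
      using tendsto_add[OF tendsto_const[of 1] e] by simp
    then show ?thesis
      by (rule LIMSEQ_le[OF Lj[OF that]]) (use a that in \<open>auto simp: el_approx_def\<close>)
  qed
  have "(\<lambda>k. \<bar>(\<Sum>j\<in>{1..n}. p (s k) j) - 1\<bar>) \<longlonglongrightarrow> \<bar>(\<Sum>j\<in>{1..n}. L j) - 1\<bar>"
    by (intro tendsto_intros Lj) auto
  then have "\<bar>(\<Sum>j\<in>{1..n}. L j) - 1\<bar> \<le> 0"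
    by (rule LIMSEQ_le[OF _ e]) (use a in \<open>auto simp: el_approx_def\<close>)
  then have b2: "(\<Sum>j\<in>{1..n}. L j) = 1" by simp
  have b3: "(\<Sum>j\<in>{1..n}. L j * X j i) = 0" if "i < d" for i
  proof -
    have "(\<lambda>k. \<bar>\<Sum>j\<in>{1..n}. p (s k) j * X j i\<bar>) \<longlonglongrightarrow> \<bar>\<Sum>j\<in>{1..n}. L j * X j i\<bar>"
      by (intro tendsto_intros Lj) auto
    then have "\<bar>\<Sum>j\<in>{1..n}. L j * X j i\<bar> \<le> 0"
      by (rule LIMSEQ_le[OF _ e]) (use a that in \<open>auto simp: el_approx_def\<close>)
    then show ?thesis by simp
  qed
  have "(\<lambda>k. r - 1 / real (Suc (s k))) \<longlonglongrightarrow> r"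
    using tendsto_diff[OF tendsto_const[of r] e] by simp
  moreover have "(\<lambda>k. \<Prod>j\<in>{1..n}. real n * p (s k) j) \<longlonglongrightarrow> (\<Prod>j\<in>{1..n}. real n * L j)"
    by (intro tendsto_intros Lj) auto
  ultimately have b4: "r \<le> (\<Prod>j\<in>{1..n}. real n * L j)"
    by (rule LIMSEQ_le) (use a in \<open>auto simp: el_approx_def\<close>)
  have "el_feasible d n X p'"
    using b0 b1 b2 b3 by (auto simp: el_feasible_def prob_weights_def p'_def)
  moreover have "r \<le> (\<Prod>j\<in>{1..n}. real n * p' j)" using b4 by (simp add: p'_def)
  ultimately show ?thesis by blast
qed

text \<open>The left side involves a supremum over uncountably many weights; compactness shows that
  it is equivalent to countably many conditions. Positivity of r excludes the inserted member
  0.\<close>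

lemma emp_lik_ge_iff:
  assumes n: "1 \<le> n" and dim: "\<And>j. 1 \<le> j \<Longrightarrow> j \<le> n \<Longrightarrow> x j \<in> carrier_vec d" and r: "0 < r"
  shows "r \<le> emp_lik d n x \<longleftrightarrow>
    (\<forall>k. \<exists>l N. el_approx d n (\<lambda>j i. x j $ i) r (1 / real (Suc k)) (rat_vec l N))"
proof -
  let ?S = "insert 0 {\<Prod>j\<in>{1..n}. real n * p j | p. el_feasible d n (\<lambda>j i. x j $ i) p}"
  have eq: "emp_lik d n x = Sup ?S"
    by (rule emp_lik_eq) (use assms in auto)
  show ?thesis
  proof
    assume *: "r \<le> emp_lik d n x"
    show "\<forall>k. \<exists>l N. el_approx d n (\<lambda>j i. x j $ i) r (1 / real (Suc k)) (rat_vec l N)"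
    proof
      fix k
      let ?e = "1 / real (Suc k)"
      have "0 < ?e" by simp
      then have "max 0 (r - ?e) < r" using r by linarith
      also have "r \<le> Sup ?S" using * by (simp only: eq)
      finally have "max 0 (r - ?e) < Sup ?S" .
      then obtain s where "s \<in> ?S" "max 0 (r - ?e) < s"
        by (subst (asm) less_cSup_iff[OF _ feasible_bdd_above[OF n]]) auto
      then obtain p where "el_feasible d n (\<lambda>j i. x j $ i) p" "r - ?e < (\<Prod>j\<in>{1..n}. real n * p j)"
        by auto
      then show "\<exists>l N. el_approx d n (\<lambda>j i. x j $ i) r ?e (rat_vec l N)"
        by (rule approx_of_feasible) simp
    qed
  next
    assume "\<forall>k. \<exists>l N. el_approx d n (\<lambda>j i. x j $ i) r (1 / real (Suc k)) (rat_vec l N)"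
    then obtain l N where "\<And>k. el_approx d n (\<lambda>j i. x j $ i) r (1 / real (Suc k)) (rat_vec (l k) (N k))"
      by (auto simp only: choice_iff)
    from feasible_of_approx[of d n "\<lambda>j i. x j $ i" r "\<lambda>k. rat_vec (l k) (N k)", OF this] obtain p' where
      p': "el_feasible d n (\<lambda>j i. x j $ i) p'" "r \<le> (\<Prod>j\<in>{1..n}. real n * p' j)" by blast
    have "(\<Prod>j\<in>{1..n}. real n * p' j) \<le> Sup ?S"
      by (intro cSup_upper feasible_bdd_above n) (use p' in auto)
    then show "r \<le> emp_lik d n x" using p' eq by simp
  qed
qed

lemma emp_lik_level_measurable:
  assumes n: "1 \<le> n" and r: "0 < r"
    and meas: "\<And>j. 1 \<le> j \<Longrightarrow> j \<le> n \<Longrightarrow> measurable_vec d M (\<lambda>\<omega>. x \<omega> j)"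
  shows "{\<omega> \<in> space M. r \<le> emp_lik d n (x \<omega>)} \<in> sets M"
proof -
  have m: "(\<lambda>\<omega>. x \<omega> j $ i) \<in> borel_measurable M" if "j \<in> {1..n}" "i < d" for i j
    using meas[of j] that by (auto simp: measurable_vec_def)
  have "{\<omega> \<in> space M. \<forall>k. \<exists>l N. el_approx d n (\<lambda>j i. x \<omega> j $ i) r (1 / real (Suc k)) (rat_vec l N)} \<in> sets M"
  proof (intro sets.sets_Collect_countable_All sets.sets_Collect_countable_Ex)
    fix k l N
    let ?p = "rat_vec l N"
    have s: "{\<omega> \<in> space M. \<bar>\<Sum>j\<in>{1..n}. ?p j * x \<omega> j $ i\<bar> \<le> 1 / real (Suc k)} \<in> sets M" if "i < d" for i
    proof -
      have "(\<lambda>\<omega>. \<Sum>j\<in>{1..n}. ?p j * x \<omega> j $ i) \<in> borel_measurable M"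
        using m that by (intro borel_measurable_sum borel_measurable_times) auto
      then show ?thesis by measurable
    qed
    have "{\<omega> \<in> space M. \<forall>i\<in>{..<d}. \<bar>\<Sum>j\<in>{1..n}. ?p j * x \<omega> j $ i\<bar> \<le> 1 / real (Suc k)} \<in> sets M"
      using s by (intro sets.sets_Collect_finite_All) auto
    \<comment> \<open>Only the mean constraints depend on the sample. The other conditions are those
      of dimension 0, so they can be pulled out as a condition that is free of the sample.\<close>
    moreover have "{\<omega> \<in> space M. el_approx d n (\<lambda>j i. x \<omega> j $ i) r (1 / real (Suc k)) ?p}
      = (if el_approx 0 n (\<lambda>_ _. 0) r (1 / real (Suc k)) ?p
         then {\<omega> \<in> space M. \<forall>i\<in>{..<d}. \<bar>\<Sum>j\<in>{1..n}. ?p j * x \<omega> j $ i\<bar> \<le> 1 / real (Suc k)} else {})"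
      by (auto simp only: el_approx_def lessThan_iff split: if_splits)
    ultimately show "{\<omega> \<in> space M. el_approx d n (\<lambda>j i. x \<omega> j $ i) r (1 / real (Suc k)) ?p} \<in> sets M"
      by simp
  qed
  also have "{\<omega> \<in> space M. \<forall>k. \<exists>l N. el_approx d n (\<lambda>j i. x \<omega> j $ i) r (1 / real (Suc k)) (rat_vec l N)}
    = {\<omega> \<in> space M. r \<le> emp_lik d n (x \<omega>)}"
  proof (intro Collect_cong conj_cong refl)
    fix \<omega> assume "\<omega> \<in> space M"
    then have "x \<omega> j \<in> carrier_vec d" if "1 \<le> j" "j \<le> n" for j
      using meas[OF that] by (auto simp: measurable_vec_def)
    then show "(\<forall>k. \<exists>l N. el_approx d n (\<lambda>j i. x \<omega> j $ i) r (1 / real (Suc k)) (rat_vec l N))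
      = (r \<le> emp_lik d n (x \<omega>))"
      using emp_lik_ge_iff[OF n _ r, of "x \<omega>" d] by simp
  qed
  finally show ?thesis .
qed

section \<open>The empirical likelihood statistic\<close>

lemma mv_cong: "(\<And>k. k < d \<Longrightarrow> A i k = A' i k) \<Longrightarrow> (\<And>k. k < d \<Longrightarrow> u k = u' k) \<Longrightarrow> mv d A u i = mv d A' u' i"
  by (simp add: mv_def)

lemma dot_mv_sym:
  assumes "\<And>i k. i < d \<Longrightarrow> k < d \<Longrightarrow> A i k = A k i"
  shows "dot d u (mv d A v) = dot d v (mv d A u)"
proof -
  have "(\<Sum>i<d. \<Sum>k<d. u i * (A i k * v k)) = (\<Sum>i<d. \<Sum>k<d. v k * (A k i * u i))"
    using assms by (intro sum.cong refl) simp
  also have "\<dots> = (\<Sum>k<d. \<Sum>i<d. v k * (A k i * u i))" by (rule sum.swap)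
  finally show ?thesis unfolding dot_def mv_def sum_distrib_left .
qed

text \<open>Normalising u moves the quotient of the two forms to the sphere; if u vanishes on the
  first d coordinates, both forms are 0. The predicate \<open>P\<close> stays abstract to serve
  lower and upper bounds alike.\<close>

lemma quadratic_form_scaling:
  fixes F :: "nat \<Rightarrow> nat \<Rightarrow> real"
  assumes "\<And>u. u \<in> unit_sphere d \<Longrightarrow> P (dot d (($) u) (mv d F (($) u)))"
  shows "dot d u u = 0 \<and> dot d u (mv d F u) = 0 \<or> 0 < dot d u u \<and> P (dot d u (mv d F u) / dot d u u)"
proof (cases "nrm d u = 0")
  case True
  then have "u i = 0" if "i < d" for i using that by (simp add: nrm_eq_0_iff)
  then show ?thesis by (simp add: dot_def)
next
  case False
  then have pos: "0 < nrm d u" using nrm_nonneg[of d u] by linarith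
  define w where "w = vec d (\<lambda>i. (1 / nrm d u) * u i)"
  have wc: "w \<in> carrier_vec d" by (simp add: w_def)
  have wi: "i < d \<Longrightarrow> w $ i = (1 / nrm d u) * u i" for i by (simp add: w_def)
  have "nrm d (($) w) = nrm d (\<lambda>i. (1 / nrm d u) * u i)" using wi by (intro nrm_cong)
  also have "\<dots> = 1" using pos by (subst nrm_scale) simp
  finally have ws: "w \<in> unit_sphere d" using wc by (simp add: unit_sphere_def vnorm_eq_nrm)
  have "dot d (($) w) (mv d F (($) w)) = dot d (\<lambda>i. (1 / nrm d u) * u i) (mv d F (\<lambda>i. (1 / nrm d u) * u i))"
    using wi by (intro dot_cong mv_cong) auto
  also have "\<dots> = (1 / nrm d u) * ((1 / nrm d u) * dot d u (mv d F u))"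
    unfolding mv_scale dot_scale_left dot_scale_right ..
  also have "\<dots> = dot d u (mv d F u) / (nrm d u)\<^sup>2" by (simp add: power2_eq_square)
  finally have "P (dot d u (mv d F u) / dot d u u)" using assms[OF ws] by (simp add: nrm_power2)
  moreover have "0 < dot d u u" using pos unfolding nrm_power2[symmetric] by simp
  ultimately show ?thesis by blast
qed

lemma regular_mats_bounds:
  assumes reg: "regular_mats m W" and W: "\<And>n. 1 \<le> n \<Longrightarrow> W n \<in> carrier_mat (m n) (m n)"
  obtains c0 c1 where "0 < c0" "0 < c1"
    "\<And>n u. 1 \<le> n \<Longrightarrow> c0 * dot (m n) u u \<le> dot (m n) u (mv (m n) (\<lambda>i k. W n $$ (i, k)) u)"
    "\<And>n u. 1 \<le> n \<Longrightarrow> dot (m n) u (mv (m n) (\<lambda>i k. W n $$ (i, k)) u) \<le> c1 * dot (m n) u u"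
proof -
  let ?F = "\<lambda>n i k. W n $$ (i, k)"
  have form: "u \<bullet> (W n *\<^sub>v u) = dot (m n) (($) u) (mv (m n) (?F n) (($) u))"
    if "1 \<le> n" "u \<in> unit_sphere (m n)" for n u
  proof -
    have u: "u \<in> carrier_vec (m n)" using that by (simp add: unit_sphere_def)
    then have "u \<bullet> (W n *\<^sub>v u) = dot (m n) (($) u) (($) (W n *\<^sub>v u))"
      using W[OF that(1)] by (intro scalar_prod_eq_dot) simp
    also have "\<dots> = dot (m n) (($) u) (mv (m n) (?F n) (($) u))"
      by (intro dot_cong mult_mat_vec_nth_eq_mv W[OF that(1)] u refl)
    finally show ?thesis .
  qed
  let ?I = "INF n\<in>{1..}. INF u\<in>unit_sphere (m n). ereal (u \<bullet> (W n *\<^sub>v u))"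
  let ?S = "SUP n\<in>{1..}. SUP u\<in>unit_sphere (m n). ereal (u \<bullet> (W n *\<^sub>v u))"
  have "ereal 0 < ?I" "?S < \<infinity>" using reg by (auto simp: regular_mats_def zero_ereal_def)
  \<comment> \<open>A real number strictly between 0 and the infimum avoids distinguishing finite
    from infinite extrema. For the upper bound, \<open>max c' 1\<close> below also secures
    positivity.\<close>
  obtain c0 where c0: "ereal 0 < ereal c0" "ereal c0 < ?I"
    using ereal_dense2[OF \<open>ereal 0 < ?I\<close>] by auto
  obtain c' where c': "?S < ereal c'"
    using ereal_dense2[OF \<open>?S < \<infinity>\<close>] by auto
  have lo: "c0 \<le> dot (m n) (($) u) (mv (m n) (?F n) (($) u))"
    if "1 \<le> n" "u \<in> unit_sphere (m n)" for n u
  proof -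
    have "?I \<le> (INF u\<in>unit_sphere (m n). ereal (u \<bullet> (W n *\<^sub>v u)))" using that by (intro INF_lower) simp
    also have "\<dots> \<le> ereal (u \<bullet> (W n *\<^sub>v u))" using that by (intro INF_lower)
    finally have "ereal c0 < ereal (u \<bullet> (W n *\<^sub>v u))" using c0(2) by (rule less_le_trans[rotated])
    then show ?thesis using form[OF that] by simp
  qed
  have hi: "dot (m n) (($) u) (mv (m n) (?F n) (($) u)) \<le> max c' 1"
    if "1 \<le> n" "u \<in> unit_sphere (m n)" for n u
  proof -
    have "ereal (u \<bullet> (W n *\<^sub>v u)) \<le> (SUP u\<in>unit_sphere (m n). ereal (u \<bullet> (W n *\<^sub>v u)))" using that by (intro SUP_upper)
    also have "\<dots> \<le> ?S" using that by (intro SUP_upper) simp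
    finally have "ereal (u \<bullet> (W n *\<^sub>v u)) < ereal c'" using c' by (rule le_less_trans)
    then show ?thesis using form[OF that] by simp
  qed
  show ?thesis
  proof (rule that)
    show "0 < c0" "0 < max c' 1" using c0 by auto
    show "c0 * dot (m n) u u \<le> dot (m n) u (mv (m n) (?F n) u)" if "1 \<le> n" for n u
      using quadratic_form_scaling[of "m n" "\<lambda>a. c0 \<le> a" "?F n" u, OF lo[OF that]]
      by (auto simp: pos_le_divide_eq)
    show "dot (m n) u (mv (m n) (?F n) u) \<le> max c' 1 * dot (m n) u u" if "1 \<le> n" for n u
      using quadratic_form_scaling[of "m n" "\<lambda>a. a \<le> max c' 1" "?F n" u, OF hi[OF that]]
      by (auto simp: pos_divide_le_eq)
  qed
qed

text \<open>The definition only says that B B is a left inverse of W; the right inverse follows by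
  symmetry, moving the matrices across the inner product with a basis vector. With y = B B u one has
  W y = u and |B u|^2 = y . W y, so the bounds on W turn into the last two inequalities.\<close>

lemma inv_sqrt_mat_function_props:
  fixes W :: "real mat"
  defines "F \<equiv> \<lambda>i k. W $$ (i, k)" and "B \<equiv> \<lambda>i k. inv_sqrt_mat W $$ (i, k)"
  assumes W: "W \<in> carrier_mat d d" and d: "0 < d"
    and sym: "\<And>u v. dot d u (mv d F v) = dot d v (mv d F u)"
    and c0: "0 < c0" and lower: "\<And>u. c0 * dot d u u \<le> dot d u (mv d F u)"
    and upper: "\<And>u. dot d u (mv d F u) \<le> c1 * dot d u u"
  shows "\<And>i k. i < d \<Longrightarrow> k < d \<Longrightarrow> B i k = B k i"
    and "\<And>u i. i < d \<Longrightarrow> mv d F (mv d B (mv d B u)) i = u i"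
    and "\<And>u. c0 * dot d (mv d B u) (mv d B u) \<le> dot d u u"
    and "\<And>u. dot d u u \<le> c1 * dot d (mv d B u) (mv d B u)"
proof -
  let ?R = "inv_sqrt_mat W"
  note props = inv_sqrt_mat_props[OF W d sym[unfolded F_def] c0 lower[unfolded F_def] upper[unfolded F_def]]
  have R: "?R \<in> carrier_mat d d" by (rule props)
  show Bs: "B i k = B k i" if "i < d" "k < d" for i k
    unfolding B_def using props(2) R that by (metis carrier_matD index_transpose_mat(1))
  have Bsym: "dot d u (mv d B v) = dot d v (mv d B u)" for u v
    using Bs by (rule dot_mv_sym)
  have left: "mv d B (mv d B (mv d F v)) i = v i" if i: "i < d" for v i
  proof -
    let ?x = "vec d v"
    have x: "?x \<in> carrier_vec d" by simp
    have Wx: "W *\<^sub>v ?x \<in> carrier_vec d" and RWx: "?R *\<^sub>v (W *\<^sub>v ?x) \<in> carrier_vec d" using W R x by auto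
    have "?R *\<^sub>v (?R *\<^sub>v (W *\<^sub>v ?x)) = (?R * ?R * W) *\<^sub>v ?x"
      using W R x by (simp add: assoc_mult_mat_vec[of _ d d _ d])
    then have "(?R *\<^sub>v (?R *\<^sub>v (W *\<^sub>v ?x))) $ i = v i" using props(3) i by simp
    moreover have "(?R *\<^sub>v (?R *\<^sub>v (W *\<^sub>v ?x))) $ i = mv d B (mv d B (mv d F v)) i"
    proof -
      have "(?R *\<^sub>v (?R *\<^sub>v (W *\<^sub>v ?x))) $ i = mv d B (($) (?R *\<^sub>v (W *\<^sub>v ?x))) i"
        unfolding B_def by (rule mult_mat_vec_nth_eq_mv[OF R RWx i])
      also have "\<dots> = mv d B (mv d B (($) (W *\<^sub>v ?x))) i"
        by (intro mv_cong refl) (simp only: B_def mult_mat_vec_nth_eq_mv[OF R Wx])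
      also have "\<dots> = mv d B (mv d B (mv d F (($) ?x))) i"
        by (intro mv_cong refl) (simp only: F_def mult_mat_vec_nth_eq_mv[OF W x])
      also have "\<dots> = mv d B (mv d B (mv d F v)) i"
        by (intro mv_cong refl) simp
      finally show ?thesis .
    qed
    ultimately show ?thesis by simp
  qed
  show right: "mv d F (mv d B (mv d B u)) i = u i" if i: "i < d" for u i
  proof -
    have "mv d F (mv d B (mv d B u)) i = dot d (unitv i) (mv d F (mv d B (mv d B u)))"
      using i by (simp add: dot_unitv)
    also have "\<dots> = dot d (mv d B (mv d B u)) (mv d F (unitv i))" by (rule sym)
    also have "\<dots> = dot d (mv d F (unitv i)) (mv d B (mv d B u))" by (rule dot_commute)
    also have "\<dots> = dot d (mv d B u) (mv d B (mv d F (unitv i)))" by (rule Bsym)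
    also have "\<dots> = dot d (mv d B (mv d F (unitv i))) (mv d B u)" by (rule dot_commute)
    also have "\<dots> = dot d u (mv d B (mv d B (mv d F (unitv i))))" by (rule Bsym)
    also have "\<dots> = dot d u (unitv i)" by (intro dot_cong refl left)
    also have "\<dots> = u i" using i by (simp add: dot_commute[of d u] dot_unitv)
    finally show ?thesis .
  qed
  fix u
  let ?y = "mv d B (mv d B u)"
  have BB: "dot d (mv d B u) (mv d B u) = dot d ?y (mv d F ?y)"
  proof -
    have "dot d (mv d B u) (mv d B u) = dot d u ?y" using Bsym[of "mv d B u" u] by simp
    also have "\<dots> = dot d ?y (mv d F ?y)"
      unfolding dot_commute[of d u] by (intro dot_cong refl right[symmetric])
    finally show ?thesis .
  qed
  have uu: "dot d (mv d F ?y) (mv d F ?y) = dot d u u" by (intro dot_cong right)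
  show "dot d u u \<le> c1 * dot d (mv d B u) (mv d B u)"
  proof -
    \<comment> \<open>Applied to y, \<open>psd_mv_square_le\<close> reads |W y|^2 <= c1 (y . W y),
      and W y = u.\<close>
    have "0 \<le> dot d v (mv d F v)" for v
      using lower[of v] c0 dot_self_nonneg[of d v] by (meson mult_nonneg_nonneg less_imp_le order_trans)
    from psd_mv_square_le[OF sym this upper, of ?y] show ?thesis unfolding BB uu .
  qed
  show "c0 * dot d (mv d B u) (mv d B u) \<le> dot d u u"
  proof -
    have yu: "dot d ?y (mv d F ?y) = dot d ?y u" by (intro dot_cong refl right)
    have "c0 * dot d ?y ?y \<le> nrm d ?y * nrm d u"
      using lower[of ?y] dot_le_nrm[of d ?y u] unfolding yu by linarith
    then have "(c0 * nrm d ?y) * nrm d ?y \<le> nrm d u * nrm d ?y"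
      by (simp add: nrm_power2[symmetric] power2_eq_square mult_ac)
    then have y: "c0 * nrm d ?y \<le> nrm d u"
      using mult_right_le_imp_le[of "c0 * nrm d ?y" "nrm d ?y" "nrm d u"] nrm_nonneg[of d ?y] nrm_nonneg[of d u]
      by (cases "nrm d ?y = 0") auto
    have "c0 * dot d (mv d B u) (mv d B u) \<le> c0 * (nrm d ?y * nrm d u)"
      unfolding BB yu using c0 dot_le_nrm[of d ?y u] by (intro mult_left_mono) auto
    also have "\<dots> = (c0 * nrm d ?y) * nrm d u" by simp
    also have "\<dots> \<le> nrm d u * nrm d u" using y by (intro mult_right_mono) auto
    also have "\<dots> = dot d u u" by (simp add: nrm_power2[symmetric] power2_eq_square)
    finally show ?thesis .
  qed
qed

lemma nrm_le_of_dot: "dot d u u \<le> a * dot d v v \<Longrightarrow> nrm d u \<le> sqrt a * nrm d v"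
  unfolding nrm_def by (metis real_sqrt_le_mono real_sqrt_mult)

text \<open>The first two summands are the constants of \<open>emp_lik_quadratic_approx\<close>, the
  last is the cost of replacing the mean of the estimator by the mean of v.\<close>

definition el_const :: "real \<Rightarrow> real \<Rightarrow> real \<Rightarrow> real" where
  "el_const c0 c1 \<kappa> = (9 * \<kappa> / c0)\<^sup>2 + 4 * (9 * \<kappa> / c0) ^ 3 * (c1 + 1) + 2 * \<kappa> / c0"

text \<open>Everything that happens on the good event, without probability. In
  \<open>\<kappa>\<close> the summand sqrt (2 C c1) bounds the mean of v through
  \<open>S_bound\<close> and \<open>B_lower\<close>, and the 1 covers the difference of the two
  means, both in units of sqrt (d / n).\<close>

lemma el_statistic_close:
  fixes n d :: nat and x :: "nat \<Rightarrow> real vec" and v :: "nat \<Rightarrow> nat \<Rightarrow> real" and W B :: "nat \<Rightarrow> nat \<Rightarrow> real"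
  defines "xbar \<equiv> \<lambda>i. (\<Sum>j\<in>{1..n}. x j $ i) / real n" and "vbar \<equiv> \<lambda>i. (\<Sum>j\<in>{1..n}. v j i) / real n"
    and "S \<equiv> \<lambda>i. \<Sum>j\<in>{1..n}. mv d B (v j) i"
  assumes n: "1 \<le> n" and d: "1 \<le> d" and dim: "\<And>j. 1 \<le> j \<Longrightarrow> j \<le> n \<Longrightarrow> x j \<in> carrier_vec d"
    and c: "0 < c0" "0 < c1" "1 \<le> C" and \<kappa>: "\<kappa> = 1 + sqrt (2 * C * c1)"
    and \<delta>: "0 \<le> \<delta>" "\<delta> \<le> 1" "\<delta> \<le> c0 / 2" "9 * \<kappa> / c0 * \<delta> \<le> 1 / 8"
    and W_sym: "\<And>u v. dot d u (mv d W v) = dot d v (mv d W u)"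
    and W_lower: "\<And>u. c0 * dot d u u \<le> dot d u (mv d W u)"
    and W_upper: "\<And>u. dot d u (mv d W u) \<le> c1 * dot d u u"
    and B_sym: "\<And>u v. dot d u (mv d B v) = dot d v (mv d B u)"
    and WBB: "\<And>u i. i < d \<Longrightarrow> mv d W (mv d B (mv d B u)) i = u i"
    and B_upper: "\<And>u. c0 * dot d (mv d B u) (mv d B u) \<le> dot d u u"
    and B_lower: "\<And>u. dot d u u \<le> c1 * dot d (mv d B u) (mv d B u)"
    and cov: "\<And>u. \<bar>(\<Sum>j\<in>{1..n}. (dot d u (($) (x j)))\<^sup>2) / real n - dot d u (mv d W u)\<bar>
      \<le> \<delta> / sqrt (real d) * dot d u u"
    and max: "\<And>j. j \<in> {1..n} \<Longrightarrow> real d * nrm d (($) (x j)) \<le> \<delta> * sqrt (real n)"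
    and exp: "nrm d (\<lambda>i. xbar i - vbar i) \<le> \<delta> / sqrt (real n)"
    and S_bound: "dot d S S \<le> 2 * C * (real n * real d)"
  shows "0 < emp_lik d n x \<and> \<bar>- 2 * ln (emp_lik d n x) - dot d S S / real n\<bar> \<le> \<delta> * sqrt (real d) * el_const c0 c1 \<kappa>"
proof -
  let ?r = "sqrt (real d / real n)"
  have dn: "0 < real d" "0 < real n" using n d by auto
  have \<kappa>0: "0 < \<kappa>" using c by (simp add: \<kappa> add_pos_nonneg)
  have S: "S i = real n * mv d B vbar i" for i
  proof -
    have "mv d B vbar i = (\<Sum>j\<in>{1..n}. mv d B (v j) i) / real n"
      unfolding mv_def vbar_def times_divide_eq_right sum_divide_distrib[symmetric] sum_distrib_left
      by (subst sum.swap) simp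
    then show ?thesis using dn by (simp add: S_def)
  qed
  then have SS: "dot d S S = (real n)\<^sup>2 * dot d (mv d B vbar) (mv d B vbar)"
    by (simp add: dot_def sum_distrib_left power2_eq_square mult_ac)
  have vb: "nrm d vbar \<le> sqrt (2 * C * c1) * ?r"
  proof -
    have "(real n)\<^sup>2 * dot d vbar vbar \<le> (real n)\<^sup>2 * (c1 * dot d (mv d B vbar) (mv d B vbar))"
      by (intro mult_left_mono B_lower) auto
    also have "\<dots> = c1 * dot d S S" by (simp add: SS)
    also have "\<dots> \<le> c1 * (2 * C * (real n * real d))" using c S_bound by (intro mult_left_mono) auto
    finally have "dot d vbar vbar \<le> 2 * C * c1 * (real d / real n)"
      using dn by (simp add: field_simps power2_eq_square)
    then show ?thesis unfolding nrm_def by (metis real_sqrt_le_mono real_sqrt_mult)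
  qed
  have dr: "\<delta> / sqrt (real n) \<le> 1 * ?r"
  proof -
    have "1 \<le> sqrt (real d)" using d by simp
    then have "\<delta> \<le> sqrt (real d)" using \<delta>(2) by linarith
    then show ?thesis using dn by (simp add: real_sqrt_divide divide_right_mono)
  qed
  have "nrm d xbar = nrm d (\<lambda>i. (xbar i - vbar i) + vbar i)" by simp
  also have "\<dots> \<le> nrm d (\<lambda>i. xbar i - vbar i) + nrm d vbar" by (rule nrm_triangle)
  also have "\<dots> \<le> \<kappa> * ?r" using vb exp dr by (simp add: \<kappa> distrib_right)
  finally have xb: "nrm d xbar \<le> \<kappa> * ?r" .
  have el: "0 < emp_lik d n x \<and> \<bar>- 2 * ln (emp_lik d n x) - real n * dot d xbar (mv d B (mv d B xbar))\<bar>
    \<le> \<delta> * sqrt (real d) * ((9 * \<kappa> / c0)\<^sup>2 + 4 * (9 * \<kappa> / c0) ^ 3 * (c1 + 1))"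
    using xb c \<kappa>0 unfolding xbar_def
    by (intro emp_lik_quadratic_approx[OF n d dim _ _ _ \<delta> W_sym W_lower W_upper cov max _ WBB]) auto
  have xBB: "dot d xbar (mv d B (mv d B xbar)) = dot d (mv d B xbar) (mv d B xbar)"
    by (rule B_sym)
  \<comment> \<open>A difference of squares, |B x|^2 - |B y|^2 = B (x - y) . B (x + y), with one
    factor of order delta / sqrt n and one of order sqrt (d / n).\<close>
  have eq: "dot d (mv d B xbar) (mv d B xbar) - dot d (mv d B vbar) (mv d B vbar)
    = dot d (mv d B (\<lambda>i. xbar i - vbar i)) (mv d B (\<lambda>i. xbar i + vbar i))"
    unfolding mv_diff mv_add dot_diff_left dot_add_right by (simp add: dot_commute[of d "mv d B vbar" "mv d B xbar"])
  have "\<bar>dot d (mv d B xbar) (mv d B xbar) - dot d (mv d B vbar) (mv d B vbar)\<bar>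
    \<le> nrm d (mv d B (\<lambda>i. xbar i - vbar i)) * nrm d (mv d B (\<lambda>i. xbar i + vbar i))"
    unfolding eq by (rule dot_le_nrm)
  also have "\<dots> \<le> (sqrt (1 / c0) * (\<delta> / sqrt (real n))) * (sqrt (1 / c0) * (2 * \<kappa> * ?r))"
  proof (intro mult_mono)
    have Bn: "nrm d (mv d B u) \<le> sqrt (1 / c0) * nrm d u" for u
      using B_upper[of u] c by (intro nrm_le_of_dot) (simp add: field_simps)
    show "nrm d (mv d B (\<lambda>i. xbar i - vbar i)) \<le> sqrt (1 / c0) * (\<delta> / sqrt (real n))"
      using c by (intro order_trans[OF Bn] mult_left_mono exp) auto
    have "nrm d vbar \<le> \<kappa> * ?r" using vb dn by (simp add: \<kappa> distrib_right add_increasing)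
    then have "nrm d (\<lambda>i. xbar i + vbar i) \<le> 2 * \<kappa> * ?r"
      using nrm_triangle[of d xbar vbar] xb by linarith
    then show "nrm d (mv d B (\<lambda>i. xbar i + vbar i)) \<le> sqrt (1 / c0) * (2 * \<kappa> * ?r)"
      using c by (intro order_trans[OF Bn] mult_left_mono) auto
  qed (use c \<delta> in auto)
  also have "\<dots> = (sqrt (1 / c0))\<^sup>2 * \<delta> * (2 * \<kappa>) * (?r / sqrt (real n))"
    by (simp only: power2_eq_square times_divide_eq_right times_divide_eq_left mult_ac)
  also have "\<dots> = \<delta> * (2 * \<kappa> / c0) * (sqrt (real d) / real n)"
  proof -
    have a: "(sqrt (1 / c0))\<^sup>2 = 1 / c0" using c by simp
    have b: "?r / sqrt (real n) = sqrt (real d) / real n" using dn by (simp add: real_sqrt_divide)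
    show ?thesis unfolding a b by simp
  qed
  finally have "real n * \<bar>dot d (mv d B xbar) (mv d B xbar) - dot d (mv d B vbar) (mv d B vbar)\<bar>
    \<le> real n * (\<delta> * (2 * \<kappa> / c0) * (sqrt (real d) / real n))"
    by (intro mult_left_mono) auto
  also have "\<dots> = \<delta> * sqrt (real d) * (2 * \<kappa> / c0)" using dn by simp
  finally have 2: "real n * \<bar>dot d (mv d B xbar) (mv d B xbar) - dot d (mv d B vbar) (mv d B vbar)\<bar>
    \<le> \<delta> * sqrt (real d) * (2 * \<kappa> / c0)" .
  have "real n * \<bar>dot d (mv d B xbar) (mv d B xbar) - dot d (mv d B vbar) (mv d B vbar)\<bar>
    = \<bar>real n * dot d xbar (mv d B (mv d B xbar)) - dot d S S / real n\<bar>"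
  proof -
    have "dot d S S / real n = real n * dot d (mv d B vbar) (mv d B vbar)"
      using dn by (simp add: SS power2_eq_square)
    then show ?thesis using dn by (simp add: xBB right_diff_distrib[symmetric] abs_mult)
  qed
  then have "\<bar>- 2 * ln (emp_lik d n x) - dot d S S / real n\<bar>
    \<le> \<delta> * sqrt (real d) * ((9 * \<kappa> / c0)\<^sup>2 + 4 * (9 * \<kappa> / c0) ^ 3 * (c1 + 1)) + \<delta> * sqrt (real d) * (2 * \<kappa> / c0)"
    using el 2 by linarith
  then show ?thesis using el by (simp add: el_const_def distrib_left)
qed

text \<open>The difference of the two forms is the form of the matrix difference, which
  Cauchy-Schwarz bounds by its operator norm.\<close>

lemma sample_covariance_form:
  fixes n d :: nat and x :: "nat \<Rightarrow> real vec"
  assumes dim: "\<And>j. 1 \<le> j \<Longrightarrow> j \<le> n \<Longrightarrow> x j \<in> carrier_vec d" and d: "0 < d"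
    and W: "W \<in> carrier_mat d d" and op: "op_norm (mean_mat d n (\<lambda>j. outer (x j) (x j)) - W) \<le> c"
  shows "\<bar>(\<Sum>j\<in>{1..n}. (dot d u (($) (x j)))\<^sup>2) / real n - dot d u (mv d (\<lambda>i k. W $$ (i, k)) u)\<bar>
      \<le> c * dot d u u"
proof -
  let ?D = "mean_mat d n (\<lambda>j. outer (x j) (x j)) - W"
  have D: "?D \<in> carrier_mat d d" using W by auto
  have Dik: "?D $$ (i, k) = (\<Sum>j\<in>{1..n}. x j $ i * x j $ k) / real n - W $$ (i, k)" if "i < d" "k < d" for i k
  proof -
    have "(\<Sum>j\<in>{1..n}. outer (x j) (x j) $$ (i, k)) = (\<Sum>j\<in>{1..n}. x j $ i * x j $ k)"
    proof (intro sum.cong refl)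
      fix j assume "j \<in> {1..n}"
      then have "dim_vec (x j) = d" using dim[of j] by auto
      then show "outer (x j) (x j) $$ (i, k) = x j $ i * x j $ k" using that by (simp add: outer_def)
    qed
    then show ?thesis using that W by (auto simp: mean_mat_def)
  qed
  have "dot d u (mv d (\<lambda>i k. ?D $$ (i, k)) u)
    = (\<Sum>i<d. \<Sum>k<d. u i * (((\<Sum>j\<in>{1..n}. x j $ i * x j $ k) / real n - W $$ (i, k)) * u k))"
    unfolding dot_def mv_def sum_distrib_left by (intro sum.cong refl) (simp only: Dik lessThan_iff)
  also have "\<dots> = (\<Sum>i<d. \<Sum>k<d. \<Sum>j\<in>{1..n}. u i * u k * (x j $ i * x j $ k)) / real n
      - (\<Sum>i<d. \<Sum>k<d. u i * (W $$ (i, k) * u k))"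
    by (simp add: left_diff_distrib right_diff_distrib sum_subtractf sum_divide_distrib sum_distrib_left
        sum_distrib_right mult_ac)
  also have "(\<Sum>i<d. \<Sum>k<d. \<Sum>j\<in>{1..n}. u i * u k * (x j $ i * x j $ k)) = (\<Sum>j\<in>{1..n}. (dot d u (($) (x j)))\<^sup>2)"
    unfolding dot_power2_eq by (subst sum.swap[of _ "{1..n}"], subst sum.swap[of _ "{1..n}"]) (rule refl)
  also have "(\<Sum>i<d. \<Sum>k<d. u i * (W $$ (i, k) * u k)) = dot d u (mv d (\<lambda>i k. W $$ (i, k)) u)"
    unfolding dot_def mv_def sum_distrib_left ..
  finally have eq: "dot d u (mv d (\<lambda>i k. ?D $$ (i, k)) u)
    = (\<Sum>j\<in>{1..n}. (dot d u (($) (x j)))\<^sup>2) / real n - dot d u (mv d (\<lambda>i k. W $$ (i, k)) u)" .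
  have "\<bar>dot d u (mv d (\<lambda>i k. ?D $$ (i, k)) u)\<bar> \<le> nrm d u * nrm d (mv d (\<lambda>i k. ?D $$ (i, k)) u)"
    by (rule dot_le_nrm)
  also have "\<dots> \<le> nrm d u * (c * nrm d u)"
    using op op_norm_le_iff[OF D d] by (intro mult_left_mono) auto
  also have "\<dots> = c * dot d u u" by (simp add: nrm_power2[symmetric] power2_eq_square)
  finally show ?thesis unfolding eq .
qed

lemma neg2log_stat_le_iff:
  assumes "0 \<le> r" "0 < s"
  shows "(neg2log r - ereal a) / ereal s \<le> ereal t \<longleftrightarrow> 0 < r \<and> (- 2 * ln r - a) / s \<le> t"
  using assms by (auto simp: neg2log_def)

text \<open>Rewrites the event as a superlevel set of the likelihood at a positive level, which also
  excludes r = 0, where the statistic is infinite. This is the shape covered by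
  \<open>emp_lik_level_measurable\<close>.\<close>

lemma neg2log_stat_level:
  assumes "0 \<le> r" "0 < s"
  shows "(neg2log r - ereal a) / ereal s \<le> ereal t \<longleftrightarrow> exp (- (t * s + a) / 2) \<le> r"
proof (cases "r = 0")
  case False
  then have r: "0 < r" using assms by simp
  have "(- 2 * ln r - a) / s \<le> t \<longleftrightarrow> - (t * s + a) / 2 \<le> ln r"
    using assms by (auto simp: pos_divide_le_eq)
  also have "\<dots> \<longleftrightarrow> exp (- (t * s + a) / 2) \<le> r" by (rule ln_ge_iff[OF r])
  finally show ?thesis using neg2log_stat_le_iff[OF assms] r by simp
qed (use neg2log_stat_le_iff[OF assms] in simp)

lemma emp_lik_nonneg:
  assumes "1 \<le> n" and "\<And>j. 1 \<le> j \<Longrightarrow> j \<le> n \<Longrightarrow> x j \<in> carrier_vec d"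
  shows "0 \<le> emp_lik d n x"
proof -
  have "emp_lik d n x = Sup (insert 0 {\<Prod>j\<in>{1..n}. real n * p j | p. el_feasible d n (\<lambda>j i. x j $ i) p})"
    by (rule emp_lik_eq) (use assms in auto)
  then show ?thesis
    using cSup_upper[OF insertI1 feasible_bdd_above[OF assms(1), of d "\<lambda>j i. x j $ i"]] by simp
qed

lemma outer_index: "i < dim_vec x \<Longrightarrow> k < dim_vec y \<Longrightarrow> outer x y $$ (i, k) = x $ i * y $ k"
  by (simp add: outer_def)

lemma triple_product_index:
  fixes A K :: "real mat"
  assumes "A \<in> carrier_mat d d" "K \<in> carrier_mat d d" "a < d" "b < d"
  shows "(A * K * A) $$ (a, b) = (\<Sum>k<d. (\<Sum>l<d. A $$ (a, l) * K $$ (l, k)) * A $$ (k, b))"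
proof -
  have ij: "(P * R) $$ (i, j) = (\<Sum>k<d. P $$ (i, k) * R $$ (k, j))"
    if "P \<in> carrier_mat d d" "R \<in> carrier_mat d d" "i < d" "j < d" for P R :: "real mat" and i j
    using that by (auto simp: scalar_prod_def atLeast0LessThan)
  have AK: "A * K \<in> carrier_mat d d" using assms by simp
  have "(A * K * A) $$ (a, b) = (\<Sum>k<d. (A * K) $$ (a, k) * A $$ (k, b))"
    by (rule ij[OF AK assms(1,3,4)])
  also have "\<dots> = (\<Sum>k<d. (\<Sum>l<d. A $$ (a, l) * K $$ (l, k)) * A $$ (k, b))"
    by (intro sum.cong refl) (simp only: ij[OF assms(1,2,3)] lessThan_iff)
  finally show ?thesis .
qed

lemma mat_trace_square:
  assumes "A \<in> carrier_mat d d"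
  shows "mat_trace (A * A) = (\<Sum>a<d. \<Sum>b<d. A $$ (a, b) * A $$ (b, a))"
  using assms by (auto simp: mat_trace_def scalar_prod_def atLeast0LessThan intro!: sum.cong)

lemma vnorm_mean_diff:
  "vnorm (mean_vec d n x - mean_vec d n y)
    = nrm d (\<lambda>i. (\<Sum>j\<in>{1..n}. x j $ i) / real n - (\<Sum>j\<in>{1..n}. y j $ i) / real n)"
proof -
  have "mean_vec d n x - mean_vec d n y \<in> carrier_vec d" by (simp add: mean_vec_def)
  then have "vnorm (mean_vec d n x - mean_vec d n y) = nrm d (($) (mean_vec d n x - mean_vec d n y))"
    by (rule vnorm_eq_nrm)
  also have "\<dots> = nrm d (\<lambda>i. (\<Sum>j\<in>{1..n}. x j $ i) / real n - (\<Sum>j\<in>{1..n}. y j $ i) / real n)"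
    by (intro nrm_cong) (simp add: mean_vec_def)
  finally show ?thesis .
qed

lemma max_vnorm_measurable:
  fixes x :: "'w \<Rightarrow> nat \<Rightarrow> real vec"
  assumes "\<And>j. 1 \<le> j \<Longrightarrow> j \<le> n \<Longrightarrow> measurable_vec d M (\<lambda>\<omega>. x \<omega> j)"
  shows "(\<lambda>\<omega>. MAX j\<in>{1..n}. vnorm (x \<omega> j)) \<in> borel_measurable M"
proof (rule borel_measurable_Max)
  fix j assume "j \<in> {1..n}"
  then have j: "measurable_vec d M (\<lambda>\<omega>. x \<omega> j)" using assms by simp
  have "(\<lambda>\<omega>. nrm d (($) (x \<omega> j))) \<in> borel_measurable M"
    unfolding nrm_def dot_def
    by (intro measurable_compose[OF _ borel_measurable_sqrt] borel_measurable_sum borel_measurable_times)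
      (use j in \<open>auto simp: measurable_vec_def\<close>)
  then show "(\<lambda>\<omega>. vnorm (x \<omega> j)) \<in> borel_measurable M"
    using j by (subst measurable_cong[where g = "\<lambda>\<omega>. nrm d (($) (x \<omega> j))"])
      (auto simp: measurable_vec_def vnorm_eq_nrm)
qed simp

lemma op_norm_sample_cov_measurable:
  assumes x: "\<And>j. 1 \<le> j \<Longrightarrow> j \<le> n \<Longrightarrow> measurable_vec d M (\<lambda>\<omega>. x \<omega> j)"
    and d: "0 < d" and W: "W \<in> carrier_mat d d"
  shows "{\<omega> \<in> space M. op_norm (mean_mat d n (\<lambda>j. outer (x \<omega> j) (x \<omega> j)) - W) \<le> a} \<in> sets M"
proof (rule op_norm_level_measurable[OF _ d])
  show "mean_mat d n (\<lambda>j. outer (x \<omega> j) (x \<omega> j)) - W \<in> carrier_mat d d" for \<omega>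
    using W by auto
  fix i k assume ik: "i < d" "k < d"
  have m: "(\<lambda>\<omega>. x \<omega> j $ i) \<in> borel_measurable M" if "j \<in> {1..n}" "i < d" for i j
    using x[of j] that by (auto simp: measurable_vec_def)
  have "(\<lambda>\<omega>. (\<Sum>j\<in>{1..n}. x \<omega> j $ i * x \<omega> j $ k) / real n - W $$ (i, k)) \<in> borel_measurable M"
    using ik by (intro borel_measurable_diff borel_measurable_divide borel_measurable_const borel_measurable_sum
        borel_measurable_times m)
  moreover have "(mean_mat d n (\<lambda>j. outer (x \<omega> j) (x \<omega> j)) - W) $$ (i, k)
    = (\<Sum>j\<in>{1..n}. x \<omega> j $ i * x \<omega> j $ k) / real n - W $$ (i, k)" if \<omega>: "\<omega> \<in> space M" for \<omega>
  proof -
    have "(\<Sum>j\<in>{1..n}. outer (x \<omega> j) (x \<omega> j) $$ (i, k)) = (\<Sum>j\<in>{1..n}. x \<omega> j $ i * x \<omega> j $ k)"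
    proof (intro sum.cong refl)
      fix j assume "j \<in> {1..n}"
      then have "x \<omega> j \<in> carrier_vec d" using x[of j] \<omega> by (auto simp: measurable_vec_def)
      then have "dim_vec (x \<omega> j) = d" by simp
      then show "outer (x \<omega> j) (x \<omega> j) $$ (i, k) = x \<omega> j $ i * x \<omega> j $ k" using ik by (simp add: outer_index)
    qed
    then show ?thesis using ik W by (auto simp: mean_mat_def)
  qed
  ultimately show "(\<lambda>\<omega>. (mean_mat d n (\<lambda>j. outer (x \<omega> j) (x \<omega> j)) - W) $$ (i, k)) \<in> borel_measurable M"
    by (subst measurable_cong) auto
qed

lemma (in prob_space) prob_Un_tendsto_zero:
  assumes A: "\<forall>\<^sub>F n in sequentially. A n \<in> events" and B: "\<forall>\<^sub>F n in sequentially. B n \<in> events"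
    and "(\<lambda>n. prob (A n)) \<longlonglongrightarrow> 0" "(\<lambda>n. prob (B n)) \<longlonglongrightarrow> 0"
  shows "\<forall>\<^sub>F n in sequentially. A n \<union> B n \<in> events" "(\<lambda>n. prob (A n \<union> B n)) \<longlonglongrightarrow> 0"
proof -
  show "\<forall>\<^sub>F n in sequentially. A n \<union> B n \<in> events" using A B by eventually_elim auto
  have "\<forall>\<^sub>F n in sequentially. prob (A n \<union> B n) \<le> prob (A n) + prob (B n)"
    using A B by eventually_elim (rule measure_Un_le)
  moreover have "(\<lambda>n. prob (A n) + prob (B n)) \<longlonglongrightarrow> 0"
    using tendsto_add[OF assms(3,4)] by simp
  ultimately show "(\<lambda>n. prob (A n \<union> B n)) \<longlonglongrightarrow> 0"
    using tendsto_sandwich[of "\<lambda>_. 0" "\<lambda>n. prob (A n \<union> B n)" sequentially "\<lambda>n. prob (A n) + prob (B n)" 0]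
    by simp
qed

section \<open>From the hypotheses to the array of normalised vectors, then the limit law on a good
  event\<close>

theorem theorem7p4:
  fixes Q :: "'z measure" and M :: "'w measure" and Z :: "nat \<Rightarrow> 'w \<Rightarrow> 'z"
    and m :: "nat \<Rightarrow> nat"
    and w v :: "nat \<Rightarrow> 'z \<Rightarrow> real vec"
    and w_hat :: "nat \<Rightarrow> (nat \<Rightarrow> 'z) \<Rightarrow> 'z \<Rightarrow> real vec"
    and x :: "nat \<Rightarrow> 'w \<Rightarrow> nat \<Rightarrow> real vec"
    and W U :: "nat \<Rightarrow> real mat" and W_hat :: "nat \<Rightarrow> 'w \<Rightarrow> real mat"
  assumes prob_Q: "prob_space Q" and prob_M: "prob_space M"
    and indep: "prob_space.indep_vars M (\<lambda>_. Q) Z {1..}"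
    and distr_Z: "\<And>j. 1 \<le> j \<Longrightarrow> distr M Q (Z j) = Q"
    and m_pos: "\<And>n. 1 \<le> n \<Longrightarrow> 0 < m n"
    and m_lim: "filterlim m at_top sequentially"
    and w_meas: "\<And>n. 1 \<le> n \<Longrightarrow> measurable_vec (m n) Q (w n)"
    and w_mean: "\<And>n. 1 \<le> n \<Longrightarrow> integral_vec (m n) Q (w n) = 0\<^sub>v (m n)"
    and w_sq: "\<And>n. 1 \<le> n \<Longrightarrow> integrable Q (\<lambda>z. (vnorm (w n z))\<^sup>2)"
    and W_def: "\<And>n. 1 \<le> n \<Longrightarrow> W n = integral_mat (m n) Q (\<lambda>z. outer (w n z) (w n z))"
    and w_hat_dim: "\<And>n \<zeta> z. 1 \<le> n \<Longrightarrow> \<zeta> \<in> {1..n} \<rightarrow>\<^sub>E space Q \<Longrightarrow> z \<in> space Q \<Longrightarrow>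
          w_hat n \<zeta> z \<in> carrier_vec (m n)"
    and x_def: "\<And>n \<omega> j. x n \<omega> j = w_hat n (\<lambda>i\<in>{1..n}. Z i \<omega>) (Z j \<omega>)"
    and x_meas: "\<And>n j. 1 \<le> j \<Longrightarrow> j \<le> n \<Longrightarrow> measurable_vec (m n) M (\<lambda>\<omega>. x n \<omega> j)"
    and W_hat_def: "\<And>n \<omega>. 1 \<le> n \<Longrightarrow>
          W_hat n \<omega> = mean_mat (m n) n (\<lambda>j. outer (x n \<omega> j) (x n \<omega> j))"
    and regular: "regular_mats m W"
    and max_op: "small_o_p M (\<lambda>n \<omega>. real (m n) * (MAX j\<in>{1..n}. vnorm (x n \<omega> j)))
          (\<lambda>n. sqrt (real n))"
    and W_hat_op: "small_o_p M (\<lambda>n \<omega>. op_norm (W_hat n \<omega> - W n)) (\<lambda>n. 1 / sqrt (real (m n)))"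
    and v_meas: "\<And>n. 1 \<le> n \<Longrightarrow> measurable_vec (m n) Q (v n)"
    and v_sq: "\<And>n. 1 \<le> n \<Longrightarrow> integrable Q (\<lambda>z. (vnorm (v n z))\<^sup>2)"
    and v_mean: "\<And>n. 1 \<le> n \<Longrightarrow> integral_vec (m n) Q (v n) = 0\<^sub>v (m n)"
    and v_lindeberg: "lindeberg Q (\<lambda>n z. vnorm (v n z))"
    and expansion: "small_o_p M (\<lambda>n \<omega>. vnorm (mean_vec (m n) n (x n \<omega>)
            - mean_vec (m n) n (\<lambda>j. v n (Z j \<omega>)))) (\<lambda>n. 1 / sqrt (real n))"
    and U_def: "\<And>n. 1 \<le> n \<Longrightarrow> U n = inv_sqrt_mat (W n)
            * integral_mat (m n) Q (\<lambda>z. outer (v n z) (v n z)) * inv_sqrt_mat (W n)"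
    and U_bounded: "(\<lambda>n. op_norm (U n)) \<in> O(\<lambda>_. 1)"
    and trace_ratio: "\<exists>C. \<forall>n\<ge>1. 0 < mat_trace (U n * U n) \<and> real (m n) / mat_trace (U n * U n) \<le> C"
  shows "asymp_std_normal M (\<lambda>n \<omega>.
           (neg2log (emp_lik (m n) n (x n \<omega>)) - ereal (mat_trace (U n)))
             / ereal (sqrt (2 * mat_trace (U n * U n))))"
proof -
  interpret Q: prob_space Q by (rule prob_Q)
  interpret M: prob_space M by (rule prob_M)
  have Wc: "W n \<in> carrier_mat (m n) (m n)" if "1 \<le> n" for n
    using W_def[OF that] by (simp add: integral_mat_def)
  have W_entry_sym: "W n $$ (i, k) = W n $$ (k, i)" if n: "1 \<le> n" and ik: "i < m n" "k < m n" for n i k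
  proof -
    have "(\<integral>z. outer (w n z) (w n z) $$ (i, k) \<partial>Q) = (\<integral>z. outer (w n z) (w n z) $$ (k, i) \<partial>Q)"
    proof (rule Bochner_Integration.integral_cong[OF refl])
      fix z assume "z \<in> space Q"
      then have "dim_vec (w n z) = m n" using w_meas[OF n] by (auto simp: measurable_vec_def)
      then show "outer (w n z) (w n z) $$ (i, k) = outer (w n z) (w n z) $$ (k, i)"
        using ik by (simp add: outer_index)
    qed
    then show ?thesis using W_def[OF n] ik by (simp add: integral_mat_def)
  qed
  obtain c0 c1 where c0: "0 < c0" and c1: "0 < c1"
    and W_lower: "\<And>n u. 1 \<le> n \<Longrightarrow> c0 * dot (m n) u u \<le> dot (m n) u (mv (m n) (\<lambda>i k. W n $$ (i, k)) u)"
    and W_upper: "\<And>n u. 1 \<le> n \<Longrightarrow> dot (m n) u (mv (m n) (\<lambda>i k. W n $$ (i, k)) u) \<le> c1 * dot (m n) u u"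
  proof (rule regular_mats_bounds[OF regular])
    show "\<And>n. 1 \<le> n \<Longrightarrow> W n \<in> carrier_mat (m n) (m n)" by (rule Wc)
  qed (rule that)
  define Wf where "Wf = (\<lambda>n i k. W n $$ (i, k))"
  define Bf where "Bf = (\<lambda>n i k. inv_sqrt_mat (W n) $$ (i, k))"
  have W_sym: "dot (m n) u (mv (m n) (Wf n) v) = dot (m n) v (mv (m n) (Wf n) u)" if "1 \<le> n" for n u v
    unfolding Wf_def by (rule dot_mv_sym) (rule W_entry_sym[OF that])
  note B_args = Wc m_pos W_sym[unfolded Wf_def] c0 W_lower W_upper
  have B_carrier: "inv_sqrt_mat (W n) \<in> carrier_mat (m n) (m n)" if "1 \<le> n" for n
    by (rule inv_sqrt_mat_props(1)[of "W n" "m n" c0 c1]) (use B_args that in auto)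
  have Bp': "(\<forall>i<m n. \<forall>k<m n. Bf n i k = Bf n k i) \<and> (\<forall>u. \<forall>i<m n. mv (m n) (Wf n) (mv (m n) (Bf n) (mv (m n) (Bf n) u)) i = u i)
    \<and> (\<forall>u. c0 * dot (m n) (mv (m n) (Bf n) u) (mv (m n) (Bf n) u) \<le> dot (m n) u u)
    \<and> (\<forall>u. dot (m n) u u \<le> c1 * dot (m n) (mv (m n) (Bf n) u) (mv (m n) (Bf n) u))" if n: "1 \<le> n" for n
    unfolding Bf_def Wf_def
    using inv_sqrt_mat_function_props[OF Wc[OF n] m_pos[OF n] W_sym[OF n, unfolded Wf_def] c0 W_lower[OF n] W_upper[OF n]]
    by blast
  have B_entry_sym: "Bf n i k = Bf n k i" if "1 \<le> n" "i < m n" "k < m n" for n i k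
    using Bp'[OF that(1)] that by blast
  have B_sym: "dot (m n) u (mv (m n) (Bf n) v) = dot (m n) v (mv (m n) (Bf n) u)" if "1 \<le> n" for n u v
    by (rule dot_mv_sym) (rule B_entry_sym[OF that])
  have WBB: "mv (m n) (Wf n) (mv (m n) (Bf n) (mv (m n) (Bf n) u)) i = u i" if "1 \<le> n" "i < m n" for n u i
    using Bp'[OF that(1)] that by blast
  have B_upper: "c0 * dot (m n) (mv (m n) (Bf n) u) (mv (m n) (Bf n) u) \<le> dot (m n) u u" if "1 \<le> n" for n u
    using Bp'[OF that] by blast
  have B_lower: "dot (m n) u u \<le> c1 * dot (m n) (mv (m n) (Bf n) u) (mv (m n) (Bf n) u)" if "1 \<le> n" for n u
    using Bp'[OF that] by blast

  have vc: "v n z \<in> carrier_vec (m n)" if "1 \<le> n" "z \<in> space Q" for n z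
    using v_meas[OF that(1)] that(2) by (auto simp: measurable_vec_def)
  have vm: "(\<lambda>z. v n z $ i) \<in> borel_measurable Q" if "1 \<le> n" "i < m n" for n i
    using v_meas[OF that(1)] that(2) by (auto simp: measurable_vec_def)
  have v2: "integrable Q (\<lambda>z. (v n z $ i)\<^sup>2)" if n: "1 \<le> n" and i: "i < m n" for n i
  proof (rule Bochner_Integration.integrable_bound[OF v_sq[OF n]])
    show "(\<lambda>z. (v n z $ i)\<^sup>2) \<in> borel_measurable Q" using vm[OF n i] by simp
    show "AE z in Q. norm ((v n z $ i)\<^sup>2) \<le> norm ((vnorm (v n z))\<^sup>2)"
    proof (rule AE_I2)
      fix z assume "z \<in> space Q"
      then have "\<bar>v n z $ i\<bar> \<le> vnorm (v n z)"
        using abs_coord_le_nrm[OF i, of "($) (v n z)"] vnorm_eq_nrm[OF vc[OF n]] by simp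
      then have "\<bar>v n z $ i\<bar>\<^sup>2 \<le> (vnorm (v n z))\<^sup>2" by (rule power_mono) simp
      then show "norm ((v n z $ i)\<^sup>2) \<le> norm ((vnorm (v n z))\<^sup>2)" by simp
    qed
  qed
  have vi: "integrable Q (\<lambda>z. v n z $ i)" if "1 \<le> n" "i < m n" for n i
    by (rule square_integrable_imp[OF prob_Q vm[OF that] v2[OF that]])
  have vv: "integrable Q (\<lambda>z. v n z $ i * v n z $ k)" if "1 \<le> n" "i < m n" "k < m n" for n i k
    by (intro square_integrable_mult vm v2 that)
  have v0: "(\<integral>z. v n z $ i \<partial>Q) = 0" if "1 \<le> n" "i < m n" for n i
  proof -
    have "integral_vec (m n) Q (v n) $ i = 0\<^sub>v (m n) $ i" using v_mean[OF that(1)] by simp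
    then show ?thesis using that by (simp add: integral_vec_def)
  qed

  \<comment> \<open>At n = 0 the hypotheses are silent, while the array structure is required for
    every n; the zero function is a harmless value there.\<close>
  define X where "X = (\<lambda>n z. if n = 0 then (\<lambda>_. 0) else mv (m n) (Bf n) (($) (v n z)))"
  have X: "X n z = mv (m n) (Bf n) (($) (v n z))" if "1 \<le> n" for n z using that by (simp add: X_def)
  have iid: "iid_vectors M Q Z {1..n} (m n) (X n)" for n
  proof (intro iid_vectors.intro iid_sample.intro iid_sample_axioms.intro iid_vectors_axioms.intro)
    show "M.indep_vars (\<lambda>_. Q) Z {1..n}" by (rule M.indep_vars_subset[OF indep]) auto
    show "distr M Q (Z j) = Q" if "j \<in> {1..n}" for j using distr_Z[of j] that by simp
    fix a assume a: "a < m n"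
    show "(\<lambda>z. X n z a) \<in> borel_measurable Q" "integrable Q (\<lambda>z. (X n z a)\<^sup>2)" "(\<integral>z. X n z a \<partial>Q) = 0"
    proof (atomize(full), cases "n = 0")
      case False
      then have n: "1 \<le> n" by simp
      have "(\<lambda>z. mv (m n) (Bf n) (($) (v n z)) a) \<in> borel_measurable Q"
        unfolding mv_def by (intro borel_measurable_sum borel_measurable_times borel_measurable_const vm n) auto
      moreover have "(mv (m n) (Bf n) (($) (v n z)) a)\<^sup>2
        = (\<Sum>i<m n. \<Sum>k<m n. Bf n a i * Bf n a k * (v n z $ i * v n z $ k))" for z
        unfolding mv_def power2_eq_square sum_product by (intro sum.cong refl) simp
      moreover have "integrable Q (\<lambda>z. \<Sum>i<m n. \<Sum>k<m n. Bf n a i * Bf n a k * (v n z $ i * v n z $ k))"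
        by (intro Bochner_Integration.integrable_sum integrable_mult_right vv n) auto
      moreover have "(\<integral>z. mv (m n) (Bf n) (($) (v n z)) a \<partial>Q) = 0"
      proof -
        have "(\<integral>z. mv (m n) (Bf n) (($) (v n z)) a \<partial>Q) = (\<Sum>i<m n. \<integral>z. Bf n a i * v n z $ i \<partial>Q)"
          unfolding mv_def
          by (rule Bochner_Integration.integral_sum) (rule integrable_mult_right, rule vi[OF n], simp)
        also have "\<dots> = 0" by (intro sum.neutral ballI) (simp add: v0[OF n])
        finally show ?thesis .
      qed
      ultimately show "(\<lambda>z. X n z a) \<in> borel_measurable Q \<and> integrable Q (\<lambda>z. (X n z a)\<^sup>2) \<and> (\<integral>z. X n z a \<partial>Q) = 0"
        unfolding X[OF n] by simp
    qed (simp add: X_def)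
  qed (simp_all add: prob_M prob_Q)

  have Uc: "U n \<in> carrier_mat (m n) (m n)" if "1 \<le> n" for n
  proof -
    have "integral_mat (m n) Q (\<lambda>z. outer (v n z) (v n z)) \<in> carrier_mat (m n) (m n)"
      by (simp add: integral_mat_def)
    then show ?thesis
      unfolding U_def[OF that] using B_carrier[OF that] by (intro mult_carrier_mat[of _ "m n" "m n"])
  qed
  \<comment> \<open>This identifies \<open>V\<close> with the dispersion matrix of the problem, so
    that \<open>trV\<close> and \<open>T2\<close> become the traces of U_n and of its
    square.\<close>
  have V_eq: "iid_vectors.V Q (X n) a b = U n $$ (a, b)" if n: "1 \<le> n" and ab: "a < m n" "b < m n" for n a b
  proof -
    let ?K = "\<lambda>l k. \<integral>z. v n z $ l * v n z $ k \<partial>Q"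
    let ?VM = "integral_mat (m n) Q (\<lambda>z. outer (v n z) (v n z))"
    have VM: "?VM $$ (l, k) = ?K l k" if "l < m n" "k < m n" for l k
    proof -
      have "(\<integral>z. outer (v n z) (v n z) $$ (l, k) \<partial>Q) = ?K l k"
      proof (rule Bochner_Integration.integral_cong[OF refl])
        fix z assume "z \<in> space Q"
        then have "dim_vec (v n z) = m n" using vc[OF n] by auto
        then show "outer (v n z) (v n z) $$ (l, k) = v n z $ l * v n z $ k" using that by (simp add: outer_index)
      qed
      then show ?thesis using that by (simp add: integral_mat_def)
    qed
    have "iid_vectors.V Q (X n) a b = (\<integral>z. X n z a * X n z b \<partial>Q)"
      by (rule iid_vectors.V_def[OF iid])
    also have "\<dots> = (\<integral>z. (\<Sum>k<m n. \<Sum>l<m n. Bf n a l * Bf n k b * (v n z $ l * v n z $ k)) \<partial>Q)"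
    proof (intro Bochner_Integration.integral_cong refl)
      fix z
      have "X n z a * X n z b = (\<Sum>l<m n. \<Sum>k<m n. Bf n a l * Bf n b k * (v n z $ l * v n z $ k))"
        unfolding X[OF n] mv_def sum_product by (intro sum.cong refl) simp
      also have "\<dots> = (\<Sum>l<m n. \<Sum>k<m n. Bf n a l * Bf n k b * (v n z $ l * v n z $ k))"
        using ab by (intro sum.cong refl) (simp add: B_entry_sym[OF n, of b])
      also have "\<dots> = (\<Sum>k<m n. \<Sum>l<m n. Bf n a l * Bf n k b * (v n z $ l * v n z $ k))"
        by (rule sum.swap)
      finally show "X n z a * X n z b = (\<Sum>k<m n. \<Sum>l<m n. Bf n a l * Bf n k b * (v n z $ l * v n z $ k))" .
    qed
    also have "\<dots> = (\<Sum>k<m n. \<Sum>l<m n. Bf n a l * Bf n k b * ?K l k)"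
      by (subst integral_double_sum[OF integrable_mult_right[OF vv[OF n]]]) (simp_all only: integral_mult_right_zero)
    also have "\<dots> = (\<Sum>k<m n. (\<Sum>l<m n. Bf n a l * ?VM $$ (l, k)) * Bf n k b)"
      unfolding sum_distrib_right by (intro sum.cong refl) (simp add: VM)
    also have "\<dots> = U n $$ (a, b)"
      unfolding U_def[OF n] Bf_def
      by (rule triple_product_index[symmetric, OF B_carrier[OF n] _ ab]) (simp add: integral_mat_def)
    finally show ?thesis .
  qed
  have trV: "iid_vectors.trV Q (m n) (X n) = mat_trace (U n)" if n: "1 \<le> n" for n
    unfolding iid_vectors.trV_def[OF iid] mat_trace_def using Uc[OF n] by (auto intro!: sum.cong simp: V_eq[OF n])
  have T2: "iid_vectors.T2 Q (m n) (X n) = mat_trace (U n * U n)" if n: "1 \<le> n" for n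
  proof -
    have "iid_vectors.T2 Q (m n) (X n) = (\<Sum>a<m n. \<Sum>b<m n. iid_vectors.V Q (X n) a b * iid_vectors.V Q (X n) b a)"
      unfolding iid_vectors.T2_eq[OF iid] by (simp add: iid_vectors.V_sym[OF iid])
    also have "\<dots> = (\<Sum>a<m n. \<Sum>b<m n. U n $$ (a, b) * U n $$ (b, a))"
      by (intro sum.cong refl) (simp add: V_eq[OF n])
    finally show ?thesis by (simp add: mat_trace_square[OF Uc[OF n]])
  qed
  obtain K where K: "\<forall>\<^sub>F n in sequentially. norm (op_norm (U n)) \<le> K * norm (1::real)"
    using U_bounded by (rule landau_o.bigE)
  define C where "C = max 1 K"
  have C: "1 \<le> C" by (simp add: C_def)
  have mvV: "mv (m n) (iid_vectors.V Q (X n)) u i = mv (m n) (\<lambda>i k. U n $$ (i, k)) u i" if "1 \<le> n" "i < m n" for n u i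
    using that by (intro mv_cong refl V_eq)
  have nV: "\<forall>\<^sub>F n in sequentially. \<forall>u. nrm (m n) (mv (m n) (iid_vectors.V Q (X n)) u) \<le> C * nrm (m n) u"
    using K eventually_ge_at_top[of 1]
  proof eventually_elim
    case (elim n)
    have "op_norm (U n) \<le> C" using elim(1) by (auto simp: C_def le_max_iff_disj)
    then have "nrm (m n) (mv (m n) (\<lambda>i k. U n $$ (i, k)) u) \<le> C * nrm (m n) u" for u
      using op_norm_le_iff[OF Uc[OF elim(2)] m_pos[OF elim(2)]] by blast
    moreover have "nrm (m n) (mv (m n) (iid_vectors.V Q (X n)) u) = nrm (m n) (mv (m n) (\<lambda>i k. U n $$ (i, k)) u)" for u
      by (rule nrm_cong) (rule mvV[OF elim(2)])
    ultimately show ?case by simp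
  qed
  obtain C' where C': "\<And>n. 1 \<le> n \<Longrightarrow> 0 < mat_trace (U n * U n) \<and> real (m n) / mat_trace (U n * U n) \<le> C'"
    using trace_ratio by blast
  \<comment> \<open>The bounded ratio of m_n and trace (U_n^2) becomes a lower bound c m_n on the
    trace; the maximum with 1 makes c positive.\<close>
  define c where "c = 1 / max 1 C'"
  have c: "0 < c" by (simp add: c_def)
  have T2c: "c * real (m n) \<le> mat_trace (U n * U n)" if "1 \<le> n" for n
  proof -
    have "real (m n) \<le> C' * mat_trace (U n * U n)" 
      by (rule pos_divide_le_eq[THEN iffD1, OF conjunct1[OF C'[OF that]] conjunct2[OF C'[OF that]]])
    also have "\<dots> \<le> max 1 C' * mat_trace (U n * U n)" 
      by (intro mult_right_mono less_imp_le[OF conjunct1[OF C'[OF that]]]) simp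
    finally show ?thesis by (simp add: c_def pos_divide_le_eq mult.commute)
  qed
  have arr: "vector_array M Q Z m X C c"
  proof (rule vector_array.intro[OF iid C c m_lim])
    show "\<forall>\<^sub>F n in sequentially. \<forall>u. dot (m n) u (mv (m n) (iid_vectors.V Q (X n)) u) \<le> C * dot (m n) u u"
      using nV
    proof eventually_elim
      case (elim n)
      show ?case
      proof
        fix u
        have "dot (m n) u (mv (m n) (iid_vectors.V Q (X n)) u) \<le> nrm (m n) u * nrm (m n) (mv (m n) (iid_vectors.V Q (X n)) u)"
          by (rule abs_le_D1[OF dot_le_nrm])
        also have "\<dots> \<le> nrm (m n) u * (C * nrm (m n) u)" using elim by (intro mult_left_mono) auto
        also have "\<dots> = C * dot (m n) u u" by (simp add: nrm_power2[symmetric] power2_eq_square)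
        finally show "dot (m n) u (mv (m n) (iid_vectors.V Q (X n)) u) \<le> C * dot (m n) u u" .
      qed
    qed
    show "\<forall>\<^sub>F n in sequentially. \<forall>u. dot (m n) (mv (m n) (iid_vectors.V Q (X n)) u)
      (mv (m n) (iid_vectors.V Q (X n)) u) \<le> C\<^sup>2 * dot (m n) u u"
      using nV
    proof eventually_elim
      case (elim n)
      show ?case
      proof
        fix u
        have "(nrm (m n) (mv (m n) (iid_vectors.V Q (X n)) u))\<^sup>2 \<le> (C * nrm (m n) u)\<^sup>2"
          using elim by (intro power_mono) auto
        then show "dot (m n) (mv (m n) (iid_vectors.V Q (X n)) u) (mv (m n) (iid_vectors.V Q (X n)) u) \<le> C\<^sup>2 * dot (m n) u u"
          by (simp add: nrm_power2 power_mult_distrib)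
      qed
    qed
    show "\<forall>\<^sub>F n in sequentially. c * real (m n) \<le> iid_vectors.T2 Q (m n) (X n)"
      using eventually_ge_at_top[of 1] by eventually_elim (simp add: T2 T2c)
    fix e :: real assume e: "0 < e"
    let ?t = "\<lambda>n. iid_vectors.tail Q {1..n} (m n) (X n) e"
    \<comment> \<open>Since |X| <= |v| / sqrt c0, the event |X| > e sqrt n forces |v| > e sqrt c0
      sqrt n. This transfers the Lindeberg property from |v_n| to the normalised vectors.\<close>
    let ?e = "e * sqrt c0"
    let ?L = "\<lambda>n. \<integral>\<^sup>+z. ennreal (\<bar>vnorm (v n z)\<bar>\<^sup>2) * indicator {z. \<bar>vnorm (v n z)\<bar> > ?e * sqrt (real n)} z \<partial>Q"
    have "0 < ?e" using e c0 by simp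
    then have L: "?L \<longlonglongrightarrow> 0" using v_lindeberg unfolding lindeberg_def by blast
    have U: "\<forall>\<^sub>F n in sequentially. ennreal (?t n) \<le> ennreal (1 / c0) * ?L n"
      using eventually_ge_at_top[of 1]
    proof eventually_elim
      case (elim n)
      let ?f = "\<lambda>z. dot (m n) (X n z) (X n z) * indicator {z. e * sqrt (real (card {1..n})) < nrm (m n) (X n z)} z"
      have "ennreal (?t n) = (\<integral>\<^sup>+z. ennreal (?f z) \<partial>Q)"
        unfolding iid_vectors.tail_def[OF iid]
        by (rule nn_integral_eq_integral[symmetric, OF iid_vectors.tail_integrable[OF iid]]) simp
      also have "\<dots> \<le> (\<integral>\<^sup>+z. ennreal (1 / c0) * (ennreal (\<bar>vnorm (v n z)\<bar>\<^sup>2) *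
          indicator {z. \<bar>vnorm (v n z)\<bar> > ?e * sqrt (real n)} z) \<partial>Q)"
      proof (rule nn_integral_mono)
        fix z assume z: "z \<in> space Q"
        have vn: "vnorm (v n z) = nrm (m n) (($) (v n z))" by (rule vnorm_eq_nrm[OF vc[OF elim z]])
        have d: "dot (m n) (X n z) (X n z) \<le> 1 / c0 * (vnorm (v n z))\<^sup>2"
          using B_upper[OF elim, of "($) (v n z)"] c0 unfolding X[OF elim] vn nrm_power2
          by (simp add: pos_le_divide_eq mult.commute)
        have nd: "sqrt c0 * nrm (m n) (X n z) \<le> vnorm (v n z)"
        proof -
          have "sqrt (c0 * dot (m n) (X n z) (X n z)) \<le> sqrt (dot (m n) (($) (v n z)) (($) (v n z)))"
            unfolding X[OF elim] by (intro real_sqrt_le_mono B_upper elim)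
          then show ?thesis by (simp add: vn nrm_def real_sqrt_mult)
        qed
        show "ennreal (?f z) \<le> ennreal (1 / c0) * (ennreal (\<bar>vnorm (v n z)\<bar>\<^sup>2) *
          indicator {z. \<bar>vnorm (v n z)\<bar> > ?e * sqrt (real n)} z)"
        proof (cases "e * sqrt (real (card {1..n})) < nrm (m n) (X n z)")
          case True
          then have "sqrt c0 * (e * sqrt (real n)) < sqrt c0 * nrm (m n) (X n z)" using c0 by simp
          then have "?e * sqrt (real n) < \<bar>vnorm (v n z)\<bar>" using nd by (simp add: mult_ac)
          then show ?thesis
            using True d c0 by (simp add: ennreal_mult'[symmetric] ennreal_leI)
        qed simp
      qed
      also have "\<dots> = ennreal (1 / c0) * ?L n"
      proof (rule nn_integral_cmult)
        have "(\<lambda>z. nrm (m n) (($) (v n z))) \<in> borel_measurable Q"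
          unfolding nrm_def dot_def
          by (intro measurable_compose[OF _ borel_measurable_sqrt] borel_measurable_sum borel_measurable_times vm elim) auto
        then have [measurable]: "(\<lambda>z. vnorm (v n z)) \<in> borel_measurable Q"
          by (subst measurable_cong[where g = "\<lambda>z. nrm (m n) (($) (v n z))"])
            (use vnorm_eq_nrm[OF vc[OF elim]] in auto)
        show "(\<lambda>z. ennreal (\<bar>vnorm (v n z)\<bar>\<^sup>2) * indicator {z. \<bar>vnorm (v n z)\<bar> > ?e * sqrt (real n)} z) \<in> borel_measurable Q"
          unfolding indicator_def by measurable
      qed
      finally show ?case .
    qed
    have "(\<lambda>n. ennreal (1 / c0) * ?L n) \<longlonglongrightarrow> ennreal (1 / c0) * 0"
      by (rule ennreal_tendsto_cmult[OF _ L]) simp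
    then have L': "(\<lambda>n. ennreal (1 / c0) * ?L n) \<longlonglongrightarrow> 0" by simp
    have "(\<lambda>n. ennreal (?t n)) \<longlonglongrightarrow> ennreal 0"
      unfolding ennreal_0 by (rule tendsto_sandwich[OF _ U tendsto_const L']) simp
    then show "?t \<longlonglongrightarrow> 0"
    proof (rule tendsto_ennreal_iff[THEN iffD1, rotated 2])
      show "\<forall>\<^sub>F n in sequentially. 0 \<le> ?t n"
        by (rule always_eventually, rule allI, rule iid_vectors.tail_nonneg[OF iid])
    qed simp
  qed
  interpret arr: vector_array M Q Z m X C c by (rule arr)

  let ?R = "\<lambda>n \<omega>. emp_lik (m n) n (x n \<omega>)"
  let ?tr = "\<lambda>n. mat_trace (U n)"
  let ?s = "\<lambda>n. sqrt (2 * mat_trace (U n * U n))"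
  let ?Y = "\<lambda>n \<omega>. arr.A.qf n {1..n} (arr.zeta \<omega>)"
  have s_pos: "0 < ?s n" if "1 \<le> n" for n using conjunct1[OF C'[OF that]] by simp
  have xc: "x n \<omega> j \<in> carrier_vec (m n)" if "\<omega> \<in> space M" "1 \<le> j" "j \<le> n" for n \<omega> j
    using x_meas[OF that(2,3)] that(1) by (auto simp: measurable_vec_def)
  have xm: "(\<lambda>\<omega>. x n \<omega> j $ i) \<in> borel_measurable M" if "1 \<le> j" "j \<le> n" "i < m n" for n j i
    using x_meas[OF that(1,2)] that(3) by (auto simp: measurable_vec_def)
  have Zm: "Z j \<in> measurable M Q" if "1 \<le> j" for j
    using indep that unfolding M.indep_vars_def2 by simp
  have R0: "0 \<le> ?R n \<omega>" if "1 \<le> n" "\<omega> \<in> space M" for n \<omega>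
    by (rule emp_lik_nonneg[OF that(1)]) (rule xc[OF that(2)])

  show ?thesis
    unfolding asymp_std_normal_def
  proof (rule allI)
    fix t :: real
    let ?E = "\<lambda>n. {\<omega> \<in> space M. (neg2log (?R n \<omega>) - ereal (?tr n)) / ereal (?s n) \<le> ereal t}"
    show "(\<lambda>n. M.prob (?E n)) \<longlonglongrightarrow> cdf std_normal_distribution t"
    proof (rule M.slutsky_cdf[where Y = ?Y and F = "cdf std_normal_distribution" and E = ?E and t = t])
      show "?Y n \<in> borel_measurable M" for n by (rule arr.A.qf_measurable[OF order_refl])
      show "(\<lambda>n. M.prob {\<omega> \<in> space M. ?Y n \<omega> \<le> t'}) \<longlonglongrightarrow> cdf std_normal_distribution t'" for t'
        by (rule arr.qf_cdf_tendsto)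
      show "isCont (cdf std_normal_distribution) t" by (rule isCont_cdf_std_normal)
      show "\<forall>\<^sub>F n in sequentially. ?E n \<in> M.events"
        using eventually_ge_at_top[of 1]
      proof eventually_elim
        case (elim n)
        have "?E n = {\<omega> \<in> space M. exp (- (t * ?s n + ?tr n) / 2) \<le> ?R n \<omega>}"
          by (intro Collect_cong conj_cong refl neg2log_stat_level R0 elim s_pos)
        also have "\<dots> \<in> M.events" by (rule emp_lik_level_measurable[OF elim exp_gt_zero x_meas])
        finally show ?case .
      qed
      fix \<epsilon> :: real assume \<epsilon>: "0 < \<epsilon>"
      define \<kappa> where "\<kappa> = 1 + sqrt (2 * C * c1)"
      have \<kappa>: "0 < \<kappa>" using C c1 by (simp add: \<kappa>_def add_pos_nonneg)
      define K1 where "K1 = el_const c0 c1 \<kappa>"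
      have K1: "0 < K1" using \<kappa> c0 c1 by (simp add: K1_def el_const_def add_pos_pos)
      \<comment> \<open>The likelihood error and the diagonal error will each be at most eta sqrt m.
        Their sum is then at most epsilon sqrt (2 c m), which is at most epsilon times the
        denominator of the statistic.\<close>
      define \<eta> where "\<eta> = \<epsilon> * sqrt (2 * c) / 2"
      have \<eta>: "0 < \<eta>" using \<epsilon> c by (simp add: \<eta>_def)
      \<comment> \<open>The first three bounds are the smallness conditions of
        \<open>el_statistic_close\<close>, with 72 = 9 * 8. The fourth makes the likelihood error at
        most eta sqrt m.\<close>
      define \<delta> where "\<delta> = Min {1, c0 / 2, c0 / (72 * \<kappa>), \<eta> / K1}"
      have \<delta>0: "0 < \<delta>" using c0 \<kappa> \<eta> K1 by (simp add: \<delta>_def)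
      have \<delta>: "\<delta> \<le> 1" "\<delta> \<le> c0 / 2" "\<delta> \<le> c0 / (72 * \<kappa>)" "\<delta> \<le> \<eta> / K1"
        unfolding \<delta>_def by (rule Min_le; simp)+
      have \<delta>8: "9 * \<kappa> / c0 * \<delta> \<le> 1 / 8"
        using mult_left_mono[OF \<delta>(3), of "9 * \<kappa> / c0"] \<kappa> c0 by simp
      let ?F1 = "\<lambda>n \<omega>. real (m n) * (MAX j\<in>{1..n}. vnorm (x n \<omega> j)) / sqrt (real n)"
      let ?F2 = "\<lambda>n \<omega>. op_norm (W_hat n \<omega> - W n) / (1 / sqrt (real (m n)))"
      let ?F3 = "\<lambda>n \<omega>. vnorm (mean_vec (m n) n (x n \<omega>) - mean_vec (m n) n (\<lambda>j. v n (Z j \<omega>))) / (1 / sqrt (real n))"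
      let ?F4 = "\<lambda>n \<omega>. \<bar>(\<Sum>j\<in>{1..n}. dot (m n) (X n (Z j \<omega>)) (X n (Z j \<omega>))) - real n * arr.A.trV n\<bar>"
      let ?F5 = "\<lambda>n \<omega>. dot (m n) (arr.A.S n {1..n} (arr.zeta \<omega>)) (arr.A.S n {1..n} (arr.zeta \<omega>))"
      \<comment> \<open>The exceptional sets: B1 to B3 are the three o_p hypotheses, B4 is the
        deviation of the diagonal and B5 an unusually large sum S.\<close>
      define B1 where "B1 = (\<lambda>n. {\<omega> \<in> space M. \<bar>?F1 n \<omega>\<bar> > \<delta>})"
      define B2 where "B2 = (\<lambda>n. {\<omega> \<in> space M. \<bar>?F2 n \<omega>\<bar> > \<delta>})"
      define B3 where "B3 = (\<lambda>n. {\<omega> \<in> space M. \<bar>?F3 n \<omega>\<bar> > \<delta>})"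
      define B4 where "B4 = (\<lambda>n. {\<omega> \<in> space M. \<eta> * (real n * sqrt (real (m n))) < ?F4 n \<omega>})"
      define B5 where "B5 = (\<lambda>n. {\<omega> \<in> space M. 2 * C * (real n * real (m n)) < ?F5 n \<omega>})"
      have P1: "(\<lambda>n. M.prob (B1 n)) \<longlonglongrightarrow> 0" using max_op \<delta>0 unfolding small_o_p_def B1_def by blast
      have P2: "(\<lambda>n. M.prob (B2 n)) \<longlonglongrightarrow> 0" using W_hat_op \<delta>0 unfolding small_o_p_def B2_def by blast
      have P3: "(\<lambda>n. M.prob (B3 n)) \<longlonglongrightarrow> 0" using expansion \<delta>0 unfolding small_o_p_def B3_def by blast
      have P4: "(\<lambda>n. M.prob (B4 n)) \<longlonglongrightarrow> 0" unfolding B4_def by (rule arr.diagonal_negligible[OF \<eta>])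
      have P5: "(\<lambda>n. M.prob (B5 n)) \<longlonglongrightarrow> 0" unfolding B5_def by (rule arr.large_sum_negligible)
      have ge1: "\<forall>\<^sub>F n in sequentially. 1 \<le> (n::nat)" by (rule eventually_ge_at_top)
      \<comment> \<open>Because \<open>measure\<close> is 0 on non-measurable sets, the limits P1 to
        P3 can enter a union bound only once the sets are known to be events.\<close>
      have E1: "\<forall>\<^sub>F n in sequentially. B1 n \<in> M.events"
        using ge1
      proof eventually_elim
        case (elim n)
        have "(\<lambda>\<omega>. MAX j\<in>{1..n}. vnorm (x n \<omega> j)) \<in> borel_measurable M"
          by (rule max_vnorm_measurable[OF x_meas])
        then show ?case unfolding B1_def by measurable
      qed
      have E2: "\<forall>\<^sub>F n in sequentially. B2 n \<in> M.events"
        using ge1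
      proof eventually_elim
        case (elim n)
          have "{\<omega> \<in> space M. op_norm (W_hat n \<omega> - W n) \<le> a} \<in> M.events" for a
          unfolding W_hat_def[OF elim]
          by (rule op_norm_sample_cov_measurable[OF x_meas m_pos[OF elim] Wc[OF elim]])
        then have "(\<lambda>\<omega>. op_norm (W_hat n \<omega> - W n)) \<in> borel_measurable M"
          by (simp add: borel_measurable_iff_le)
        then show ?case unfolding B2_def by measurable
      qed
      have E3: "\<forall>\<^sub>F n in sequentially. B3 n \<in> M.events"
        using ge1
      proof eventually_elim
        case (elim n)
        have "(\<lambda>\<omega>. v n (Z j \<omega>) $ i) \<in> borel_measurable M" if "1 \<le> j" "j \<le> n" "i < m n" for i j
          by (rule measurable_compose[OF Zm[OF that(1)] vm[OF elim that(3)]])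
        then have "(\<lambda>\<omega>. vnorm (mean_vec (m n) n (x n \<omega>) - mean_vec (m n) n (\<lambda>j. v n (Z j \<omega>)))) \<in> borel_measurable M"
          unfolding vnorm_mean_diff nrm_def dot_def
          by (intro measurable_compose[OF _ borel_measurable_sqrt] borel_measurable_sum borel_measurable_times
              borel_measurable_diff borel_measurable_divide borel_measurable_const xm) auto
        then show ?case unfolding B3_def by measurable
      qed
      have E4: "\<forall>\<^sub>F n in sequentially. B4 n \<in> M.events"
      proof (rule always_eventually, rule allI)
        fix n
        have "(\<lambda>\<omega>. \<Sum>j\<in>{1..n}. dot (m n) (X n (Z j \<omega>)) (X n (Z j \<omega>))) \<in> borel_measurable M"
        proof (rule borel_measurable_sum)
          fix j assume "j \<in> {1..n}"
          then have "Z j \<in> measurable M Q" using Zm by simp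
          then show "(\<lambda>\<omega>. dot (m n) (X n (Z j \<omega>)) (X n (Z j \<omega>))) \<in> borel_measurable M"
            by (rule measurable_compose[OF _ borel_measurable_integrable[OF iid_vectors.dot_X_X_integrable[OF iid]]])
        qed
        then show "B4 n \<in> M.events" unfolding B4_def by measurable
      qed
      have E5: "\<forall>\<^sub>F n in sequentially. B5 n \<in> M.events"
      proof (rule always_eventually, rule allI)
        fix n
        have "?F5 n \<in> borel_measurable M" using arr.A.dot_S_integrable[of "{1..n}" n] by auto
        then show "B5 n \<in> M.events" unfolding B5_def by measurable
      qed
      note U2 = M.prob_Un_tendsto_zero[OF E1 E2 P1 P2]
      note U3 = M.prob_Un_tendsto_zero[OF U2(1) E3 U2(2) P3]
      note U4 = M.prob_Un_tendsto_zero[OF U3(1) E4 U3(2) P4]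
      note U5 = M.prob_Un_tendsto_zero[OF U4(1) E5 U4(2) P5]
      have close: "0 < ?R n \<omega> \<and> \<bar>(- 2 * ln (?R n \<omega>) - ?tr n) / ?s n - ?Y n \<omega>\<bar> \<le> \<epsilon>"
        if n: "1 \<le> n" and \<omega>: "\<omega> \<in> space M" "\<omega> \<notin> B1 n \<union> B2 n \<union> B3 n \<union> B4 n \<union> B5 n" for n \<omega>
      proof -
        have n0: "0 < real n" and d: "1 \<le> m n" and d0: "0 < real (m n)" using n m_pos[OF n] by auto
        have good: "\<bar>?F1 n \<omega>\<bar> \<le> \<delta>" "\<bar>?F2 n \<omega>\<bar> \<le> \<delta>" "\<bar>?F3 n \<omega>\<bar> \<le> \<delta>"
          "?F4 n \<omega> \<le> \<eta> * (real n * sqrt (real (m n)))" "?F5 n \<omega> \<le> 2 * C * (real n * real (m n))"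
          using \<omega> by (auto simp: B1_def B2_def B3_def B4_def B5_def not_less)
        have S: "arr.A.S n {1..n} (arr.zeta \<omega>) = (\<lambda>i. \<Sum>j\<in>{1..n}. mv (m n) (Bf n) (($) (v n (Z j \<omega>))) i)"
          by (rule ext) (simp only: iid_vectors.S_def[OF iid] X[OF n])
        have el: "0 < ?R n \<omega> \<and> \<bar>- 2 * ln (?R n \<omega>) - ?F5 n \<omega> / real n\<bar> \<le> \<delta> * sqrt (real (m n)) * K1"
          unfolding S K1_def
        proof (rule el_statistic_close[OF n d xc[OF \<omega>(1)] c0 c1 C \<kappa>_def less_imp_le[OF \<delta>0] \<delta>(1,2) \<delta>8 W_sym[OF n] _ _ B_sym[OF n] WBB[OF n] B_upper[OF n] B_lower[OF n]])
          show "c0 * dot (m n) u u \<le> dot (m n) u (mv (m n) (Wf n) u)" for u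
            unfolding Wf_def by (rule W_lower[OF n])
          show "dot (m n) u (mv (m n) (Wf n) u) \<le> c1 * dot (m n) u u" for u
            unfolding Wf_def by (rule W_upper[OF n])
          have "op_norm (W_hat n \<omega> - W n) \<le> \<delta> / sqrt (real (m n))"
            using good(2) d0 by (simp add: pos_le_divide_eq abs_le_iff)
          note opn = this[unfolded W_hat_def[OF n]]
          show "\<bar>(\<Sum>j\<in>{1..n}. (dot (m n) u (($) (x n \<omega> j)))\<^sup>2) / real n - dot (m n) u (mv (m n) (Wf n) u)\<bar>
            \<le> \<delta> / sqrt (real (m n)) * dot (m n) u u" for u
            unfolding Wf_def
            by (rule sample_covariance_form[OF _ m_pos[OF n] Wc[OF n] opn]) (rule xc[OF \<omega>(1)])
          show "real (m n) * nrm (m n) (($) (x n \<omega> j)) \<le> \<delta> * sqrt (real n)" if j: "j \<in> {1..n}" for j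
          proof -
            have "nrm (m n) (($) (x n \<omega> j)) = vnorm (x n \<omega> j)"
              using xc[OF \<omega>(1), of j n] j by (simp add: vnorm_eq_nrm)
            also have "\<dots> \<le> (MAX j\<in>{1..n}. vnorm (x n \<omega> j))" using j by (intro Max_ge) auto
            finally have "real (m n) * nrm (m n) (($) (x n \<omega> j)) \<le> real (m n) * (MAX j\<in>{1..n}. vnorm (x n \<omega> j))"
              by (intro mult_left_mono) auto
            also have "\<dots> \<le> \<delta> * sqrt (real n)"
              using good(1) n0 by (simp add: abs_le_iff pos_divide_le_eq)
            finally show ?thesis .
          qed
          have "vnorm (mean_vec (m n) n (x n \<omega>) - mean_vec (m n) n (\<lambda>j. v n (Z j \<omega>))) \<le> \<delta> / sqrt (real n)"
            using good(3) n0 by (simp add: pos_le_divide_eq abs_le_iff)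
          then show "nrm (m n) (\<lambda>i. (\<Sum>j\<in>{1..n}. x n \<omega> j $ i) / real n - (\<Sum>j\<in>{1..n}. v n (Z j \<omega>) $ i) / real n)
            \<le> \<delta> / sqrt (real n)"
            unfolding vnorm_mean_diff .
          show "dot (m n) (\<lambda>i. \<Sum>j\<in>{1..n}. mv (m n) (Bf n) (($) (v n (Z j \<omega>))) i)
            (\<lambda>i. \<Sum>j\<in>{1..n}. mv (m n) (Bf n) (($) (v n (Z j \<omega>))) i) \<le> 2 * C * (real n * real (m n))"
            using good(5) unfolding S .
        qed
        let ?D = "(\<Sum>j\<in>{1..n}. dot (m n) (X n (Z j \<omega>)) (X n (Z j \<omega>))) - real n * arr.A.trV n"
        have Y: "?Y n \<omega> = (?F5 n \<omega> - (\<Sum>j\<in>{1..n}. dot (m n) (X n (Z j \<omega>)) (X n (Z j \<omega>)))) / (real n * ?s n)"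
          unfolding iid_vectors.qf_def[OF iid] iid_vectors.scale_def[OF iid] iid_vectors.H_def[OF iid] dot_mv_unitv T2[OF n]
          by simp
        \<comment> \<open>The centring n trace (U_n) is added and subtracted, so the error splits
          into the likelihood approximation and the deviation ?D of the diagonal from its
          mean.\<close>
        have eq: "(- 2 * ln (?R n \<omega>) - ?tr n) / ?s n - ?Y n \<omega>
          = ((- 2 * ln (?R n \<omega>) - ?F5 n \<omega> / real n) + ?D / real n) / ?s n"
        proof -
          have "(L - tr) / s - (F - G) / (N * s) = ((L - F / N) + (G - N * tr) / N) / s"
            if "0 < N" "0 < s" for L F G N tr s :: real
            using that by (simp add: field_simps)
          from this[OF n0 s_pos[OF n]] show ?thesis unfolding Y trV[OF n] .
        qed
        have "\<bar>(- 2 * ln (?R n \<omega>) - ?tr n) / ?s n - ?Y n \<omega>\<bar> \<le> (\<delta> * sqrt (real (m n)) * K1 + \<eta> * sqrt (real (m n))) / ?s n"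
        proof -
          have "\<bar>?D / real n\<bar> \<le> \<eta> * sqrt (real (m n))"
            using good(4) n0 by (simp add: abs_divide pos_divide_le_eq mult_ac)
          then have "\<bar>(- 2 * ln (?R n \<omega>) - ?F5 n \<omega> / real n) + ?D / real n\<bar> \<le> \<delta> * sqrt (real (m n)) * K1 + \<eta> * sqrt (real (m n))"
            using el by linarith
          then show ?thesis unfolding eq using s_pos[OF n] by (simp add: abs_divide divide_right_mono)
        qed
        also have "\<dots> \<le> \<epsilon>"
        proof -
          have "\<delta> * K1 \<le> \<eta>" using \<delta>(4) K1 by (simp add: pos_le_divide_eq)
          then have "\<delta> * K1 * sqrt (real (m n)) \<le> \<eta> * sqrt (real (m n))" by (intro mult_right_mono) auto
          then have "\<delta> * sqrt (real (m n)) * K1 + \<eta> * sqrt (real (m n)) \<le> 2 * \<eta> * sqrt (real (m n))"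
            by (simp add: mult_ac)
          also have "\<dots> = \<epsilon> * sqrt (2 * (c * real (m n)))" by (simp add: \<eta>_def real_sqrt_mult)
          also have "\<dots> \<le> \<epsilon> * ?s n" using \<epsilon> T2c[OF n] by (intro mult_left_mono real_sqrt_le_mono) auto
          finally show ?thesis using s_pos[OF n] by (simp add: pos_divide_le_eq)
        qed
        finally show ?thesis using el by blast
      qed
      have "\<forall>\<^sub>F n in sequentially. {\<omega> \<in> space M. ?Y n \<omega> \<le> t - \<epsilon>} \<subseteq> ?E n \<union> (B1 n \<union> B2 n \<union> B3 n \<union> B4 n \<union> B5 n) \<and>
          ?E n \<subseteq> {\<omega> \<in> space M. ?Y n \<omega> \<le> t + \<epsilon>} \<union> (B1 n \<union> B2 n \<union> B3 n \<union> B4 n \<union> B5 n)"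
        using ge1
      proof eventually_elim
        case (elim n)
        note iff = neg2log_stat_le_iff[OF R0[OF elim] s_pos[OF elim], of _ "?tr n" t]
        show ?case
        proof (intro conjI subsetI)
          fix \<omega> assume a: "\<omega> \<in> {\<omega> \<in> space M. ?Y n \<omega> \<le> t - \<epsilon>}"
          show "\<omega> \<in> ?E n \<union> (B1 n \<union> B2 n \<union> B3 n \<union> B4 n \<union> B5 n)"
          proof (cases "\<omega> \<in> B1 n \<union> B2 n \<union> B3 n \<union> B4 n \<union> B5 n")
            case False
            have "0 < ?R n \<omega> \<and> (- 2 * ln (?R n \<omega>) - ?tr n) / ?s n \<le> t"
              using close[OF elim _ False] a by (auto simp: abs_le_iff)
            then show ?thesis using a iff[of \<omega>] by simp
          qed simp
        next
          fix \<omega> assume a: "\<omega> \<in> ?E n"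
          show "\<omega> \<in> {\<omega> \<in> space M. ?Y n \<omega> \<le> t + \<epsilon>} \<union> (B1 n \<union> B2 n \<union> B3 n \<union> B4 n \<union> B5 n)"
          proof (cases "\<omega> \<in> B1 n \<union> B2 n \<union> B3 n \<union> B4 n \<union> B5 n")
            case False
            have "(- 2 * ln (?R n \<omega>) - ?tr n) / ?s n \<le> t" using a iff[of \<omega>] by simp
            then have "?Y n \<omega> \<le> t + \<epsilon>" using close[OF elim _ False] a by (auto simp: abs_le_iff)
            then show ?thesis using a by simp
          qed simp
        qed
      qed
      with U5 show "\<exists>B. (\<forall>\<^sub>F n in sequentially. B n \<in> M.events) \<and> (\<lambda>n. M.prob (B n)) \<longlonglongrightarrow> 0 \<and>
        (\<forall>\<^sub>F n in sequentially. {\<omega> \<in> space M. ?Y n \<omega> \<le> t - \<epsilon>} \<subseteq> ?E n \<union> B n \<and>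
          ?E n \<subseteq> {\<omega> \<in> space M. ?Y n \<omega> \<le> t + \<epsilon>} \<union> B n)"
        by (intro exI[of _ "\<lambda>n. B1 n \<union> B2 n \<union> B3 n \<union> B4 n \<union> B5 n"] conjI)
    qed
  qed
qed

end
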